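(* Let $\Delta$ be a pure simplicial complex of dimension $m-1\ge2$ whose clique decomposition $\Delta=\Delta_1\cup\cdots\cup\Delta_r$ satisfies conditions (i) and (ii), and suppose that $G_\Delta$ is a tree. Then: (a) if $\Delta$ is closed, then $J_\Delta$ is a prime ideal; (b) $\Delta$ is closed if and only if each vertex $v_i$ of $G_\Delta$ has degree at most $\min\{|V(\Delta_i)|,\,2\dim\Delta\}$.
   Context: Let $K$ be a field, $X=(x_{ij})$ an $m\times n$ matrix of indeterminates, $S=K[X]$, and $\Delta$ a pure $(m-1)$-dimensional simplicial complex on $[n]$. For $1\le a_1<\dots<a_m\le n$, $[a_1\ldots a_m]$ is the maximal minor with columns $a_1,\dots,a_m$; $J_\Delta=(\mu_F : F\in\mathcal{F}(\Delta))$ with $\mu_F=[a_1\ldots a_m]$ for a facet $F=\{a_1<\dots<a_m\}$. Clique decomposition: let $\mathcal{S}$ be the set of simplices $\Gamma$ with vertices in $[n]$, $\dim\Gamma\ge m-1$, whose $(m-1)$-skeleton is contained in $\Delta$; the maximal elements $\Gamma_1,\dots,\Gamma_r$ of $\mathcal{S}$ give the cliques $\Delta_i=\Gamma_i^{(m-1)}$, $\Delta=\Delta_1\cup\cdots\cup\Delta_r$; $V(\Delta_i)$ is the vertex set of $\Delta_i$. Conditions: (i) $|V(\Delta_i)\cap V(\Delta_j)|\le1$ for all $i<j$; (ii) $V(\Delta_i)\cap V(\Delta_j)\cap V(\Delta_k)=\emptyset$ for all $i<j<k$. $G_\Delta$ is the simple graph on vertices $v_1,\dots,v_r$ with an edge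 $\{v_i,v_j\}$ ($i\ne j$) iff $V(\Delta_i)\cap V(\Delta_j)\ne\emptyset$. $\Delta$ is closed with respect to a labeling of its vertices by $[n]$ if for any two facets $F=\{a_1<\dots<a_m\}$, $G=\{b_1<\dots<b_m\}$ with $a_i=b_i$ for some $i$, every $m$-subset of $F\cup G$ is a facet of $\Delta$; $\Delta$ is closed if some labeling makes it closed (primality of $J_\Delta$ is independent of the labeling). *)

theory Defs
  imports "HOL-Library.Poly_Mapping" "HOL-Combinatorics.Permutations"
begin

type_synonym 'a mpoly = "((nat \<times> nat) \<Rightarrow>\<^sub>0 nat) \<Rightarrow>\<^sub>0 'a"

definition Xvar :: "nat \<Rightarrow> nat \<Rightarrow> 'a::comm_ring_1 mpoly" where
  "Xvar i j = Poly_Mapping.single (Poly_Mapping.single (i, j) 1) 1"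

definition polyring :: "nat \<Rightarrow> nat \<Rightarrow> 'a::comm_ring_1 mpoly set" where
  "polyring m n = {p :: 'a mpoly. \<forall>mon\<in>Poly_Mapping.keys p. Poly_Mapping.keys mon \<subseteq> ({1..m} \<times> {1..n})}"

definition minor :: "nat \<Rightarrow> nat set \<Rightarrow> 'a::comm_ring_1 mpoly" where
  "minor m F = (\<Sum>\<pi> | \<pi> permutes {1..m}.
      of_int (sign \<pi>) * (\<Prod>i\<in>{1..m}. Xvar i (sorted_list_of_set F ! (\<pi> i - 1))))"

definition ideal_gen :: "'a::comm_ring_1 set \<Rightarrow> 'a set \<Rightarrow> 'a set" where
  "ideal_gen R G = {(\<Sum>g\<in>T. c g * g) | T c. finite T \<and> T \<subseteq> G \<and> (\<forall>g\<in>T. c g \<in> R)}"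

definition prime_ideal_in :: "'a::comm_ring_1 set \<Rightarrow> 'a set \<Rightarrow> bool" where
  "prime_ideal_in R I \<longleftrightarrow>
     I \<subseteq> R \<and> 0 \<in> I \<and> (\<forall>a\<in>I. \<forall>b\<in>I. a + b \<in> I) \<and> (\<forall>r\<in>R. \<forall>a\<in>I. r * a \<in> I)
     \<and> I \<noteq> R \<and> (\<forall>a\<in>R. \<forall>b\<in>R. a * b \<in> I \<longrightarrow> a \<in> I \<or> b \<in> I)"

definition J_Delta :: "nat \<Rightarrow> nat \<Rightarrow> nat set set \<Rightarrow> 'a::comm_ring_1 mpoly set" where
  "J_Delta n m Fs = ideal_gen (polyring m n) (minor m ` Fs)"

text \<open>A pure (m-1)-dimensional simplicial complex on [n], given by its facets.\<close>
definition pure_complex :: "nat \<Rightarrow> nat \<Rightarrow> nat set set \<Rightarrow> bool" where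
  "pure_complex n m Fs \<longleftrightarrow> Fs \<noteq> {} \<and> (\<forall>F\<in>Fs. F \<subseteq> {1..n} \<and> card F = m)"

text \<open>Vertex sets W of simplices in the set S (dimension >= m-1, (m-1)-skeleton in Delta).\<close>
definition clique_simplex :: "nat \<Rightarrow> nat \<Rightarrow> nat set set \<Rightarrow> nat set \<Rightarrow> bool" where
  "clique_simplex n m Fs W \<longleftrightarrow> W \<subseteq> {1..n} \<and> m \<le> card W \<and>
     (\<forall>F. F \<subseteq> W \<and> card F = m \<longrightarrow> F \<in> Fs)"

text \<open>Vertex sets V(Delta_i) of the cliques (maximal elements of S).\<close>
definition cliques :: "nat \<Rightarrow> nat \<Rightarrow> nat set set \<Rightarrow> nat set set" where
  "cliques n m Fs = {W. clique_simplex n m Fs W \<and>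
     (\<forall>W'. clique_simplex n m Fs W' \<and> W \<subseteq> W' \<longrightarrow> W' = W)}"

definition cond_i :: "nat \<Rightarrow> nat \<Rightarrow> nat set set \<Rightarrow> bool" where
  "cond_i n m Fs \<longleftrightarrow> (\<forall>A\<in>cliques n m Fs. \<forall>B\<in>cliques n m Fs. A \<noteq> B \<longrightarrow> card (A \<inter> B) \<le> 1)"

definition cond_ii :: "nat \<Rightarrow> nat \<Rightarrow> nat set set \<Rightarrow> bool" where
  "cond_ii n m Fs \<longleftrightarrow> (\<forall>A\<in>cliques n m Fs. \<forall>B\<in>cliques n m Fs. \<forall>C\<in>cliques n m Fs.
      A \<noteq> B \<and> A \<noteq> C \<and> B \<noteq> C \<longrightarrow> A \<inter> B \<inter> C = {})"

definition G_adj :: "nat \<Rightarrow> nat \<Rightarrow> nat set set \<Rightarrow> nat set \<Rightarrow> nat set \<Rightarrow> bool" where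
  "G_adj n m Fs A B \<longleftrightarrow> A \<in> cliques n m Fs \<and> B \<in> cliques n m Fs \<and> A \<noteq> B \<and> A \<inter> B \<noteq> {}"

definition G_degree :: "nat \<Rightarrow> nat \<Rightarrow> nat set set \<Rightarrow> nat set \<Rightarrow> nat" where
  "G_degree n m Fs A = card {B. G_adj n m Fs A B}"

text \<open>Simple graph on finite vertex set V with symmetric irreflexive adjacency E.\<close>
definition has_cycle :: "'v set \<Rightarrow> ('v \<Rightarrow> 'v \<Rightarrow> bool) \<Rightarrow> bool" where
  "has_cycle V E \<longleftrightarrow> (\<exists>vs. 3 \<le> length vs \<and> distinct vs \<and> set vs \<subseteq> V \<and>
      (\<forall>i. Suc i < length vs \<longrightarrow> E (vs ! i) (vs ! Suc i)) \<and> E (last vs) (hd vs))"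

definition is_tree :: "'v set \<Rightarrow> ('v \<Rightarrow> 'v \<Rightarrow> bool) \<Rightarrow> bool" where
  "is_tree V E \<longleftrightarrow> finite V \<and> V \<noteq> {} \<and>
     (\<forall>u\<in>V. \<forall>v\<in>V. (\<lambda>x y. x \<in> V \<and> y \<in> V \<and> E x y)\<^sup>*\<^sup>* u v) \<and> \<not> has_cycle V E"

definition closed_wrt :: "nat \<Rightarrow> nat set set \<Rightarrow> bool" where
  "closed_wrt m Fs \<longleftrightarrow> (\<forall>F\<in>Fs. \<forall>G\<in>Fs.
      (\<exists>i<m. sorted_list_of_set F ! i = sorted_list_of_set G ! i) \<longrightarrow>
      (\<forall>H. H \<subseteq> F \<union> G \<and> card H = m \<longrightarrow> H \<in> Fs))"

definition is_closed :: "nat \<Rightarrow> nat \<Rightarrow> nat set set \<Rightarrow> bool" where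
  "is_closed n m Fs \<longleftrightarrow> (\<exists>\<sigma>. bij_betw \<sigma> {1..n} {1..n} \<and> closed_wrt m ((\<lambda>F. \<sigma> ` F) ` Fs))"

end

theory Submission
  imports Defs "HOL-Library.Product_Lexorder"
begin

text \<open>
  Two facets of different cliques that agree in some position violate closedness, so a labelling is
  closed iff at each vertex shared by two cliques the positions it can take in the facets of either
  clique form disjoint intervals. A shared vertex must then be among the first or the last
  \<open>m - 1\<close> vertices of its cliques, which bounds the degrees. Conversely, a tree of cliques is
  labelled clique by clique: the new clique goes entirely above (or below) everything labelled before,
  so that its attaching vertex is extremal in it and its other shared vertices can be put at the ends.

  For primality, cliques are attached to the tree one at a time at a vertex \<open>v\<close>. As \<open>J\<close> does not depend
  on the labelling, each step may use its own closed labelling, in which \<open>v\<close> is the last vertex of the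
  old clique and the first one of the new clique. The maximal minors of one clique form a Groebner basis
  (the monomials free of diagonals stay independent after substituting a generic linear combination
  of the other rows for the last row), and in a closed labelling the diagonals of different cliques are
  coprime, so the generators of \<open>J\<close> form a Groebner basis as well. Hence a certain \<open>(m - 1)\<close>-minor
  \<open>h\<close> of the new clique, whose leading monomial is coprime to all diagonals, is a nonzerodivisor
  modulo \<open>J\<close>, and after inverting \<open>h\<close> the new relations merely eliminate variables.
\<close>

text \<open>The bound \<open>m \<ge> 3\<close> enters primality through \<open>h\<close>. Its
  leading monomial is a shifted diagonal: row \<open>i\<close> meets the vertex in position
  \<open>i - 1\<close> of the new clique, so row 2 meets the attaching vertex \<open>v\<close>.
  Being last in the old clique, \<open>v\<close> stands there only in row \<open>m\<close>, which is
  not row 2. A clique with several attaching vertices has only one last vertex, so the labelling has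
  to change from step to step, and the old tree is re-rooted at the clique that receives the new
  one. The Groebner basis of one clique is obtained without S-polynomials. It suffices that no
  nontrivial combination of diagonal-free monomials lies in the ideal, and this is a triangularity
  statement: each such monomial is assigned one term of its image under the substitution, and a
  lexicographic weight vector controls all other monomials whose images contain that term. The term
  is the unique maximum of an additive weight on the image, so its coefficient is nonzero in every
  characteristic.\<close>

type_synonym mon = "(nat \<times> nat) \<Rightarrow>\<^sub>0 nat"

abbreviation "lookup \<equiv> Poly_Mapping.lookup"
abbreviation "keys \<equiv> Poly_Mapping.keys"
abbreviation "single \<equiv> Poly_Mapping.single"

section \<open>Polynomials and substitution\<close>

lemma lookup_sum_when:
  assumes "finite T"
  shows "lookup (\<Sum>t\<in>T. single t (c t)) k = (c k when k \<in> T)"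
proof -
  have "lookup (\<Sum>t\<in>T. single t (c t)) k = (\<Sum>t\<in>T. (if k = t then c t else 0))"
    by (simp add: lookup_sum lookup_single when_def eq_commute)
  then show ?thesis using assms by (simp add: when_def)
qed

lemma poly_sum_singles: "(\<Sum>t\<in>keys p. single t (lookup p t)) = p"
  by (rule poly_mapping_eqI) (simp add: lookup_sum_when when_def in_keys_iff)

lemma poly_single_induct [case_names single add]:
  assumes "\<And>t c. Q (single t c)" and "\<And>p q. Q p \<Longrightarrow> Q q \<Longrightarrow> Q (p + q)"
  shows "Q (p :: 'k \<Rightarrow>\<^sub>0 'b::comm_monoid_add)"
proof -
  have Q0: "Q 0" using assms(1)[of undefined 0] by simp
  have "Q (\<Sum>t\<in>T. single t (lookup p t))" if "finite T" for T
    using that by (induction T) (auto simp: Q0 intro: assms)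
  from this[of "keys p"] show ?thesis by (simp add: poly_sum_singles)
qed

lemma mult_as_sum:
  fixes p q :: "'k::monoid_add \<Rightarrow>\<^sub>0 'b::semiring_0"
  shows "p * q = (\<Sum>s\<in>keys p. \<Sum>t\<in>keys q. single (s + t) (lookup p s * lookup q t))"
proof -
  have "p * q = (\<Sum>s\<in>keys p. single s (lookup p s)) * (\<Sum>t\<in>keys q. single t (lookup q t))"
    by (simp add: poly_sum_singles)
  also have "\<dots> = (\<Sum>s\<in>keys p. \<Sum>t\<in>keys q. single s (lookup p s) * single t (lookup q t))"
    by (rule sum_product)
  finally show ?thesis by (simp add: mult_single)
qed

lemma lookup_times:
  fixes p q :: "'k::monoid_add \<Rightarrow>\<^sub>0 'b::semiring_0"
  shows "lookup (p * q) k =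
    (\<Sum>s\<in>keys p. \<Sum>t\<in>keys q. if s + t = k then lookup p s * lookup q t else 0)"
  by (simp add: mult_as_sum[of p q] lookup_sum lookup_single when_def)

lemma keys_times_E:
  fixes p q :: "'k::monoid_add \<Rightarrow>\<^sub>0 'b::semiring_0"
  assumes "k \<in> keys (p * q)"
  obtains s t where "s \<in> keys p" "t \<in> keys q" "k = s + t"
  using assms keys_mult by blast

definition monev :: "(nat \<times> nat \<Rightarrow> 'a::comm_ring_1 mpoly) \<Rightarrow> mon \<Rightarrow> 'a mpoly" where
  "monev f t = (\<Prod>v\<in>keys t. f v ^ lookup t v)"

definition subst :: "(nat \<times> nat \<Rightarrow> 'a::comm_ring_1 mpoly) \<Rightarrow> 'a mpoly \<Rightarrow> 'a mpoly" where
  "subst f p = (\<Sum>t\<in>keys p. single 0 (lookup p t) * monev f t)"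

lemma monev_superset:
  assumes "finite V" "keys t \<subseteq> V"
  shows "monev f t = (\<Prod>v\<in>V. f v ^ lookup t v)"
  unfolding monev_def by (rule prod.mono_neutral_left) (use assms in \<open>auto simp: in_keys_iff\<close>)

lemma keys_add_mon: "keys (s + t) = keys s \<union> keys (t :: 'v \<Rightarrow>\<^sub>0 nat)"
  by (auto simp: in_keys_iff lookup_add)

lemma monev_add: "monev f (s + t) = monev f s * monev f t"
proof -
  let ?V = "keys s \<union> keys t"
  have "monev f (s + t) = (\<Prod>v\<in>?V. f v ^ lookup (s + t) v)"
    by (rule monev_superset) (auto simp: keys_add_mon)
  also have "\<dots> = (\<Prod>v\<in>?V. f v ^ lookup s v) * (\<Prod>v\<in>?V. f v ^ lookup t v)"
    by (simp add: lookup_add power_add prod.distrib)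
  also have "\<dots> = monev f s * monev f t"
    by (subst (1 2) monev_superset[of ?V]) auto
  finally show ?thesis .
qed

lemma monev_0 [simp]: "monev f 0 = 1"
  by (simp add: monev_def)

lemma monev_single: "monev f (single v k) = f v ^ k"
  by (cases "k = 0") (auto simp: monev_def)

lemma subst_superset:
  assumes "finite T" "keys p \<subseteq> T"
  shows "subst f p = (\<Sum>t\<in>T. single 0 (lookup p t) * monev f t)"
  unfolding subst_def by (rule sum.mono_neutral_left) (use assms in \<open>auto simp: in_keys_iff\<close>)

lemma subst_add: "subst f (p + q) = subst f p + subst f q"
proof -
  let ?T = "keys p \<union> keys q"
  have "subst f (p + q) = (\<Sum>t\<in>?T. single 0 (lookup (p + q) t) * monev f t)"
    by (rule subst_superset) (use keys_add[of p q] in auto)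
  also have "\<dots> = (\<Sum>t\<in>?T. single 0 (lookup p t) * monev f t)
      + (\<Sum>t\<in>?T. single 0 (lookup q t) * monev f t)"
    by (simp add: lookup_add single_add algebra_simps sum.distrib)
  also have "\<dots> = subst f p + subst f q"
    by (subst (1 2) subst_superset[of ?T]) auto
  finally show ?thesis .
qed

lemma subst_single: "subst f (single t c) = single 0 c * monev f t"
  by (cases "c = 0") (auto simp: subst_def)

lemma subst_0 [simp]: "subst f 0 = 0"
  by (simp add: subst_def)

lemma subst_mult: "subst f (p * q) = subst f p * subst f q"
proof (induction p rule: poly_single_induct)
  case (single s c)
  show ?case
  proof (induction q rule: poly_single_induct)
    case (single t d)
    have eq: "single 0 (c * d) = single 0 c * (single 0 d :: 'a mpoly)"
      by (simp add: mult_single)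
    have "subst f (single s c * single t d) = single 0 (c * d) * (monev f s * monev f t)"
      by (simp only: mult_single subst_single monev_add)
    also have "\<dots> = (single 0 c * monev f s) * (single 0 d * monev f t)"
      by (simp only: eq mult_ac)
    finally show ?case by (simp only: subst_single)
  qed (simp add: subst_add algebra_simps)
qed (simp add: subst_add algebra_simps)

lemma subst_1 [simp]: "subst f 1 = 1"
  using subst_single[of f 0 1] by simp

lemma subst_sum: "subst f (sum g A) = (\<Sum>a\<in>A. subst f (g a))"
  by (induction A rule: infinite_finite_induct) (auto simp: subst_add)

lemma subst_prod: "subst f (prod g A) = (\<Prod>a\<in>A. subst f (g a))"
  by (induction A rule: infinite_finite_induct) (auto simp: subst_mult)

lemma subst_of_int [simp]: "subst f (of_int k) = of_int k"
proof -
  have "subst f (single 0 (of_int k)) = single 0 (of_int k)"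
    by (simp only: subst_single monev_0 mult_1_right)
  then show ?thesis by simp
qed

lemma subst_Xvar [simp]: "subst f (Xvar i j) = f (i, j)"
  by (simp add: Xvar_def subst_single monev_single)

lemma subst_subst: "subst f (subst g p) = subst (\<lambda>v. subst f (g v)) p"
proof (induction p rule: poly_single_induct)
  case (single t c)
  have "subst f (monev g t) = monev (\<lambda>v. subst f (g v)) t"
  proof -
    have "subst f (g v ^ k) = subst f (g v) ^ k" for v k
      by (induction k) (auto simp: subst_mult)
    then show ?thesis by (simp add: monev_def subst_prod)
  qed
  moreover have "subst f (single 0 c) = single 0 c"
    by (simp only: subst_single monev_0 mult_1_right)
  ultimately show ?case by (simp add: subst_single subst_mult)
qed (simp add: subst_add)

lemma monev_Xvar: "monev (\<lambda>(i, j). Xvar i j) t = (single t 1 :: 'a::comm_ring_1 mpoly)"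
proof -
  have "(single (single v 1) 1 :: 'a mpoly) ^ k = single (single v k) 1" for v :: "nat \<times> nat" and k
  proof (induction k)
    case (Suc k)
    have "single v 1 + single v k = single v (Suc k)"
      by (simp add: poly_mapping_eq_iff fun_eq_iff lookup_add lookup_single when_def)
    then show ?case using Suc by (simp add: mult_single)
  qed simp
  moreover have "(\<Prod>v\<in>V. single (single v (lookup t v)) 1) =
      (single (\<Sum>v\<in>V. single v (lookup t v)) 1 :: 'a mpoly)" if "finite V" for V
    using that by (induction V) (auto simp: mult_single)
  ultimately show ?thesis
    by (simp add: monev_def Xvar_def case_prod_beta poly_sum_singles)
qed

lemma subst_Xvar_id: "subst (\<lambda>(i, j). Xvar i j) p = p"
proof (induction p rule: poly_single_induct)
  case (single t c)
  show ?case by (simp add: subst_single monev_Xvar mult_single)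
qed (simp add: subst_add)

section \<open>Leading monomials and Groebner bases\<close>

text \<open>Arbitrary sets of cells are allowed, because later steps read off from membership that a
  polynomial avoids a certain row.\<close>

definition polys_in :: "(nat \<times> nat) set \<Rightarrow> 'a::comm_ring_1 mpoly set" where
  "polys_in B = {p. \<forall>t\<in>keys p. keys t \<subseteq> B}"

lemma polyring_eq: "polyring m n = polys_in ({1..m} \<times> {1..n})"
  by (simp add: polyring_def polys_in_def)

lemma polys_in_mono: "B \<subseteq> C \<Longrightarrow> p \<in> polys_in B \<Longrightarrow> p \<in> polys_in C"
  unfolding polys_in_def by blast

lemma polys_in_single [intro]: "keys t \<subseteq> B \<Longrightarrow> single t c \<in> polys_in B"
  by (simp add: polys_in_def)

lemma polys_in_0 [simp, intro]: "0 \<in> polys_in B"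
  by (simp add: polys_in_def)

lemma polys_in_1 [simp, intro]: "1 \<in> polys_in B"
  by (simp add: polys_in_def)

lemma polys_in_add [intro]: "p \<in> polys_in B \<Longrightarrow> q \<in> polys_in B \<Longrightarrow> p + q \<in> polys_in B"
  unfolding polys_in_def using keys_add[of p q] by blast

lemma polys_in_uminus [intro]: "p \<in> polys_in B \<Longrightarrow> - p \<in> polys_in B"
  by (simp add: polys_in_def in_keys_iff)

lemma polys_in_diff [intro]: "p \<in> polys_in B \<Longrightarrow> q \<in> polys_in B \<Longrightarrow> p - q \<in> polys_in B"
  using polys_in_add[of p B "- q"] by auto

lemma polys_in_mult [intro]: "p \<in> polys_in B \<Longrightarrow> q \<in> polys_in B \<Longrightarrow> p * q \<in> polys_in B"
  unfolding polys_in_def by (fastforce elim!: keys_times_E simp: keys_add_mon)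

lemma polys_in_sum [intro]: "(\<And>x. x \<in> A \<Longrightarrow> f x \<in> polys_in B) \<Longrightarrow> sum f A \<in> polys_in B"
  by (induction A rule: infinite_finite_induct) auto

lemma polys_in_prod [intro]: "(\<And>x. x \<in> A \<Longrightarrow> f x \<in> polys_in B) \<Longrightarrow> prod f A \<in> polys_in B"
  by (induction A rule: infinite_finite_induct) auto

lemma polys_in_power [intro]: "p \<in> polys_in B \<Longrightarrow> p ^ k \<in> polys_in B"
  by (induction k) auto

lemma polys_in_of_int [intro]: "of_int k \<in> polys_in B"
  using polys_in_single[of 0 B "of_int k"] by simp

lemma polys_in_Xvar [intro]: "(i, j) \<in> B \<Longrightarrow> Xvar i j \<in> polys_in B"
  by (auto simp: Xvar_def)

lemma subst_polys_in:
  assumes "p \<in> polys_in B" "\<And>v. v \<in> B \<Longrightarrow> f v \<in> polys_in C"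
  shows "subst f p \<in> polys_in C"
proof -
  have "monev f t \<in> polys_in C" if "t \<in> keys p" for t
    unfolding monev_def
    by (intro polys_in_prod polys_in_power assms(2)) (use assms(1) that in \<open>auto simp: polys_in_def\<close>)
  then show ?thesis unfolding subst_def by (intro polys_in_sum polys_in_mult) auto
qed

section \<open>Ideals in a polynomial ring on a set of cells, and their sums\<close>

definition ideal_in :: "'a::comm_ring_1 set \<Rightarrow> 'a set \<Rightarrow> bool" where
  "ideal_in R I \<longleftrightarrow> I \<subseteq> R \<and> 0 \<in> I \<and> (\<forall>a\<in>I. \<forall>b\<in>I. a + b \<in> I) \<and> (\<forall>r\<in>R. \<forall>a\<in>I. r * a \<in> I)"

lemma prime_ideal_in_iff:
  "prime_ideal_in R I \<longleftrightarrow> ideal_in R I \<and> I \<noteq> R \<and> (\<forall>a\<in>R. \<forall>b\<in>R. a * b \<in> I \<longrightarrow> a \<in> I \<or> b \<in> I)"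
  unfolding prime_ideal_in_def ideal_in_def by blast

lemma ideal_inD:
  assumes "ideal_in R I"
  shows "a \<in> I \<Longrightarrow> a \<in> R" "0 \<in> I" "a \<in> I \<Longrightarrow> b \<in> I \<Longrightarrow> a + b \<in> I"
    "r \<in> R \<Longrightarrow> a \<in> I \<Longrightarrow> r * a \<in> I"
  using assms unfolding ideal_in_def by blast+

lemma ideal_in_uminus:
  assumes "ideal_in (polys_in B) I" "a \<in> I" shows "- a \<in> I"
proof -
  have "(- 1) * a \<in> I" using assms by (intro ideal_inD(4)) auto
  then show ?thesis by simp
qed

lemma ideal_in_diff:
  assumes "ideal_in (polys_in B) I" "a \<in> I" "b \<in> I" shows "a - b \<in> I"
  using ideal_inD(3)[OF assms(1,2) ideal_in_uminus[OF assms(1,3)]] by simp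

lemma ideal_in_sum:
  assumes "ideal_in R I" "\<And>x. x \<in> A \<Longrightarrow> f x \<in> I" shows "sum f A \<in> I"
  using assms(2) by (induction A rule: infinite_finite_induct) (auto intro: ideal_inD[OF assms(1)])

lemma ideal_in_gen:
  assumes "G \<subseteq> polys_in B"
  shows "ideal_in (polys_in B) (ideal_gen (polys_in B) G)"
proof -
  have "a + b \<in> ideal_gen (polys_in B) G"
    if ab: "a \<in> ideal_gen (polys_in B) G" "b \<in> ideal_gen (polys_in B) G" for a b
  proof -
    obtain S c where S: "a = (\<Sum>g\<in>S. c g * g)" "finite S" "S \<subseteq> G" "\<forall>g\<in>S. c g \<in> polys_in B"
      using ab(1) unfolding ideal_gen_def by blast
    obtain T d where T: "b = (\<Sum>g\<in>T. d g * g)" "finite T" "T \<subseteq> G" "\<forall>g\<in>T. d g \<in> polys_in B"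
      using ab(2) unfolding ideal_gen_def by blast
    define e where "e g = (if g \<in> S then c g else 0) + (if g \<in> T then d g else 0)" for g
    have "(\<Sum>g\<in>S \<union> T. e g * g)
        = (\<Sum>g\<in>S \<union> T. (if g \<in> S then c g * g else 0)) + (\<Sum>g\<in>S \<union> T. (if g \<in> T then d g * g else 0))"
      unfolding sum.distrib[symmetric] by (rule sum.cong) (auto simp: e_def algebra_simps)
    also have "\<dots> = a + b"
      using S T by (simp add: sum.If_cases Int_absorb1 Int_absorb2)
    finally have "a + b = (\<Sum>g\<in>S \<union> T. e g * g)" by simp
    moreover have "\<forall>g\<in>S \<union> T. e g \<in> polys_in B"
      using S(4) T(4) unfolding e_def by auto
    ultimately show ?thesis unfolding ideal_gen_def using S(2,3) T(2,3)
      by (intro CollectI exI[of _ "S \<union> T"] exI[of _ e]) auto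
  qed
  moreover have "r * a \<in> ideal_gen (polys_in B) G"
    if ra: "r \<in> polys_in B" "a \<in> ideal_gen (polys_in B) G" for r a
  proof -
    obtain S c where S: "a = (\<Sum>g\<in>S. c g * g)" "finite S" "S \<subseteq> G" "\<forall>g\<in>S. c g \<in> polys_in B"
      using ra(2) unfolding ideal_gen_def by blast
    have "r * a = (\<Sum>g\<in>S. (r * c g) * g)" by (simp add: S(1) sum_distrib_left mult.assoc)
    then show ?thesis unfolding ideal_gen_def using S(2-4) ra(1)
      by (intro CollectI exI[of _ S] exI[of _ "\<lambda>g. r * c g"]) auto
  qed
  moreover have "0 \<in> ideal_gen (polys_in B) G"
    unfolding ideal_gen_def by (intro CollectI exI[of _ "{}"]) auto
  moreover have "ideal_gen (polys_in B) G \<subseteq> polys_in B"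
    unfolding ideal_gen_def using assms by (auto intro!: polys_in_sum)
  ultimately show ?thesis unfolding ideal_in_def by blast
qed

lemma ideal_gen_superset: "G \<subseteq> ideal_gen (polys_in B) G"
proof
  fix g assume "g \<in> G"
  then show "g \<in> ideal_gen (polys_in B) G"
    unfolding ideal_gen_def by (intro CollectI exI[of _ "{g}"] exI[of _ "\<lambda>_. 1"]) auto
qed

lemma ideal_gen_least:
  assumes "ideal_in R I" "G \<subseteq> I" shows "ideal_gen R G \<subseteq> I"
  unfolding ideal_gen_def using assms
  by (auto intro!: ideal_in_sum ideal_inD(4)[OF assms(1)])

lemma ideal_in_plus:
  assumes "ideal_in R I" "ideal_in R J"
    and "\<And>a b. a \<in> R \<Longrightarrow> b \<in> R \<Longrightarrow> a + b \<in> R"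
  shows "ideal_in R {a + b |a b. a \<in> I \<and> b \<in> J}"
proof -
  note I = ideal_inD[OF assms(1)] and J = ideal_inD[OF assms(2)]
  have "(a + b) + (a' + b') \<in> {a + b |a b. a \<in> I \<and> b \<in> J}"
    if "a \<in> I" "a' \<in> I" "b \<in> J" "b' \<in> J" for a a' b b'
  proof -
    have "(a + b) + (a' + b') = (a + a') + (b + b')" by (simp add: algebra_simps)
    with that I(3)[of a a'] J(3)[of b b'] show ?thesis by blast
  qed
  moreover have "r * (a + b) \<in> {a + b |a b. a \<in> I \<and> b \<in> J}" if "r \<in> R" "a \<in> I" "b \<in> J" for r a b
  proof -
    have "r * (a + b) = r * a + r * b" by (simp add: algebra_simps)
    with that I(4)[of r a] J(4)[of r b] show ?thesis by blast
  qed
  moreover have "0 \<in> {a + b |a b. a \<in> I \<and> b \<in> J}" using I(2) J(2) by force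
  ultimately show ?thesis unfolding ideal_in_def using I(1) J(1) assms(3) by auto
qed

lemma sum_ideals_superset:
  fixes I J :: "'b::comm_monoid_add set"
  assumes "0 \<in> I" "0 \<in> J"
  shows "I \<union> J \<subseteq> {a + b |a b. a \<in> I \<and> b \<in> J}"
proof
  fix g assume "g \<in> I \<union> J"
  then consider "g \<in> I" | "g \<in> J" by blast
  then show "g \<in> {a + b |a b. a \<in> I \<and> b \<in> J}"
  proof cases
    case 1
    moreover have "g = g + 0" by simp
    ultimately show ?thesis using assms(2) by blast
  next
    case 2
    moreover have "g = 0 + g" by simp
    ultimately show ?thesis using assms(1) by blast
  qed
qed

lemma ideal_gen_Un:
  assumes "G \<subseteq> polys_in B" "H \<subseteq> polys_in B"
  shows "ideal_gen (polys_in B) (G \<union> H)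
    = {a + b |a b. a \<in> ideal_gen (polys_in B) G \<and> b \<in> ideal_gen (polys_in B) H}" (is "?L = ?R")
proof
  note I = ideal_in_gen[OF assms(1)] and J = ideal_in_gen[OF assms(2)]
  have "ideal_in (polys_in B) ?R" by (rule ideal_in_plus[OF I J]) auto
  moreover have "G \<union> H \<subseteq> ?R"
    using sum_ideals_superset[OF ideal_inD(2)[OF I] ideal_inD(2)[OF J]]
      ideal_gen_superset[of G B] ideal_gen_superset[of H B] by blast
  ultimately show "?L \<subseteq> ?R" by (rule ideal_gen_least)
  have L: "ideal_in (polys_in B) ?L" by (rule ideal_in_gen) (use assms in auto)
  have "ideal_gen (polys_in B) G \<subseteq> ?L" "ideal_gen (polys_in B) H \<subseteq> ?L"
    by (rule ideal_gen_least[OF L]; use ideal_gen_superset in blast)+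
  then show "?R \<subseteq> ?L" using ideal_inD(3)[OF L] by blast
qed

section \<open>Unique top monomials, leading monomials and the monomial order\<close>

definition top_at :: "('k \<Rightarrow> 'w::linorder) \<Rightarrow> ('k \<Rightarrow>\<^sub>0 'b::zero) \<Rightarrow> 'k \<Rightarrow> bool" where
  "top_at w p s \<longleftrightarrow> s \<in> keys p \<and> (\<forall>t\<in>keys p. t \<noteq> s \<longrightarrow> w t < w s)"

text \<open>All other pairs of monomials have strictly smaller total weight, so nothing cancels the
  product of the two top terms. Besides the monomial order itself, \<open>w\<close> will be a
  numerical weight that follows one monomial through powers of sums, whose multinomial coefficients
  may vanish in the field.\<close>

lemma top_at_mult:
  fixes p q :: "'k::monoid_add \<Rightarrow>\<^sub>0 'b::idom"
    and w :: "'k \<Rightarrow> 'w::linordered_cancel_ab_semigroup_add"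
  assumes w: "\<And>s t. w (s + t) = w s + w t" and p: "top_at w p s" and q: "top_at w q t"
  shows "top_at w (p * q) (s + t)"
proof -
  have less: "w (s' + t') < w (s + t)" if "s' \<in> keys p" "t' \<in> keys q" "s' \<noteq> s \<or> t' \<noteq> t" for s' t'
  proof -
    have "w s' \<le> w s" "w t' \<le> w t" "w s' < w s \<or> w t' < w t"
      using that p q unfolding top_at_def by (auto simp: le_less)
    then show ?thesis unfolding w by (auto intro: add_less_le_mono add_le_less_mono)
  qed
  have "lookup (p * q) (s + t)
      = (\<Sum>s'\<in>keys p. \<Sum>t'\<in>keys q. if s' = s \<and> t' = t then lookup p s' * lookup q t' else 0)"
    unfolding lookup_times by (intro sum.cong refl if_cong) (use less in force)
  also have "\<dots> = (\<Sum>s'\<in>keys p. if s' = s then \<Sum>t'\<in>keys q. if t' = t then lookup p s * lookup q t else 0 else 0)"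
    by (intro sum.cong refl) auto
  also have "\<dots> = lookup p s * lookup q t"
    using p q by (simp add: top_at_def)
  finally have "s + t \<in> keys (p * q)"
    using p q by (simp add: top_at_def in_keys_iff)
  then show ?thesis unfolding top_at_def using less by (blast elim!: keys_times_E)
qed

lemma top_at_prod:
  fixes f :: "'x \<Rightarrow> ('k::comm_monoid_add \<Rightarrow>\<^sub>0 'b::idom)"
    and w :: "'k \<Rightarrow> 'w::linordered_cancel_ab_semigroup_add"
  assumes w: "\<And>s t. w (s + t) = w s + w t" and "\<And>x. x \<in> A \<Longrightarrow> top_at w (f x) (g x)"
  shows "top_at w (prod f A) (sum g A)"
  using assms(2)
proof (induction A rule: infinite_finite_induct)
  case (insert x F)
  then show ?case using top_at_mult[OF w, of "f x" "g x" "prod f F" "sum g F"] by simp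
qed (simp_all add: top_at_def)

lemma top_at_power:
  fixes p :: "'k::comm_monoid_add \<Rightarrow>\<^sub>0 'b::idom"
    and w :: "'k \<Rightarrow> 'w::linordered_cancel_ab_semigroup_add"
  assumes w: "\<And>s t. w (s + t) = w s + w t" and "top_at w p s"
  shows "top_at w (p ^ k) (\<Sum>i<k. s)"
  using top_at_prod[OF w, of "{..<k}" "\<lambda>_. p" "\<lambda>_. s"] assms(2) by simp

lemma top_at_sum:
  fixes f :: "'x \<Rightarrow> ('k \<Rightarrow>\<^sub>0 'b::comm_monoid_add)"
  assumes "finite X" "x \<in> X" "top_at w (f x) s"
    and "\<And>y t. y \<in> X \<Longrightarrow> y \<noteq> x \<Longrightarrow> t \<in> keys (f y) \<Longrightarrow> w t < w s"
  shows "top_at w (sum f X) s"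
proof -
  have "lookup (sum f X) s = (\<Sum>y\<in>X. if y = x then lookup (f x) s else 0)"
    unfolding lookup_sum using assms(4) by (intro sum.cong refl) (auto simp: in_keys_iff)
  then have "s \<in> keys (sum f X)" using assms(1-3) by (simp add: top_at_def in_keys_iff)
  moreover have "w t < w s" if "t \<in> keys (sum f X)" "t \<noteq> s" for t
  proof -
    have "\<not> (\<forall>y\<in>X. lookup (f y) t = 0)"
    proof
      assume "\<forall>y\<in>X. lookup (f y) t = 0"
      then have "lookup (sum f X) t = 0" unfolding lookup_sum by (intro sum.neutral)
      with that(1) show False by (simp add: in_keys_iff)
    qed
    then obtain y where y: "y \<in> X" "t \<in> keys (f y)" by (auto simp: in_keys_iff)
    show ?thesis using assms(3,4) y that(2) by (cases "y = x") (auto simp: top_at_def)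
  qed
  ultimately show ?thesis by (simp add: top_at_def)
qed

lemma top_at_add:
  assumes "top_at w p s" "\<And>t. t \<in> keys q \<Longrightarrow> w t < w s"
  shows "top_at w (p + q) s"
proof -
  have "lookup q s = 0" using assms(2) by (auto simp: in_keys_iff)
  then show ?thesis using assms keys_add[of p q] unfolding top_at_def
    by (auto simp: in_keys_iff lookup_add)
qed

definition LM :: "'a::zero mpoly \<Rightarrow> mon" where
  "LM p = Max (keys p)"

lemma LM_top_at: "p \<noteq> 0 \<Longrightarrow> top_at (\<lambda>t. t) p (LM p)"
  unfolding top_at_def LM_def by (auto simp: less_le)

lemma LM_in_keys: "p \<noteq> 0 \<Longrightarrow> LM p \<in> keys p"
  using LM_top_at by (auto simp: top_at_def)

lemma LM_ge: "t \<in> keys p \<Longrightarrow> t \<le> LM p"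
  by (simp add: LM_def)

lemma top_at_LM: "top_at (\<lambda>t. t) p s \<Longrightarrow> p \<noteq> 0 \<and> LM p = s"
  unfolding top_at_def LM_def by (auto intro!: Max_eqI simp: le_less)

lemma LM_mult:
  fixes p q :: "'a::idom mpoly"
  assumes "p \<noteq> 0" "q \<noteq> 0"
  shows "LM (p * q) = LM p + LM q"
  using top_at_LM[OF top_at_mult[OF _ LM_top_at[OF assms(1)] LM_top_at[OF assms(2)]]] by simp

lemma LM_single_mult:
  fixes p :: "'a::idom mpoly"
  assumes "p \<noteq> 0" "c \<noteq> 0"
  shows "single u c * p \<noteq> 0" "LM (single u c * p) = u + LM p"
proof -
  have "top_at (\<lambda>t. t) (single u c) u" using assms by (simp add: top_at_def)
  from top_at_LM[OF top_at_mult[OF _ this LM_top_at[OF assms(1)]]]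
  show "single u c * p \<noteq> 0" "LM (single u c * p) = u + LM p" by auto
qed

lemma LM_polys_in: "p \<in> polys_in B \<Longrightarrow> p \<noteq> 0 \<Longrightarrow> keys (LM p) \<subseteq> B"
  using LM_in_keys[of p] unfolding polys_in_def by blast

lemma LM_less_cancel:
  fixes p q :: "'a::field mpoly"
  assumes "p \<noteq> 0" "q \<noteq> 0" "LM q = LM p" "lookup q (LM p) = lookup p (LM p)" "p - q \<noteq> 0"
  shows "LM (p - q) < LM p"
proof -
  have "LM (p - q) \<in> keys (p - q)" by (rule LM_in_keys) fact
  then have "LM (p - q) \<in> keys p \<union> keys q" "LM (p - q) \<noteq> LM p"
    using keys_diff[of p q] assms(4) by (auto simp: in_keys_iff lookup_minus)
  then show ?thesis using LM_ge[of _ p] LM_ge[of _ q] assms(3) by (auto simp: less_le)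
qed

lemma lookup_single_mult_LM:
  fixes p :: "'a::idom mpoly"
  assumes "p \<noteq> 0"
  shows "lookup (single u c * p) (u + LM p) = c * lookup p (LM p)"
proof (cases "c = 0")
  case False
  have "lookup (single u c * p) (u + LM p)
      = (\<Sum>t\<in>keys p. if t = LM p then c * lookup p (LM p) else 0)"
    unfolding lookup_times using False by (simp cong: if_cong)
  then show ?thesis using LM_in_keys[OF assms] by simp
qed simp

text \<open>With cells ordered row by row this is a lexicographic monomial order in which earlier
  cells are larger variables; it makes the diagonal lead in every minor.\<close>

lemma less_mon_iff: "(s :: mon) < t \<longleftrightarrow> (\<exists>v. lookup s v < lookup t v \<and> (\<forall>v'<v. lookup s v' = lookup t v'))"
  by (simp add: less_poly_mapping.rep_eq less_fun_def)

text \<open>On infinitely many cells the order has infinite descents. Confined to a finite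
  \<open>B\<close>, exponents become lists of one fixed length, compared lexicographically.\<close>

lemma wf_mon:
  assumes "finite B"
  shows "wf {(s :: mon, t). s < t \<and> keys s \<subseteq> B \<and> keys t \<subseteq> B}"
proof -
  let ?vs = "sorted_list_of_set B"
  let ?l = "\<lambda>t :: mon. map (lookup t) ?vs"
  have "{(s :: mon, t). s < t \<and> keys s \<subseteq> B \<and> keys t \<subseteq> B} \<subseteq> inv_image (lenlex less_than) ?l"
  proof clarify
    fix s t :: mon assume st: "s < t" "keys s \<subseteq> B" "keys t \<subseteq> B"
    obtain v where v: "lookup s v < lookup t v" "\<And>v'. v' < v \<Longrightarrow> lookup s v' = lookup t v'"
      using st(1) unfolding less_mon_iff by blast
    have "v \<in> keys t" using v(1) by (simp add: in_keys_iff)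
    then have "v \<in> B" using st(3) by blast
    then have "v \<in> set ?vs" using assms by simp
    then obtain xs ys where xy: "?vs = xs @ v # ys" using split_list by fast
    have "sorted ?vs" "distinct ?vs" by auto
    then have "\<forall>x\<in>set xs. x < v" unfolding xy by (auto simp: sorted_append less_le)
    then have "map (lookup s) xs = map (lookup t) xs" using v(2) by simp
    then have "(?l s, ?l t) \<in> lex less_than"
      unfolding xy lex_conv using v(1)
      by (simp, intro exI[of _ "map (lookup t) xs"], simp)
    then show "(s, t) \<in> inv_image (lenlex less_than) ?l"
      by (simp add: lenlex_conv)
  qed
  from wf_subset[OF wf_inv_image[OF wf_lenlex[OF wf_less_than]] this] show ?thesis .
qed

lemma mon_less_induct [consumes 2, case_names less]:
  assumes "finite B" "keys (t :: mon) \<subseteq> B"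
    and "\<And>t. keys t \<subseteq> B \<Longrightarrow> (\<And>s. keys s \<subseteq> B \<Longrightarrow> s < t \<Longrightarrow> Q s) \<Longrightarrow> Q t"
  shows "Q t"
proof -
  have "keys t \<subseteq> B \<longrightarrow> Q t"
    by (induction t rule: wf_induct_rule[OF wf_mon[OF assms(1)]]) (use assms(3) in blast)
  then show ?thesis using assms(2) by blast
qed

text \<open>\<open>LM 0\<close> would be the maximum of an empty set, so the zero polynomial is
  treated separately as lying below everything.\<close>

lemma poly_LM_induct [consumes 2, case_names less]:
  fixes p :: "'a::comm_ring_1 mpoly"
  assumes "finite B" "p \<in> polys_in B"
    and step: "\<And>p :: 'a mpoly. p \<in> polys_in B \<Longrightarrow>
      (\<And>q :: 'a mpoly. q \<in> polys_in B \<Longrightarrow> p \<noteq> 0 \<Longrightarrow> q = 0 \<or> LM q < LM p \<Longrightarrow> Q q) \<Longrightarrow> Q p"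
  shows "Q p"
proof -
  have Q0: "Q 0" by (rule step) auto
  have *: "Q p" if "p \<noteq> 0" "p \<in> polys_in B" "LM p = t" "keys t \<subseteq> B" for p :: "'a mpoly" and t
    using assms(1) that(4) that(1-3)
  proof (induction t arbitrary: p rule: mon_less_induct)
    case (less t)
    show ?case
    proof (rule step)
      fix q :: "'a mpoly" assume q: "q \<in> polys_in B" "q = 0 \<or> LM q < LM p"
      show "Q q"
      proof (cases "q = 0")
        case False
        then show ?thesis using less.IH[of "LM q" q] q LM_polys_in[OF q(1) False] less.prems by auto
      qed (use Q0 in simp)
    qed (rule less.prems)
  qed
  show ?thesis using *[of p "LM p"] Q0 assms(2) LM_polys_in by (cases "p = 0") auto
qed

section \<open>Groebner bases, recorded by their leading monomials only\<close>

definition groebner :: "(nat \<times> nat) set \<Rightarrow> 'a::comm_ring_1 mpoly set \<Rightarrow> mon set \<Rightarrow> bool" where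
  "groebner B I M \<longleftrightarrow> ideal_in (polys_in B) I
     \<and> (\<forall>g\<in>I. g \<noteq> 0 \<longrightarrow> (\<exists>t\<in>M. \<exists>u. LM g = t + u)) \<and> (\<forall>t\<in>M. \<exists>g\<in>I. g \<noteq> 0 \<and> LM g = t)"

text \<open>Division with remainder. The clause \<open>s \<le> LM f\<close> keeps the remainder
  below the divided polynomial, so that reducing a tail cannot recreate the term it was the tail
  of.\<close>

lemma normal_form:
  fixes I :: "'a::field mpoly set"
  assumes B: "finite B" and I: "ideal_in (polys_in B) I"
    and M: "\<And>t. t \<in> M \<Longrightarrow> \<exists>g\<in>I. g \<noteq> 0 \<and> LM g = t" and f: "f \<in> polys_in B"
  shows "\<exists>f'\<in>polys_in B. f - f' \<in> I
    \<and> (\<forall>s\<in>keys f'. (\<nexists>t u. t \<in> M \<and> s = t + u) \<and> f \<noteq> 0 \<and> s \<le> LM f)"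
  using B f
proof (induction f rule: poly_LM_induct)
  case (less f)
  show ?case
  proof (cases "f = 0")
    case True
    then show ?thesis using ideal_inD(2)[OF I] by (intro bexI[of _ 0]) auto
  next
    case False
    let ?c = "lookup f (LM f)"
    have c: "?c \<noteq> 0" using LM_in_keys[OF False] by (simp add: in_keys_iff)
    have kB: "keys (LM f) \<subseteq> B" using LM_polys_in less.hyps False by blast
    show ?thesis
    proof (cases "\<exists>t u. t \<in> M \<and> LM f = t + u")
      case True
      then obtain t u where t: "t \<in> M" "LM f = t + u" by blast
      obtain g where g: "g \<in> I" "g \<noteq> 0" "LM g = t" using M[OF t(1)] by blast
      let ?d = "?c / lookup g t"
      have gt: "lookup g t \<noteq> 0" using LM_in_keys[OF g(2)] g(3) by (simp add: in_keys_iff)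
      have d: "?d \<noteq> 0" using c gt by simp
      let ?h = "single u ?d * g"
      have uB: "keys u \<subseteq> B" using kB unfolding t(2) keys_add_mon by blast
      have hI: "?h \<in> I" using uB by (intro ideal_inD(4)[OF I] g(1) polys_in_single)
      have hLM: "?h \<noteq> 0" "LM ?h = LM f"
        using LM_single_mult[OF g(2) d, of u] g(3) t(2) by (auto simp: add.commute)
      have "lookup ?h (LM f) = ?c"
        using lookup_single_mult_LM[OF g(2), of u ?d] gt g(3) t(2) by (simp add: add.commute)
      then have lt: "f - ?h = 0 \<or> LM (f - ?h) < LM f"
        using LM_less_cancel[of f ?h] False hLM by auto
      have "f - ?h \<in> polys_in B" using less.hyps ideal_inD(1)[OF I hI] by auto
      from less.IH[OF this False lt] obtain f' where f': "f' \<in> polys_in B" "f - ?h - f' \<in> I"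
        "\<And>s. s \<in> keys f' \<Longrightarrow> (\<nexists>t u. t \<in> M \<and> s = t + u) \<and> f - ?h \<noteq> 0 \<and> s \<le> LM (f - ?h)"
        by blast
      have "f - ?h - f' + ?h \<in> I" by (rule ideal_inD(3)[OF I f'(2) hI])
      then have "f - f' \<in> I" by simp
      moreover have "s \<le> LM f" if "s \<in> keys f'" for s using f'(3)[OF that] lt by auto
      ultimately show ?thesis using f' False by blast
    next
      case nred: False
      let ?h = "single (LM f) ?c"
      have hB: "?h \<in> polys_in B" using kB by blast
      have h: "?h \<noteq> 0" "LM ?h = LM f" using c by (auto simp: LM_def dest: arg_cong[of _ _ keys])
      have lt: "f - ?h = 0 \<or> LM (f - ?h) < LM f"
        using LM_less_cancel[of f ?h] False h by auto
      have "f - ?h \<in> polys_in B" using less.hyps hB by auto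
      from less.IH[OF this False lt] obtain f' where f': "f' \<in> polys_in B" "f - ?h - f' \<in> I"
        "\<And>s. s \<in> keys f' \<Longrightarrow> (\<nexists>t u. t \<in> M \<and> s = t + u) \<and> f - ?h \<noteq> 0 \<and> s \<le> LM (f - ?h)"
        by blast
      have "s \<le> LM f" if "s \<in> keys f'" for s using f'(3)[OF that] lt by auto
      moreover have "keys (f' + ?h) \<subseteq> keys f' \<union> {LM f}" using keys_add[of f' ?h] c by auto
      ultimately have "\<forall>s\<in>keys (f' + ?h). (\<nexists>t u. t \<in> M \<and> s = t + u) \<and> f \<noteq> 0 \<and> s \<le> LM f"
      proof (intro ballI)
        fix s assume "s \<in> keys (f' + ?h)"
        then consider "s \<in> keys f'" | "s = LM f"
          using \<open>keys (f' + ?h) \<subseteq> keys f' \<union> {LM f}\<close> by blast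
        then show "(\<nexists>t u. t \<in> M \<and> s = t + u) \<and> f \<noteq> 0 \<and> s \<le> LM f"
          using f'(3)[of s] False nred \<open>\<And>s. s \<in> keys f' \<Longrightarrow> s \<le> LM f\<close> by cases auto
      qed
      moreover have "f - (f' + ?h) \<in> I" using f'(2) by (simp add: algebra_simps)
      moreover have "f' + ?h \<in> polys_in B" using f'(1) hB by (rule polys_in_add)
      ultimately show ?thesis by blast
    qed
  qed
qed

text \<open>If \<open>M\<close> does not reduce the leading term of \<open>g\<close>, this term plus
  the normal form of the tail is an irreducible element of \<open>I\<close>, hence 0. But the normal
  form stays strictly below \<open>LM g\<close> and cannot cancel it.\<close>

lemma groebner_if_independent:
  fixes I :: "'a::field mpoly set"
  assumes B: "finite B" and I: "ideal_in (polys_in B) I"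
    and M: "\<And>t. t \<in> M \<Longrightarrow> \<exists>g\<in>I. g \<noteq> 0 \<and> LM g = t"
    and indep: "\<And>f. f \<in> I \<Longrightarrow> \<forall>s\<in>keys f. \<nexists>t u. t \<in> M \<and> s = t + u \<Longrightarrow> f = 0"
  shows "groebner B I M"
proof -
  have "\<exists>t\<in>M. \<exists>u. LM g = t + u" if g: "g \<in> I" "g \<noteq> 0" for g
  proof (rule ccontr)
    assume nred: "\<not> (\<exists>t\<in>M. \<exists>u. LM g = t + u)"
    let ?c = "lookup g (LM g)"
    have c: "?c \<noteq> 0" using LM_in_keys[OF g(2)] by (simp add: in_keys_iff)
    let ?h = "single (LM g) ?c"
    have gB: "g \<in> polys_in B" by (rule ideal_inD(1)[OF I g(1)])
    have hB: "?h \<in> polys_in B" using LM_polys_in[OF gB g(2)] by blast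
    have h: "?h \<noteq> 0" "LM ?h = LM g" using c by (auto simp: LM_def dest: arg_cong[of _ _ keys])
    have lt: "g - ?h = 0 \<or> LM (g - ?h) < LM g"
      using LM_less_cancel[of g ?h] g(2) h by auto
    have "g - ?h \<in> polys_in B" using gB hB by auto
    have "\<exists>f'\<in>polys_in B. g - ?h - f' \<in> I
      \<and> (\<forall>s\<in>keys f'. (\<nexists>t u. t \<in> M \<and> s = t + u) \<and> g - ?h \<noteq> 0 \<and> s \<le> LM (g - ?h))"
      by (rule normal_form[OF B I _ \<open>g - ?h \<in> polys_in B\<close>]) (rule M)
    then obtain f' where f': "f' \<in> polys_in B" "g - ?h - f' \<in> I"
        "\<And>s. s \<in> keys f' \<Longrightarrow> (\<nexists>t u. t \<in> M \<and> s = t + u) \<and> g - ?h \<noteq> 0 \<and> s \<le> LM (g - ?h)"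
      by blast
    have "g - (g - ?h - f') \<in> I" by (rule ideal_in_diff[OF I g(1) f'(2)])
    then have "?h + f' \<in> I" by simp
    moreover have "\<forall>s\<in>keys (?h + f'). \<nexists>t u. t \<in> M \<and> s = t + u"
    proof (intro ballI)
      fix s assume "s \<in> keys (?h + f')"
      then consider "s \<in> keys f'" | "s = LM g" using keys_add[of ?h f'] c by auto
      then show "\<nexists>t u. t \<in> M \<and> s = t + u" using f'(3)[of s] nred by cases auto
    qed
    ultimately have "?h + f' = 0" by (rule indep)
    then have "lookup (?h + f') (LM g) = 0" by (simp only: lookup_zero)
    then have "lookup f' (LM g) \<noteq> 0" using c by (auto simp: lookup_add)
    then have "LM g \<in> keys f'" by (simp add: in_keys_iff)
    from f'(3)[OF this] lt show False by auto
  qed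
  then show ?thesis unfolding groebner_def using I M by blast
qed

lemma mon_dvd_coprime:
  fixes s s' :: mon
  assumes "t = s + u" "t = s' + u'" "keys s \<inter> keys s' = {}"
  shows "\<exists>w. t = s + s' + w"
proof -
  have "lookup t v = lookup (s + s' + (t - (s + s'))) v" for v
  proof (cases "v \<in> keys s")
    case True
    then have "lookup s' v = 0" using assms(3) by (auto simp: in_keys_iff)
    then show ?thesis unfolding assms(1) by (simp add: lookup_add lookup_minus)
  next
    case False
    then have "lookup s v = 0" by (simp add: in_keys_iff)
    then show ?thesis unfolding assms(2) by (simp add: lookup_add lookup_minus)
  qed
  then show ?thesis by (blast intro: poly_mapping_eqI)
qed

text \<open>The only obstacle is that the leading terms of \<open>a\<close> and \<open>b\<close>
  cancel. Their common monomial is then divisible by members of both \<open>M\<close> and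
  \<open>N\<close>, hence by their product, which is the leading monomial of some
  \<open>g * h\<close> in both ideals. Moving a multiple of \<open>g * h\<close> from
  \<open>a\<close> to \<open>b\<close> keeps the sum and lowers \<open>a\<close>.\<close>

lemma groebner_plus:
  fixes I J :: "'a::field mpoly set"
  assumes B: "finite B" and I: "groebner B I M" and J: "groebner B J N"
    and co: "\<And>s t. s \<in> M \<Longrightarrow> t \<in> N \<Longrightarrow> keys s \<inter> keys t = {}"
  shows "groebner B {a + b |a b. a \<in> I \<and> b \<in> J} (M \<union> N)"
proof -
  have iI: "ideal_in (polys_in B) I" and iJ: "ideal_in (polys_in B) J"
    using I J by (auto simp: groebner_def)
  have dI: "\<exists>t\<in>M. \<exists>u. LM g = t + u" if "g \<in> I" "g \<noteq> 0" for g using I that by (auto simp: groebner_def)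
  have dJ: "\<exists>t\<in>N. \<exists>u. LM g = t + u" if "g \<in> J" "g \<noteq> 0" for g using J that by (auto simp: groebner_def)
  have red: "\<exists>t\<in>M \<union> N. \<exists>u. LM (a + b) = t + u"
    if "a \<in> I" "b \<in> J" "a + b \<noteq> 0" for a b
  proof -
    have "a \<in> polys_in B" by (rule ideal_inD(1)[OF iI that(1)])
    from B this show ?thesis using that
    proof (induction a arbitrary: b rule: poly_LM_induct)
      case (less a)
      consider "a = 0" | "b = 0" | "a \<noteq> 0" "b \<noteq> 0" by blast
      then show ?case
      proof cases
        case 1 then show ?thesis using dJ[OF less.prems(2)] less.prems(3) by (metis UnI2 add_0)
      next
        case 2 then show ?thesis using dI[OF less.prems(1)] less.prems(3) by (metis UnI1 add_0_right)
      next
        case 3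
        show ?thesis
        proof (cases "LM a = LM b \<and> lookup a (LM a) + lookup b (LM a) = 0")
          case False
          have "LM (a + b) = LM a \<or> LM (a + b) = LM b"
          proof -
            consider "LM a < LM b" | "LM b < LM a" | "LM a = LM b" by (rule linorder_cases)
            then show ?thesis
            proof cases
              case 1
              have "top_at (\<lambda>t. t) (a + b) (LM b)"
                using top_at_add[OF LM_top_at[OF 3(2)], of a] LM_ge[of _ a] 1
                by (simp add: add.commute[of b]) (meson le_less_trans)
              then show ?thesis using top_at_LM by blast
            next
              case 2
              have "top_at (\<lambda>t. t) (a + b) (LM a)"
                using top_at_add[OF LM_top_at[OF 3(1)], of b] LM_ge[of _ b] 2
                by (meson le_less_trans)
              then show ?thesis using top_at_LM by blast
            next
              case c: 3
              have "LM a \<in> keys (a + b)" using False c by (simp add: in_keys_iff lookup_add)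
              moreover have "t \<le> LM a" if "t \<in> keys (a + b)" for t
                using that keys_add[of a b] LM_ge[of t a] LM_ge[of t b] c by auto
              ultimately have "LM (a + b) = LM a" unfolding LM_def[of "a + b"] by (intro Max_eqI) auto
              then show ?thesis by blast
            qed
          qed
          then show ?thesis using dI[OF less.prems(1) 3(1)] dJ[OF less.prems(2) 3(2)] by (metis UnI1 UnI2)
        next
          case True
          let ?t = "LM a" and ?c = "lookup a (LM a)"
          obtain s u where s: "s \<in> M" "?t = s + u" using dI[OF less.prems(1) 3(1)] by blast
          obtain s' u' where s': "s' \<in> N" "?t = s' + u'" using dJ[OF less.prems(2) 3(2)] True by auto
          obtain w where w: "?t = s + s' + w"
            using mon_dvd_coprime[OF s(2) s'(2) co[OF s(1) s'(1)]] by blast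
          obtain g where g: "g \<in> I" "g \<noteq> 0" "LM g = s" using I s(1) unfolding groebner_def by blast
          obtain h where h: "h \<in> J" "h \<noteq> 0" "LM h = s'" using J s'(1) unfolding groebner_def by blast
          have gh: "g * h \<noteq> 0" "LM (g * h) = s + s'" using g h LM_mult by auto
          let ?e = "lookup (g * h) (s + s')"
          have e: "?e \<noteq> 0" using LM_in_keys[OF gh(1)] gh(2) by (simp add: in_keys_iff)
          have c: "?c \<noteq> 0" using LM_in_keys[OF 3(1)] by (simp add: in_keys_iff)
          let ?P = "single w (?c / ?e) * (g * h)"
          have wB: "single w (?c / ?e) \<in> polys_in B"
            using LM_polys_in[OF less.hyps 3(1)] unfolding w keys_add_mon by blast
          have PI: "?P \<in> I"
          proof -
            have "single w (?c / ?e) * h * g \<in> I"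
              using wB ideal_inD(1)[OF iJ h(1)] by (intro ideal_inD(4)[OF iI _ g(1)]) auto
            then show ?thesis by (simp add: mult_ac)
          qed
          have PJ: "?P \<in> J"
          proof -
            have "single w (?c / ?e) * g * h \<in> J"
              using wB ideal_inD(1)[OF iI g(1)] by (intro ideal_inD(4)[OF iJ _ h(1)]) auto
            then show ?thesis by (simp add: mult_ac)
          qed
          have P: "?P \<noteq> 0" "LM ?P = ?t" using LM_single_mult[OF gh(1), of "?c / ?e" w] c e gh(2) w
            by (auto simp: add_ac)
          have "lookup ?P ?t = ?c"
            using lookup_single_mult_LM[OF gh(1), of w "?c / ?e"] gh(2) e w by (simp add: add_ac)
          then have lt: "a - ?P = 0 \<or> LM (a - ?P) < LM a" using LM_less_cancel[OF 3(1) P(1)] P(2) by auto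
          have aP: "a - ?P \<in> I" by (rule ideal_in_diff[OF iI less.prems(1) PI])
          have bP: "b + ?P \<in> J" by (rule ideal_inD(3)[OF iJ less.prems(2) PJ])
          show ?thesis
            using less.IH[OF ideal_inD(1)[OF iI aP] 3(1) lt aP bP] less.prems(3) by simp
        qed
      qed
    qed
  qed
  define S where "S = {a + b |a b. a \<in> I \<and> b \<in> J}"
  have sub: "I \<union> J \<subseteq> S"
    unfolding S_def by (rule sum_ideals_superset[OF ideal_inD(2)[OF iI] ideal_inD(2)[OF iJ]])
  have "\<exists>g\<in>S. g \<noteq> 0 \<and> LM g = t" if "t \<in> M \<union> N" for t
  proof -
    have "\<exists>g\<in>I \<union> J. g \<noteq> 0 \<and> LM g = t"
      using that I J unfolding groebner_def by (metis UnE UnI1 UnI2)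
    then show ?thesis using sub by blast
  qed
  moreover have "ideal_in (polys_in B) S"
    unfolding S_def by (rule ideal_in_plus[OF iI iJ]) (rule polys_in_add)
  moreover have "\<exists>t\<in>M \<union> N. \<exists>u. LM g = t + u" if "g \<in> S" "g \<noteq> 0" for g
    using that red unfolding S_def by fast
  ultimately have "groebner B S (M \<union> N)" unfolding groebner_def by simp
  then show ?thesis unfolding S_def .
qed

text \<open>A member of \<open>M\<close> that divides \<open>LM h + LM g\<close> and is coprime to
  \<open>LM h\<close> divides \<open>LM g\<close>, so \<open>g\<close> can be lowered by an element
  of \<open>I\<close> while \<open>h * g\<close> stays in \<open>I\<close>.\<close>

lemma groebner_nonzero_divisor:
  fixes I :: "'a::field mpoly set"
  assumes B: "finite B" and I: "groebner B I M" and h: "h \<noteq> 0"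
    and co: "\<And>t. t \<in> M \<Longrightarrow> keys t \<inter> keys (LM h) = {}"
    and g: "g \<in> polys_in B" and hg: "h * g \<in> I" and hB: "h \<in> polys_in B"
  shows "g \<in> I"
  using B g hg
proof (induction g rule: poly_LM_induct)
  case (less g)
  have iI: "ideal_in (polys_in B) I" using I by (auto simp: groebner_def)
  show ?case
  proof (cases "g = 0")
    case True then show ?thesis using ideal_inD(2)[OF iI] by simp
  next
    case False
    then have "h * g \<noteq> 0" using h by simp
    then obtain t u where t: "t \<in> M" "LM (h * g) = t + u" using I less.prems unfolding groebner_def by blast
    have hg: "LM (h * g) = LM h + LM g" by (rule LM_mult[OF h False])
    obtain w where "LM h + LM g = t + LM h + w"
      using mon_dvd_coprime[of "LM h + LM g" t u "LM h" "LM g"] t hg co[OF t(1)] by metis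
    then have "LM g + LM h = (t + w) + LM h" by (simp add: add_ac)
    then have w: "LM g = t + w" by simp
    obtain k where k: "k \<in> I" "k \<noteq> 0" "LM k = t" using I t(1) unfolding groebner_def by blast
    let ?c = "lookup g (LM g) / lookup k t"
    have kt: "lookup k t \<noteq> 0" using LM_in_keys[OF k(2)] k(3) by (simp add: in_keys_iff)
    have "lookup g (LM g) \<noteq> 0" using LM_in_keys[OF False] by (simp add: in_keys_iff)
    then have c: "?c \<noteq> 0" using kt by simp
    let ?P = "single w ?c * k"
    have "single w ?c \<in> polys_in B"
      using LM_polys_in[OF less.hyps False] unfolding w keys_add_mon by blast
    then have PI: "?P \<in> I" by (rule ideal_inD(4)[OF iI _ k(1)])
    have P: "?P \<noteq> 0" "LM ?P = LM g" using LM_single_mult[OF k(2) c, of w] k(3) w by (auto simp: add_ac)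
    have "lookup ?P (LM g) = lookup g (LM g)"
      using lookup_single_mult_LM[OF k(2), of w ?c] kt k(3) w by (simp add: add_ac)
    then have lt: "g - ?P = 0 \<or> LM (g - ?P) < LM g" using LM_less_cancel[OF False P(1)] P(2) by auto
    have "h * g - h * ?P \<in> I"
      by (rule ideal_in_diff[OF iI less.prems ideal_inD(4)[OF iI hB PI]])
    then have "h * (g - ?P) \<in> I" by (simp add: algebra_simps)
    from less.IH[OF _ False lt this] have "g - ?P \<in> I" using less.hyps ideal_inD(1)[OF iI PI] by auto
    from ideal_inD(3)[OF iI this PI] show ?thesis by simp
  qed
qed

section \<open>Minors\<close>

text \<open>Columns are a function rather than a set, so that they may be unsorted or repeated, and
  the entries are arbitrary, so that substitution into a minor is again of this form.\<close>

definition gdet :: "nat \<Rightarrow> (nat \<Rightarrow> nat \<Rightarrow> 'b::comm_ring_1) \<Rightarrow> (nat \<Rightarrow> nat) \<Rightarrow> 'b" where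
  "gdet m X c = (\<Sum>\<pi> | \<pi> permutes {1..m}. of_int (sign \<pi>) * (\<Prod>i\<in>{1..m}. X i (c (\<pi> i))))"

text \<open>The values \<open>u\<close> and \<open>v\<close>, exchanged by \<open>t\<close>, select
  one member of every pair. The bare involution would only give \<open>sum f S = - sum f S\<close>,
  which says nothing in characteristic 2.\<close>

lemma sum_sign_reversing:
  fixes f :: "'x \<Rightarrow> 'b::ab_group_add" and u v :: "'x \<Rightarrow> 'l::linorder"
  assumes "finite S" "\<And>x. x \<in> S \<Longrightarrow> u x \<noteq> v x"
    and "\<And>x. x \<in> S \<Longrightarrow> t x \<in> S" "\<And>x. x \<in> S \<Longrightarrow> t (t x) = x"
    and "\<And>x. x \<in> S \<Longrightarrow> u (t x) = v x" "\<And>x. x \<in> S \<Longrightarrow> v (t x) = u x"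
    and "\<And>x. x \<in> S \<Longrightarrow> f (t x) = - f x"
  shows "sum f S = 0"
proof -
  let ?S1 = "{x \<in> S. u x < v x}" and ?S2 = "{x \<in> S. v x < u x}"
  have "sum f S = sum f (?S1 \<union> ?S2)"
    by (rule sum.cong) (use assms(2) in force)+
  also have "\<dots> = sum f ?S1 + sum f ?S2"
    by (rule sum.union_disjoint) (use assms(1) in auto)
  also have "sum f ?S2 = (\<Sum>x\<in>?S1. - f x)"
    by (rule sum.reindex_bij_witness[of _ t t]) (use assms in auto)
  finally show ?thesis by (simp add: sum_negf)
qed

lemma gdet_eq_rows:
  assumes rk: "r \<in> {1..m}" "k \<in> {1..m}" "r \<noteq> k" and X: "\<And>j. X r j = X k j"
  shows "gdet m X c = 0"
  unfolding gdet_def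
proof (rule sum_sign_reversing[where t = "\<lambda>\<pi>. \<pi> \<circ> transpose r k" and u = "\<lambda>\<pi>. \<pi> r" and v = "\<lambda>\<pi>. \<pi> k"])
  show "finite {\<pi>. \<pi> permutes {1..m}}" by (rule finite_permutations) simp
next
  fix \<pi> :: "nat \<Rightarrow> nat" assume "\<pi> \<in> {\<pi>. \<pi> permutes {1..m}}"
  then have \<pi>: "\<pi> permutes {1..m}" by simp
  have \<tau>: "transpose r k permutes {1..m}" using rk by (simp add: permutes_swap_id)
  show "\<pi> r \<noteq> \<pi> k" using rk(3) permutes_inj[OF \<pi>] by (auto dest: injD)
  show "\<pi> \<circ> transpose r k \<in> {\<pi>. \<pi> permutes {1..m}}" using permutes_compose[OF \<tau> \<pi>] by simp
  show "\<pi> \<circ> transpose r k \<circ> transpose r k = \<pi>" by (simp add: comp_assoc)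
  show "(\<pi> \<circ> transpose r k) r = \<pi> k" "(\<pi> \<circ> transpose r k) k = \<pi> r" by auto
  have sg: "sign (\<pi> \<circ> transpose r k) = - sign \<pi>"
    using sign_compose[OF permutes_imp_permutation[OF _ \<pi>] permutation_swap_id, of r k] rk(3)
    by (simp add: sign_swap_id)
  have "(\<Prod>i\<in>{1..m}. X i (c ((\<pi> \<circ> transpose r k) i))) = (\<Prod>i\<in>{1..m}. X (transpose r k i) (c (\<pi> i)))"
    by (rule prod.reindex_bij_witness[of _ "transpose r k" "transpose r k"])
      (use permutes_in_image[OF \<tau>] in auto)
  also have "\<dots> = (\<Prod>i\<in>{1..m}. X i (c (\<pi> i)))"
    by (rule prod.cong) (auto simp: transpose_def X)
  finally show "of_int (sign (\<pi> \<circ> transpose r k)) * (\<Prod>i\<in>{1..m}. X i (c ((\<pi> \<circ> transpose r k) i)))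
      = - (of_int (sign \<pi>) * (\<Prod>i\<in>{1..m}. X i (c (\<pi> i))))"
    by (simp add: sg)
qed

lemma gdet_eq_cols:
  assumes rk: "r \<in> {1..m}" "k \<in> {1..m}" "r \<noteq> k" and c: "c r = c k"
  shows "gdet m X c = 0"
  unfolding gdet_def
proof (rule sum_sign_reversing[where t = "\<lambda>\<pi>. transpose r k \<circ> \<pi>" and u = "\<lambda>\<pi>. inv \<pi> r" and v = "\<lambda>\<pi>. inv \<pi> k"])
  show "finite {\<pi>. \<pi> permutes {1..m}}" by (rule finite_permutations) simp
next
  fix \<pi> :: "nat \<Rightarrow> nat" assume "\<pi> \<in> {\<pi>. \<pi> permutes {1..m}}"
  then have \<pi>: "\<pi> permutes {1..m}" by simp
  have \<tau>: "transpose r k permutes {1..m}" using rk by (simp add: permutes_swap_id)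
  show "inv \<pi> r \<noteq> inv \<pi> k" using rk(3) permutes_inj[OF permutes_inv[OF \<pi>]] by (auto dest: injD)
  show "transpose r k \<circ> \<pi> \<in> {\<pi>. \<pi> permutes {1..m}}" using permutes_compose[OF \<pi> \<tau>] by simp
  show "transpose r k \<circ> (transpose r k \<circ> \<pi>) = \<pi>" by (simp flip: comp_assoc)
  have "inv (transpose r k \<circ> \<pi>) = inv \<pi> \<circ> transpose r k"
    using o_inv_distrib[OF permutes_bij[OF \<tau>] permutes_bij[OF \<pi>]] by simp
  then show "inv (transpose r k \<circ> \<pi>) r = inv \<pi> k" "inv (transpose r k \<circ> \<pi>) k = inv \<pi> r" by auto
  have sg: "sign (transpose r k \<circ> \<pi>) = - sign \<pi>"
    using sign_compose[OF permutation_swap_id permutes_imp_permutation[OF _ \<pi>], of r k] rk(3)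
    by (simp add: sign_swap_id)
  have "(\<Prod>i\<in>{1..m}. X i (c ((transpose r k \<circ> \<pi>) i))) = (\<Prod>i\<in>{1..m}. X i (c (\<pi> i)))"
    by (rule prod.cong) (auto simp: transpose_def c)
  then show "of_int (sign (transpose r k \<circ> \<pi>)) * (\<Prod>i\<in>{1..m}. X i (c ((transpose r k \<circ> \<pi>) i)))
      = - (of_int (sign \<pi>) * (\<Prod>i\<in>{1..m}. X i (c (\<pi> i))))"
    by (simp add: sg)
qed

lemma gdet_permute_cols:
  assumes "\<tau> permutes {1..m}"
  shows "gdet m X c = of_int (sign \<tau>) * gdet m X (c \<circ> \<tau>)"
proof -
  have "gdet m X c = (\<Sum>\<pi> | \<pi> permutes {1..m}.
      of_int (sign (\<tau> \<circ> \<pi>)) * (\<Prod>i\<in>{1..m}. X i (c ((\<tau> \<circ> \<pi>) i))))"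
    unfolding gdet_def by (rule setum_permutations_compose_left[OF assms])
  also have "\<dots> = (\<Sum>\<pi> | \<pi> permutes {1..m}.
      of_int (sign \<tau>) * (of_int (sign \<pi>) * (\<Prod>i\<in>{1..m}. X i ((c \<circ> \<tau>) (\<pi> i)))))"
  proof (intro sum.cong refl, goal_cases)
    case (1 \<pi>)
    then have "sign (\<tau> \<circ> \<pi>) = sign \<tau> * sign \<pi>"
      using assms permutes_imp_permutation[of "{1..m}"] by (intro sign_compose) auto
    then show ?case by (simp add: mult.assoc)
  qed
  finally show ?thesis unfolding gdet_def by (simp add: sum_distrib_left)
qed

lemma gdet_cong:
  assumes "\<And>i j. i \<in> {1..m} \<Longrightarrow> j \<in> {1..m} \<Longrightarrow> X i (c j) = Y i (d j)"
  shows "gdet m X c = gdet m Y d"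
  unfolding gdet_def
proof (intro sum.cong refl arg_cong2[where f = "(*)"] prod.cong, goal_cases)
  case (1 \<pi> i)
  then show ?case using permutes_in_image[of \<pi> "{1..m}" i] by (intro assms) auto
qed

text \<open>Linearity in row \<open>r\<close> leaves determinants in which row \<open>r\<close>
  repeats row \<open>i\<close>. Both the generic point and the elimination of row 1 kill minors in
  this way.\<close>

lemma gdet_row_combination:
  assumes r: "r \<in> {1..m}"
    and X: "\<And>j. j \<in> {1..m} \<Longrightarrow> X r (c j) = (\<Sum>i\<in>{1..m} - {r}. w i * X i (c j))"
  shows "gdet m X c = 0"
proof -
  let ?P = "{\<pi>. \<pi> permutes {1..m}}"
  have "gdet m X c = (\<Sum>\<pi>\<in>?P. \<Sum>i\<in>{1..m} - {r}.
      w i * (of_int (sign \<pi>) * (\<Prod>k\<in>{1..m}. (X(r := X i)) k (c (\<pi> k)))))"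
    unfolding gdet_def
  proof (intro sum.cong refl)
    fix \<pi> assume "\<pi> \<in> ?P"
    then have "\<pi> r \<in> {1..m}" using r permutes_in_image[of \<pi> "{1..m}" r] by simp
    then have Xr: "X r (c (\<pi> r)) = (\<Sum>i\<in>{1..m} - {r}. w i * X i (c (\<pi> r)))" by (rule X)
    have "(\<Prod>k\<in>{1..m}. X k (c (\<pi> k))) = X r (c (\<pi> r)) * (\<Prod>k\<in>{1..m} - {r}. X k (c (\<pi> k)))"
      using r by (intro prod.remove) auto
    also have "\<dots> = (\<Sum>i\<in>{1..m} - {r}. w i * (X i (c (\<pi> r)) * (\<Prod>k\<in>{1..m} - {r}. X k (c (\<pi> k)))))"
      by (simp add: Xr sum_distrib_right mult.assoc)
    also have "\<dots> = (\<Sum>i\<in>{1..m} - {r}. w i * (\<Prod>k\<in>{1..m}. (X(r := X i)) k (c (\<pi> k))))"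
    proof (intro sum.cong refl)
      fix i
      have "(\<Prod>k\<in>{1..m}. (X(r := X i)) k (c (\<pi> k)))
          = X i (c (\<pi> r)) * (\<Prod>k\<in>{1..m} - {r}. (X(r := X i)) k (c (\<pi> k)))"
        using r by (subst prod.remove[of _ r]) auto
      also have "(\<Prod>k\<in>{1..m} - {r}. (X(r := X i)) k (c (\<pi> k))) = (\<Prod>k\<in>{1..m} - {r}. X k (c (\<pi> k)))"
        by (intro prod.cong refl) auto
      finally show "w i * (X i (c (\<pi> r)) * (\<Prod>k\<in>{1..m} - {r}. X k (c (\<pi> k))))
          = w i * (\<Prod>k\<in>{1..m}. (X(r := X i)) k (c (\<pi> k)))" by simp
    qed
    finally show "of_int (sign \<pi>) * (\<Prod>k\<in>{1..m}. X k (c (\<pi> k))) = (\<Sum>i\<in>{1..m} - {r}.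
      w i * (of_int (sign \<pi>) * (\<Prod>k\<in>{1..m}. (X(r := X i)) k (c (\<pi> k)))))"
      by (simp add: sum_distrib_left mult_ac)
  qed
  also have "\<dots> = (\<Sum>i\<in>{1..m} - {r}. w i * gdet m (X(r := X i)) c)"
    unfolding gdet_def sum_distrib_left by (rule sum.swap)
  also have "\<dots> = 0"
  proof (intro sum.neutral ballI)
    fix i assume "i \<in> {1..m} - {r}"
    then have "gdet m (X(r := X i)) c = 0" using r by (intro gdet_eq_rows[of r m i]) auto
    then show "w i * gdet m (X(r := X i)) c = 0" by simp
  qed
  finally show ?thesis .
qed

text \<open>The coefficient of \<open>X i (c m)\<close> in the determinant, cut out of the
  permutation sum so that it carries its own sign; row \<open>i\<close> and column position
  \<open>m\<close> do not occur in it.\<close>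

definition last_cofactor :: "nat \<Rightarrow> (nat \<Rightarrow> nat \<Rightarrow> 'b::comm_ring_1) \<Rightarrow> (nat \<Rightarrow> nat) \<Rightarrow> nat \<Rightarrow> 'b" where
  "last_cofactor m X c i = (\<Sum>\<pi> | \<pi> permutes {1..m} \<and> \<pi> i = m.
      of_int (sign \<pi>) * (\<Prod>k\<in>{1..m} - {i}. X k (c (\<pi> k))))"

lemma gdet_expand_last_column:
  assumes "1 \<le> m"
  shows "gdet m X c = (\<Sum>i\<in>{1..m}. last_cofactor m X c i * X i (c m))"
proof -
  let ?P = "{\<pi>. \<pi> permutes {1..m}}"
  have fin: "finite ?P" by (rule finite_permutations) simp
  let ?f = "\<lambda>\<pi>. of_int (sign \<pi>) * (\<Prod>k\<in>{1..m}. X k (c (\<pi> k)))"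
  have "(\<Sum>i\<in>{1..m}. last_cofactor m X c i * X i (c m)) = (\<Sum>i\<in>{1..m}. \<Sum>\<pi>\<in>{\<pi> \<in> ?P. \<pi> i = m}. ?f \<pi>)"
  proof (intro sum.cong refl)
    fix i assume i: "i \<in> {1..m}"
    have "?f \<pi> = of_int (sign \<pi>) * (\<Prod>k\<in>{1..m} - {i}. X k (c (\<pi> k))) * X i (c m)" if "\<pi> i = m" for \<pi>
      using i that by (subst prod.remove[of _ i]) (auto simp: mult_ac)
    then show "last_cofactor m X c i * X i (c m) = (\<Sum>\<pi>\<in>{\<pi> \<in> ?P. \<pi> i = m}. ?f \<pi>)"
      unfolding last_cofactor_def sum_distrib_right by (intro sum.cong) auto
  qed
  also have "\<dots> = sum ?f (\<Union>i\<in>{1..m}. {\<pi> \<in> ?P. \<pi> i = m})"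
    using fin by (intro sum.UNION_disjoint[symmetric]) (auto dest: permutes_inj injD)
  also have "(\<Union>i\<in>{1..m}. {\<pi> \<in> ?P. \<pi> i = m}) = ?P"
  proof -
    have "\<exists>i\<in>{1..m}. \<pi> i = m" if "\<pi> permutes {1..m}" for \<pi>
      using permutes_image[OF that] assms by (metis atLeastAtMost_iff imageE order_refl)
    then show ?thesis by blast
  qed
  finally show ?thesis by (simp add: gdet_def)
qed

lemma last_cofactor_cong:
  assumes "\<And>k j. k \<in> {1..m} - {i} \<Longrightarrow> j \<in> {1..<m} \<Longrightarrow> X k (c j) = Y k (d j)" "i \<in> {1..m}"
  shows "last_cofactor m X c i = last_cofactor m Y d i"
  unfolding last_cofactor_def
proof (intro sum.cong refl arg_cong2[where f = "(*)"] prod.cong, goal_cases)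
  case (1 \<pi> k)
  then have "\<pi> k \<in> {1..m}" "\<pi> k \<noteq> m"
    using permutes_in_image[of \<pi> "{1..m}" k] by (auto dest: permutes_inj injD)
  then show ?case using 1 by (intro assms) auto
qed

lemma subst_gdet: "subst f (gdet m X c) = gdet m (\<lambda>i j. subst f (X i j)) c"
  by (simp add: gdet_def subst_sum subst_mult subst_prod)

section \<open>Increasing enumeration of vertex sets and the positions of a vertex\<close>

definition enum :: "nat set \<Rightarrow> nat \<Rightarrow> nat" where
  "enum F i = sorted_list_of_set F ! (i - 1)"

lemma minor_gdet: "minor m F = gdet m Xvar (enum F)"
  by (simp add: minor_def gdet_def enum_def)

lemma enum_mono:
  assumes "finite F" "1 \<le> i" "i < j" "j \<le> card F"
  shows "enum F i < enum F j"
  unfolding enum_def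
  using assms sorted_wrt_nth_less[OF strict_sorted_list_of_set, of "i - 1" "j - 1" F] by simp

lemma enum_bij:
  assumes "finite F" shows "bij_betw (enum F) {1..card F} F"
proof -
  have "inj_on (enum F) {1..card F}"
    using enum_mono[OF assms] by (intro linorder_inj_onI) fastforce+
  moreover have "enum F ` {1..card F} = F"
  proof -
    have "enum F i \<in> F" if "i \<in> {1..card F}" for i
      using that assms nth_mem[of "i - 1" "sorted_list_of_set F"] by (auto simp: enum_def)
    then have "enum F ` {1..card F} \<subseteq> F" by blast
    then show ?thesis using calculation assms by (intro card_subset_eq) (auto simp: card_image)
  qed
  ultimately show ?thesis by (simp add: bij_betw_def)
qed

lemma enum_in: "finite F \<Longrightarrow> 1 \<le> i \<Longrightarrow> i \<le> card F \<Longrightarrow> enum F i \<in> F"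
  using bij_betwE[OF enum_bij] by auto

lemma enum_less_iff:
  assumes "finite F" "i \<in> {1..card F}" "j \<in> {1..card F}"
  shows "enum F i < enum F j \<longleftrightarrow> i < j"
  using assms enum_mono[of F i j] enum_mono[of F j i] by (cases i j rule: linorder_cases) auto

lemma enum_inverse: "finite F \<Longrightarrow> x \<in> F \<Longrightarrow> \<exists>i\<in>{1..card F}. x = enum F i"
  using enum_bij[of F] unfolding bij_betw_def by blast

lemma card_less_enum:
  assumes "finite F" "i \<in> {1..card F}"
  shows "card {x \<in> F. x < enum F i} = i - 1" "card {x \<in> F. enum F i < x} = card F - i"
proof -
  have inj: "inj_on (enum F) {1..card F}" and im: "enum F ` {1..card F} = F"
    using enum_bij[OF assms(1)] by (auto simp: bij_betw_def)
  have *: "card {x \<in> F. Q x} = card {j \<in> {1..card F}. Q (enum F j)}" for Q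
  proof -
    have "{x \<in> F. Q x} = enum F ` {j \<in> {1..card F}. Q (enum F j)}"
      by (subst im[symmetric]) blast
    moreover have "inj_on (enum F) {j \<in> {1..card F}. Q (enum F j)}"
      by (rule inj_on_subset[OF inj]) blast
    ultimately show ?thesis by (simp add: card_image)
  qed
  have "{j \<in> {1..card F}. enum F j < enum F i} = {1..<i}"
    using assms by (auto simp: enum_less_iff)
  then show "card {x \<in> F. x < enum F i} = i - 1" unfolding * by simp
  have "{j \<in> {1..card F}. enum F i < enum F j} = {i<..card F}"
    using assms by (auto simp: enum_less_iff)
  then show "card {x \<in> F. enum F i < x} = card F - i" unfolding * by simp
qed

lemma enum_eqI:
  assumes "finite F" "w \<in> F" "card {x \<in> F. x < w} = i - 1" "1 \<le> i"
  shows "enum F i = w"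
proof -
  obtain j where j: "j \<in> {1..card F}" "w = enum F j" using enum_inverse[OF assms(1,2)] by blast
  then have "j - 1 = i - 1" using card_less_enum(1)[OF assms(1) j(1)] assms(3) by simp
  then have "j = i" using j(1) assms(4) by auto
  then show ?thesis using j(2) by simp
qed

text \<open>Pad \<open>w\<close> with \<open>i - 1\<close> smaller and \<open>m - i\<close> larger
  elements. These two counts are all that restricts the position of a vertex in a facet.\<close>

lemma exists_subset_with_enum:
  assumes "finite A" "w \<in> A" "1 \<le> i" "i \<le> m"
    and "i - 1 \<le> card {x \<in> A. x < w}" "m - i \<le> card {x \<in> A. w < x}"
  shows "\<exists>F\<subseteq>A. card F = m \<and> enum F i = w"
proof -
  obtain L where L: "L \<subseteq> {x \<in> A. x < w}" "card L = i - 1"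
    using obtain_subset_with_card_n[OF assms(5)] by blast
  obtain H where H: "H \<subseteq> {x \<in> A. w < x}" "card H = m - i"
    using obtain_subset_with_card_n[OF assms(6)] by blast
  have fin: "finite L" "finite H" using L(1) H(1) assms(1) by (auto intro: finite_subset)
  let ?F = "L \<union> insert w H"
  have "L \<inter> insert w H = {}" "w \<notin> H" using L(1) H(1) by force+
  then have "card ?F = m"
    using fin L(2) H(2) assms(3,4) by (simp add: card_Un_disjoint)
  moreover have "{x \<in> ?F. x < w} = L" using L(1) H(1) by force
  then have "enum ?F i = w" using fin L(2) assms(3) by (intro enum_eqI) auto
  ultimately show ?thesis using L(1) H(1) assms(2) by (intro exI[of _ ?F]) auto
qed

section \<open>Diagonal monomials as leading monomials of minors\<close>

definition cells :: "nat set \<Rightarrow> (nat \<Rightarrow> nat) \<Rightarrow> mon" where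
  "cells I g = (\<Sum>i\<in>I. single (i, g i) 1)"

lemma lookup_cells: "finite I \<Longrightarrow> lookup (cells I g) (i, j) = (if i \<in> I \<and> g i = j then 1 else 0)"
proof -
  assume fin: "finite I"
  have "lookup (cells I g) (i, j) = (\<Sum>k\<in>I. if k = i then (if g i = j then 1 else 0) else 0)"
    unfolding cells_def lookup_sum lookup_single by (intro sum.cong refl) (auto simp: when_def)
  then show ?thesis using fin by simp
qed

lemma keys_cells: "finite I \<Longrightarrow> keys (cells I g) = {(i, g i) | i. i \<in> I}"
  by (auto simp: in_keys_iff lookup_cells split: if_splits)

text \<open>In the first row of disagreement the smaller column is the larger variable.\<close>

lemma cells_less:
  assumes "finite I" "k \<in> I" "\<And>i. i \<in> I \<Longrightarrow> i < k \<Longrightarrow> h i = g i" "g k < h k"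
  shows "cells I h < cells I g"
  unfolding less_mon_iff
proof (intro exI[of _ "(k, g k)"] conjI allI impI)
  show "lookup (cells I h) (k, g k) < lookup (cells I g) (k, g k)"
    using assms by (simp add: lookup_cells)
  fix v' :: "nat \<times> nat" assume v': "v' < (k, g k)"
  obtain i j where ij: "v' = (i, j)" by fastforce
  from v' have "i < k \<or> i = k \<and> j < g k" unfolding ij less_prod_def by auto
  then show "lookup (cells I h) v' = lookup (cells I g) v'"
    using assms by (auto simp: lookup_cells ij)
qed

lemma cells_cong: "(\<And>i. i \<in> I \<Longrightarrow> g i = h i) \<Longrightarrow> cells I g = cells I h"
  unfolding cells_def by (rule sum.cong) auto

lemma of_int_prod_Xvar:
  "of_int s * (\<Prod>i\<in>I. Xvar i (g i)) = (single (cells I g) (of_int s) :: 'a::comm_ring_1 mpoly)"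
proof -
  have "(\<Prod>i\<in>I. Xvar i (g i)) = (single (cells I g) 1 :: 'a mpoly)"
    unfolding cells_def Xvar_def
    by (induction I rule: infinite_finite_induct) (auto simp: mult_single)
  moreover have "of_int s * single t 1 = (single t (of_int s) :: 'a mpoly)" for t
    by (simp add: mult_single flip: single_of_int)
  ultimately show ?thesis by simp
qed

lemma top_at_single: "c \<noteq> 0 \<Longrightarrow> top_at w (single t c) t"
  by (simp add: top_at_def)

lemma of_int_sign_neq_0: "(of_int (sign \<pi>) :: 'b::ring_1) \<noteq> 0"
  by (auto simp: sign_def)

text \<open>A permutation other than the identity sends its first moved row to a larger index, since
  the smaller ones are taken, and this lowers the monomial.\<close>

lemma LM_gdet:
  assumes c: "strict_mono_on {1..m} c"
  shows "gdet m Xvar c \<noteq> (0 :: 'a::field mpoly)" "LM (gdet m Xvar c :: 'a mpoly) = cells {1..m} c"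
proof -
  have "top_at (\<lambda>t. t) (gdet m Xvar c :: 'a mpoly) (cells {1..m} c)"
    unfolding gdet_def of_int_prod_Xvar
  proof (rule top_at_sum[where x = id])
    show "finite {\<pi>. \<pi> permutes {1..m}}" by (rule finite_permutations) simp
    show "id \<in> {\<pi>. \<pi> permutes {1..m}}" by (simp add: permutes_id)
    show "top_at (\<lambda>t. t) (single (cells {1..m} (\<lambda>i. c (id i))) (of_int (sign id)) :: 'a mpoly) (cells {1..m} c)"
      using top_at_single[of "of_int (sign id) :: 'a" "\<lambda>t. t" "cells {1..m} c"] by simp
    fix \<pi> t assume \<pi>: "\<pi> \<in> {\<pi>. \<pi> permutes {1..m}}" "\<pi> \<noteq> id"
      and t: "t \<in> keys (single (cells {1..m} (\<lambda>i. c (\<pi> i))) (of_int (sign \<pi>)) :: 'a mpoly)"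
    have p: "\<pi> permutes {1..m}" using \<pi>(1) by simp
    define k where "k = (LEAST i. \<pi> i \<noteq> i)"
    have ex: "\<exists>i. \<pi> i \<noteq> i" using \<pi>(2) by (auto simp: fun_eq_iff)
    have k: "\<pi> k \<noteq> k" using LeastI_ex[OF ex] by (simp add: k_def)
    have lt: "\<pi> i = i" if "i < k" for i using not_less_Least[of i "\<lambda>i. \<pi> i \<noteq> i"] that by (auto simp: k_def)
    have km: "k \<in> {1..m}" using k p by (metis permutes_not_in)
    then have pm: "\<pi> k \<in> {1..m}" using permutes_in_image[OF p] by simp
    have "k < \<pi> k"
      using k lt[of "\<pi> k"] permutes_inj[OF p] by (metis injD linorder_neqE_nat)
    then have "c k < c (\<pi> k)" using c km pm by (auto simp: strict_mono_on_def)
    then have "cells {1..m} (\<lambda>i. c (\<pi> i)) < cells {1..m} c"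
      using km lt by (intro cells_less[of _ k]) auto
    then show "t < cells {1..m} c" using t by (simp split: if_splits)
  qed
  from top_at_LM[OF this] show "gdet m Xvar c \<noteq> (0 :: 'a mpoly)"
    "LM (gdet m Xvar c :: 'a mpoly) = cells {1..m} c" by auto
qed

text \<open>Without row 1 and the last column the diagonal is shifted: row \<open>i\<close> meets
  column \<open>i - 1\<close>. The shift is what separates this monomial from the diagonals of
  maximal minors.\<close>

lemma LM_last_cofactor:
  assumes c: "strict_mono_on {1..<m} c" and m: "1 \<le> m"
  shows "last_cofactor m Xvar c 1 \<noteq> (0 :: 'a::field mpoly)"
    "LM (last_cofactor m Xvar c 1 :: 'a mpoly) = cells {2..m} (\<lambda>i. c (i - 1))"
proof -
  \<comment> \<open>The cycle behind the shifted diagonal: row 1 is given the deleted column, every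
    later row moves one column down.\<close>
  define \<sigma> where "\<sigma> i = (if i = 1 then m else if i \<in> {2..m} then i - 1 else i)" for i
  have set: "{1..m} - {1} = {2..m}" by auto
  have \<sigma>: "\<sigma> permutes {1..m}"
  proof (rule bij_imp_permutes)
    show "bij_betw \<sigma> {1..m} {1..m}"
      by (rule bij_betw_byWitness[of _ "\<lambda>i. if i = m then 1 else i + 1"]) (use m in \<open>auto simp: \<sigma>_def\<close>)
    show "\<sigma> x = x" if "x \<notin> {1..m}" for x using that m by (auto simp: \<sigma>_def)
  qed
  have eq: "cells {2..m} (\<lambda>i. c (\<sigma> i)) = cells {2..m} (\<lambda>i. c (i - 1))"
    by (rule cells_cong) (auto simp: \<sigma>_def)
  have "top_at (\<lambda>t. t) (last_cofactor m Xvar c 1 :: 'a mpoly) (cells {2..m} (\<lambda>i. c (i - 1)))"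
    unfolding last_cofactor_def of_int_prod_Xvar set
  proof (rule top_at_sum[where x = \<sigma>])
    show "finite {\<pi>. \<pi> permutes {1..m} \<and> \<pi> 1 = m}"
      by (rule finite_subset[OF _ finite_permutations[of "{1..m}"]]) auto
    show "\<sigma> \<in> {\<pi>. \<pi> permutes {1..m} \<and> \<pi> 1 = m}" using \<sigma> by (simp add: \<sigma>_def)
    show "top_at (\<lambda>t. t) (single (cells {2..m} (\<lambda>i. c (\<sigma> i))) (of_int (sign \<sigma>)) :: 'a mpoly)
        (cells {2..m} (\<lambda>i. c (i - 1)))"
      unfolding eq by (rule top_at_single) (rule of_int_sign_neq_0)
    fix \<pi> t assume \<pi>: "\<pi> \<in> {\<pi>. \<pi> permutes {1..m} \<and> \<pi> 1 = m}" "\<pi> \<noteq> \<sigma>"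
      and t: "t \<in> keys (single (cells {2..m} (\<lambda>i. c (\<pi> i))) (of_int (sign \<pi>)) :: 'a mpoly)"
    have p: "\<pi> permutes {1..m}" and p1: "\<pi> 1 = m" using \<pi>(1) by auto
    define k where "k = (LEAST i. \<pi> i \<noteq> \<sigma> i)"
    have ex: "\<exists>i. \<pi> i \<noteq> \<sigma> i" using \<pi>(2) by (auto simp: fun_eq_iff)
    have k: "\<pi> k \<noteq> \<sigma> k" using LeastI_ex[OF ex] by (simp add: k_def)
    have lt: "\<pi> i = \<sigma> i" if "i < k" for i
      using not_less_Least[of i "\<lambda>i. \<pi> i \<noteq> \<sigma> i"] that by (auto simp: k_def)
    have "k \<noteq> 1" using k p1 by (auto simp: \<sigma>_def)
    moreover have "k \<in> {1..m}" using k p \<sigma> by (metis permutes_not_in)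
    ultimately have km: "k \<in> {2..m}" by auto
    then have pm: "\<pi> k \<in> {1..m}" using permutes_in_image[OF p, of k] by simp
    have inj: "\<pi> k \<noteq> \<pi> j" if "j \<noteq> k" for j using that permutes_inj[OF p] by (auto dest: injD)
    have "\<pi> k \<noteq> m" using inj[of 1] p1 km by auto
    moreover have "k - 1 < \<pi> k"
    proof (rule ccontr)
      assume "\<not> k - 1 < \<pi> k"
      then have "\<pi> k < k - 1" using k km by (auto simp: \<sigma>_def)
      then have "\<pi> (\<pi> k + 1) = \<sigma> (\<pi> k + 1)" by (intro lt) auto
      also have "\<dots> = \<pi> k" using \<open>\<pi> k < k - 1\<close> km pm by (auto simp: \<sigma>_def)
      finally have "\<pi> k + 1 = k" using inj[of "\<pi> k + 1"] by metis
      then show False using \<open>\<pi> k < k - 1\<close> by simp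
    qed
    ultimately have "c (k - 1) < c (\<pi> k)" using c km pm by (auto simp: strict_mono_on_def)
    then have "cells {2..m} (\<lambda>i. c (\<pi> i)) < cells {2..m} (\<lambda>i. c (i - 1))"
      using km lt by (intro cells_less[of _ k]) (auto simp: \<sigma>_def)
    then show "t < cells {2..m} (\<lambda>i. c (i - 1))" using t by (simp split: if_splits)
  qed
  from top_at_LM[OF this] show "last_cofactor m Xvar c 1 \<noteq> (0 :: 'a mpoly)"
    "LM (last_cofactor m Xvar c 1 :: 'a mpoly) = cells {2..m} (\<lambda>i. c (i - 1))" by auto
qed

lemma gdet_polys_in:
  assumes "\<And>j. j \<in> {1..m} \<Longrightarrow> c j \<in> C"
  shows "gdet m Xvar c \<in> polys_in ({1..m} \<times> C)"
  unfolding gdet_def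
proof (intro polys_in_sum polys_in_mult polys_in_of_int polys_in_prod polys_in_Xvar, goal_cases)
  case (1 \<pi> i)
  then show ?case using permutes_in_image[of \<pi> "{1..m}" i] assms by auto
qed

lemma last_cofactor_polys_in:
  assumes "\<And>j. j \<in> {1..<m} \<Longrightarrow> c j \<in> C" "i \<in> {1..m}"
  shows "last_cofactor m Xvar c i \<in> polys_in (({1..m} - {i}) \<times> C)"
  unfolding last_cofactor_def
proof (intro polys_in_sum polys_in_mult polys_in_of_int polys_in_prod polys_in_Xvar, goal_cases)
  case (1 \<pi> k)
  then have "\<pi> k \<in> {1..m}" "\<pi> k \<noteq> m"
    using permutes_in_image[of \<pi> "{1..m}" k] by (auto dest: permutes_inj injD)
  then show ?case using 1 assms by auto
qed

definition chains :: "nat \<Rightarrow> nat set \<Rightarrow> mon set" where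
  "chains m A = {cells {1..m} (enum F) |F. F \<subseteq> A \<and> card F = m}"

lemma enum_strict_mono: "finite F \<Longrightarrow> card F = m \<Longrightarrow> strict_mono_on {1..m} (enum F)"
  by (auto simp: strict_mono_on_def intro: enum_mono)

lemma LM_minor:
  assumes "finite F" "card F = m"
  shows "minor m F \<noteq> (0 :: 'a::field mpoly)" "LM (minor m F :: 'a mpoly) = cells {1..m} (enum F)"
  unfolding minor_gdet using LM_gdet[OF enum_strict_mono[OF assms]] by auto

lemma minor_polys_in: "finite F \<Longrightarrow> card F = m \<Longrightarrow> F \<subseteq> C \<Longrightarrow> minor m F \<in> polys_in ({1..m} \<times> C)"
  unfolding minor_gdet using enum_in[of F] by (intro gdet_polys_in) auto

section \<open>Maximal minors of a generic matrix\<close>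

text \<open>An exchange argument in one row. From the supply \<open>p c + N c = p' c + N' c\<close>,
  the choice \<open>N'\<close> takes everything strictly between \<open>T\<close> and
  \<open>T'\<close>, possibly something at \<open>T'\<close>, and nothing else. These are the
  columns cheapest under \<open>H\<close>, so \<open>N'\<close> costs least among all choices of its
  size, and its remainder \<open>p'\<close> costs most, uniquely so. Columns up to \<open>T\<close>,
  from which \<open>N'\<close> takes nothing, get the maximal price \<open>big\<close>.\<close>

lemma greedy_row:
  fixes p p' N N' :: "nat \<Rightarrow> nat"
  assumes A: "finite A" "\<And>c. c \<in> A \<Longrightarrow> c < big"
    and eq: "\<And>c. c \<in> A \<Longrightarrow> p c + N c = p' c + N' c" and sum: "sum N A = sum N' A"
    and N': "\<And>c. c \<in> A \<Longrightarrow> c \<le> T \<or> T' < c \<Longrightarrow> N' c = 0"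
    and p': "\<And>c. c \<in> A \<Longrightarrow> T < c \<Longrightarrow> c < T' \<Longrightarrow> p' c = 0"
    and T': "T' = big \<or> T < T' \<and> T' < big"
  defines "H \<equiv> \<lambda>c. if T < c then c else big"
  shows "(\<Sum>c\<in>A. p c * H c) \<le> (\<Sum>c\<in>A. p' c * H c)"
    and "(\<Sum>c\<in>A. p c * H c) = (\<Sum>c\<in>A. p' c * H c) \<Longrightarrow> c \<in> A \<Longrightarrow> p c = p' c"
proof -
  define d where "d c = int (N c) - int (N' c)" for c
  \<comment> \<open>Relative to \<open>T'\<close> the price is negative only where \<open>N'\<close>
    takes everything and positive only where \<open>N'\<close> takes nothing.\<close>
  define e where "e c = int (H c) - int T'" for c
  have sd: "sum d A = 0" using sum by (simp add: d_def sum_subtractf flip: of_nat_sum)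
  have pd: "int (p' c) - int (p c) = d c" if "c \<in> A" for c using eq[OF that] by (simp add: d_def)
  have "int (\<Sum>c\<in>A. p' c * H c) - int (\<Sum>c\<in>A. p c * H c) = (\<Sum>c\<in>A. d c * int (H c))"
    by (simp add: pd flip: sum_subtractf left_diff_distrib)
  also have "\<dots> = (\<Sum>c\<in>A. d c * e c) + int T' * sum d A"
    by (simp add: e_def algebra_simps sum_subtractf sum_distrib_left)
  finally have main: "int (\<Sum>c\<in>A. p' c * H c) - int (\<Sum>c\<in>A. p c * H c) = (\<Sum>c\<in>A. d c * e c)"
    by (simp add: sd)
  have neg: "d c \<le> 0" if "c \<in> A" "e c < 0" for c
  proof -
    have "T < c" "c < T'" using that A(2)[OF that(1)] T' by (auto simp: e_def H_def split: if_splits)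
    then show ?thesis using p'[OF that(1)] eq[OF that(1)] by (simp add: d_def)
  qed
  have pos: "d c \<ge> 0" if "c \<in> A" "e c > 0" for c
  proof -
    have "c \<le> T \<or> T' < c" using that by (auto simp: e_def H_def split: if_splits)
    then show ?thesis using N'[OF that(1)] by (simp add: d_def)
  qed
  have nn: "d c * e c \<ge> 0" if "c \<in> A" for c
    using neg[OF that] pos[OF that] by (cases "e c" "0 :: int" rule: linorder_cases)
      (auto simp: mult_nonpos_nonpos)
  then have "(\<Sum>c\<in>A. d c * e c) \<ge> 0" by (rule sum_nonneg)
  with main show "(\<Sum>c\<in>A. p c * H c) \<le> (\<Sum>c\<in>A. p' c * H c)" by linarith
  assume "(\<Sum>c\<in>A. p c * H c) = (\<Sum>c\<in>A. p' c * H c)" and c: "c \<in> A"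
  then have "(\<Sum>c\<in>A. d c * e c) = 0" using main by simp
  then have "\<forall>c\<in>A. d c * e c = 0" using sum_nonneg_eq_0_iff[OF A(1), of "\<lambda>c. d c * e c"] nn by simp
  then have d0: "d c = 0" if "c \<in> A" "e c \<noteq> 0" for c using that by auto
  \<comment> \<open>Columns with \<open>e = 0\<close> remain. For \<open>T' = big\<close> these are
    columns up to \<open>T\<close>, where \<open>d\<close> is nonnegative with total 0; otherwise
    only \<open>T'\<close> itself is left, and the total determines it.\<close>
  have "d c = 0"
  proof (cases "T' = big")
    case True
    have "d x \<ge> 0" if "x \<in> A" for x
    proof (cases "e x = 0")
      case True
      then have "x \<le> T" using \<open>T' = big\<close> A(2)[OF that] by (auto simp: e_def H_def split: if_splits)
      then show ?thesis using N'[OF that] by (simp add: d_def)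
    qed (use d0 that in simp)
    then show ?thesis using sum_nonneg_eq_0_iff[OF A(1), of d] sd c by simp
  next
    case False
    then have eT: "x = T'" if "e x = 0" for x
      using T' that by (auto simp: e_def H_def split: if_splits)
    have "sum d A = (\<Sum>x\<in>A. if x = T' then d T' else 0)"
      using d0 eT by (intro sum.cong) auto
    then have "T' \<in> A \<Longrightarrow> d T' = 0" using sd A(1) by simp
    then show ?thesis using d0[OF c] eT[of c] c by auto
  qed
  then show "p c = p' c" using pd[OF c] by simp
qed

context
  fixes A :: "nat set" and big :: nat
begin

text \<open>Taking the first admissible column in every row leaves the most room for the later rows.
  With all columns strictly between 0 and \<open>big\<close>, the start value 0 excludes nothing,
  and \<open>big\<close> marks the end of the chain and persists from there on.\<close>

primrec greedy :: "(nat \<Rightarrow> nat \<Rightarrow> nat) \<Rightarrow> nat \<Rightarrow> nat" where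
  "greedy b 0 = 0"
| "greedy b (Suc j) = (if \<exists>c\<in>A. greedy b j < c \<and> b (Suc j) c > 0
     then LEAST c. c \<in> A \<and> greedy b j < c \<and> b (Suc j) c > 0 else big)"

declare greedy.simps(2) [simp del]

lemma greedy_cong:
  assumes "\<And>i c. i \<in> {1..j} \<Longrightarrow> c \<in> A \<Longrightarrow> b i c = b' i c"
  shows "greedy b j = greedy b' j"
  using assms
proof (induction j)
  case (Suc j)
  have "greedy b j = greedy b' j" using Suc.prems by (intro Suc.IH) auto
  moreover have "b (Suc j) c = b' (Suc j) c" if "c \<in> A" for c using Suc.prems[of "Suc j" c] that by auto
  ultimately have "(\<lambda>c. c \<in> A \<and> greedy b j < c \<and> b (Suc j) c > 0) =
      (\<lambda>c. c \<in> A \<and> greedy b' j < c \<and> b' (Suc j) c > 0)" by (auto simp: fun_eq_iff)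
  then show ?case unfolding greedy.simps Bex_def by metis
qed simp

lemma greedy_Suc:
  "greedy b (Suc j) = big \<or> greedy b (Suc j) \<in> A \<and> greedy b j < greedy b (Suc j) \<and> b (Suc j) (greedy b (Suc j)) > 0"
proof (cases "\<exists>c\<in>A. greedy b j < c \<and> b (Suc j) c > 0")
  case True
  then have ex: "\<exists>c. c \<in> A \<and> greedy b j < c \<and> b (Suc j) c > 0" by blast
  from LeastI_ex[OF ex] show ?thesis using True by (simp add: greedy.simps(2))
next
  case False
  then have "greedy b (Suc j) = big" by (simp only: greedy.simps(2) if_False)
  then show ?thesis ..
qed

lemma greedy_least:
  assumes "c \<in> A" "greedy b j < c" "c < greedy b (Suc j)" shows "b (Suc j) c = 0"
proof (rule ccontr)
  assume "b (Suc j) c \<noteq> 0"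
  then have "\<exists>c\<in>A. greedy b j < c \<and> b (Suc j) c > 0" using assms by auto
  then have "greedy b (Suc j) = (LEAST c. c \<in> A \<and> greedy b j < c \<and> b (Suc j) c > 0)"
    by (simp only: greedy.simps(2) if_True)
  also have "\<dots> \<le> c" using assms \<open>b (Suc j) c \<noteq> 0\<close> by (intro Least_le) auto
  finally show False using assms(3) by simp
qed

lemma greedy_mono:
  assumes "\<And>c. c \<in> A \<Longrightarrow> c < big" "greedy b (Suc j) < big"
  shows "greedy b (Suc j) \<in> A" "greedy b j < greedy b (Suc j)" "b (Suc j) (greedy b (Suc j)) > 0"
    "greedy b j < big"
  using greedy_Suc[of b j] assms(2) by (auto intro: less_trans)

lemma greedy_less_big:
  assumes "\<And>c. c \<in> A \<Longrightarrow> c < big" "greedy b k < big" "j \<le> k"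
  shows "greedy b j < big"
  using assms(3,2)
proof (induction rule: inc_induct)
  case (step i)
  then show ?case using greedy_mono(4)[OF assms(1), where b = b and j = i] by simp
qed

lemma greedy_strict_mono:
  assumes "\<And>c. c \<in> A \<Longrightarrow> c < big" "greedy b k < big" "i < j" "j \<le> k"
  shows "greedy b i < greedy b j"
  using assms(3,4)
proof (induction j)
  case (Suc j)
  have "greedy b (Suc j) < big" using greedy_less_big[OF assms(1,2) Suc.prems(2)] by blast
  from greedy_mono(2)[OF assms(1) this] have "greedy b j < greedy b (Suc j)" by blast
  then show ?case using Suc by (cases "i = j") auto
qed simp

text \<open>The price of a column depends on \<open>b\<close> only through the rows before
  \<open>j\<close>, so two monomials that agree in those rows are priced alike in row
  \<open>j\<close>.\<close>

definition weight :: "(nat \<Rightarrow> nat \<Rightarrow> nat) \<Rightarrow> nat \<Rightarrow> nat" where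
  "weight b j = (\<Sum>c\<in>A. b j c * (if greedy b (j - 1) < c then c else big))"

text \<open>Up to the first row in which \<open>b\<close> and \<open>b'\<close> differ the greedy
  columns coincide; in that row \<open>greedy_row\<close> applies, with \<open>T\<close> and
  \<open>T'\<close> the greedy columns of \<open>b'\<close> before and in that row.\<close>

lemma greedy_extremal:
  assumes A: "finite A" "\<And>c. c \<in> A \<Longrightarrow> 0 < c \<and> c < big"
    and eq: "\<And>i c. i \<in> {1..<m} \<Longrightarrow> c \<in> A \<Longrightarrow> b i c + N i c = b' i c + N' i c"
    and sum: "\<And>i. i \<in> {1..<m} \<Longrightarrow> sum (N i) A = sum (N' i) A"
    and N': "\<And>i c. i \<in> {1..<m} \<Longrightarrow> c \<in> A \<Longrightarrow> N' i c > 0 \<Longrightarrow> greedy b' (i - 1) < c \<and> c \<le> greedy b' i"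
    and ne: "i \<in> {1..<m}" "c \<in> A" "b i c \<noteq> b' i c"
  shows "\<exists>t\<in>{1..<m}. (\<forall>j\<in>{1..<t}. weight b j = weight b' j) \<and> weight b t < weight b' t"
proof -
  define P where "P t \<longleftrightarrow> t \<in> {1..<m} \<and> (\<exists>c\<in>A. b t c \<noteq> b' t c)" for t
  have Pi: "P i" using ne by (auto simp: P_def)
  define t where "t = (LEAST t. P t)"
  have Pt: "P t" unfolding t_def by (rule LeastI[of P, OF Pi])
  have same: "b j c = b' j c" if "j \<in> {1..<t}" "c \<in> A" for j c
    using not_less_Least[of j P] that Pt by (auto simp: t_def P_def)
  have gr: "greedy b j = greedy b' j" if "j < t" for j
    using that by (intro greedy_cong same) auto
  have "weight b j = weight b' j" if "j \<in> {1..<t}" for j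
  proof -
    have "j - 1 < t" using that by auto
    then show ?thesis unfolding weight_def using gr[of "j - 1"] same[OF that] by (intro sum.cong) auto
  qed
  moreover have "weight b t < weight b' t"
  proof -
    obtain s where s: "t = Suc s" using Pt by (cases t) (auto simp: P_def)
    have tm: "t \<in> {1..<m}" using Pt by (simp add: P_def)
    have T: "greedy b' t = big \<or> greedy b' s < greedy b' t \<and> greedy b' t < big"
      using greedy_Suc[of b' s] A(2) s by auto
    have H: "greedy b (t - 1) = greedy b' s" using gr[of s] s by simp
    have N0: "N' t c = 0" if "c \<in> A" "c \<le> greedy b' s \<or> greedy b' t < c" for c
      using N'[OF tm that(1)] that(2) s by (cases "N' t c") auto
    have p0: "b' t c = 0" if "c \<in> A" "greedy b' s < c" "c < greedy b' t" for c
      using greedy_least[of c b' s] that s by simp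
    have bigA: "\<And>c. c \<in> A \<Longrightarrow> c < big" using A(2) by blast
    note g = greedy_row[OF A(1) bigA eq[OF tm] sum[OF tm] N0 p0 T]
    have "weight b t \<le> weight b' t" unfolding weight_def H using g(1) s by simp
    moreover have "weight b t \<noteq> weight b' t"
    proof
      assume "weight b t = weight b' t"
      then have "b t c = b' t c" if "c \<in> A" for c
        using g(2)[of c] that s unfolding weight_def H by simp
      then show False using Pt by (auto simp: P_def)
    qed
    ultimately show ?thesis by simp
  qed
  moreover have "t \<in> {1..<m}" using Pt by (simp add: P_def)
  ultimately show ?thesis by blast
qed

end

section \<open>Monomials in products of powers of sums, and chains dividing a monomial\<close>

lemma keys_sum_single:
  "k \<in> keys (\<Sum>i\<in>I. single (g i) (1 :: 'b::comm_semiring_1)) \<Longrightarrow> \<exists>i\<in>I. k = g i"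
proof (rule ccontr)
  assume "k \<in> keys (\<Sum>i\<in>I. single (g i) (1 :: 'b))" "\<not> (\<exists>i\<in>I. k = g i)"
  then have "lookup (\<Sum>i\<in>I. single (g i) (1 :: 'b)) k = 0"
    unfolding lookup_sum by (intro sum.neutral) (auto simp: lookup_single when_def)
  with \<open>k \<in> keys _\<close> show False by (simp add: in_keys_iff)
qed

lemma keys_power_sum_single:
  fixes g :: "'i \<Rightarrow> mon"
  assumes "finite I" "k \<in> keys ((\<Sum>i\<in>I. single (g i) (1 :: 'b::comm_ring_1)) ^ e)"
  shows "\<exists>N. sum N I = e \<and> (\<forall>v. lookup k v = (\<Sum>i\<in>I. N i * lookup (g i) v))"
  using assms(2)
proof (induction e arbitrary: k)
  case 0
  then have "k = 0" by (simp split: if_splits)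
  then show ?case by (intro exI[of _ "\<lambda>_. 0"]) simp
next
  case (Suc e)
  then obtain s t where st: "s \<in> keys (\<Sum>i\<in>I. single (g i) (1 :: 'b))"
    "t \<in> keys ((\<Sum>i\<in>I. single (g i) (1 :: 'b)) ^ e)" "k = s + t" by (auto elim: keys_times_E)
  obtain i where i: "i \<in> I" "s = g i" using keys_sum_single[OF st(1)] by blast
  obtain N where N: "sum N I = e" "\<And>v. lookup t v = (\<Sum>i\<in>I. N i * lookup (g i) v)"
    using Suc.IH[OF st(2)] by blast
  let ?N = "\<lambda>j. N j + (if j = i then 1 else 0)"
  have "sum ?N I = Suc e" using i(1) assms(1) N(1) by (simp add: sum.distrib)
  moreover have "(\<Sum>j\<in>I. ?N j * lookup (g j) v) = lookup k v" for v
  proof -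
    have "(\<Sum>j\<in>I. ?N j * lookup (g j) v) = (\<Sum>j\<in>I. N j * lookup (g j) v + (if j = i then lookup (g i) v else 0))"
      by (intro sum.cong) (auto simp: algebra_simps)
    then show ?thesis using i assms(1) N(2) st(3) by (simp add: sum.distrib lookup_add)
  qed
  ultimately show ?case by (intro exI[of _ ?N]) simp
qed

text \<open>Each monomial of the expansion comes from a distribution \<open>N\<close> of the
  exponents over the summands. No converse is claimed, since a multinomial coefficient may vanish in
  the coefficient ring.\<close>

lemma keys_prod_power_sum_single:
  fixes g :: "'i \<Rightarrow> 'c \<Rightarrow> mon"
  assumes "finite I" "finite A" "k \<in> keys (\<Prod>c\<in>A. (\<Sum>i\<in>I. single (g i c) (1 :: 'b::comm_ring_1)) ^ e c)"
  shows "\<exists>N. (\<forall>c\<in>A. (\<Sum>i\<in>I. N i c) = e c) \<and> (\<forall>v. lookup k v = (\<Sum>c\<in>A. \<Sum>i\<in>I. N i c * lookup (g i c) v))"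
  using assms(2,3)
proof (induction A arbitrary: k)
  case empty
  then have "k = 0" by (simp split: if_splits)
  then show ?case by simp
next
  case (insert x A)
  then obtain s t where st: "s \<in> keys ((\<Sum>i\<in>I. single (g i x) (1 :: 'b)) ^ e x)"
    "t \<in> keys (\<Prod>c\<in>A. (\<Sum>i\<in>I. single (g i c) (1 :: 'b)) ^ e c)" "k = s + t"
    by (auto elim: keys_times_E)
  obtain N1 where N1: "sum N1 I = e x" "\<And>v. lookup s v = (\<Sum>i\<in>I. N1 i * lookup (g i x) v)"
    using keys_power_sum_single[OF assms(1) st(1)] by blast
  obtain N where N: "\<And>c. c \<in> A \<Longrightarrow> (\<Sum>i\<in>I. N i c) = e c"
    "\<And>v. lookup t v = (\<Sum>c\<in>A. \<Sum>i\<in>I. N i c * lookup (g i c) v)"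
    using insert.IH[OF st(2)] by blast
  let ?N = "\<lambda>i c. if c = x then N1 i else N i c"
  have ne: "c \<noteq> x" if "c \<in> A" for c using that insert.hyps by blast
  have "(\<Sum>i\<in>I. ?N i c) = e c" if "c \<in> insert x A" for c
    using that N(1) N1(1) by (cases "c = x") auto
  moreover have "lookup k v = (\<Sum>c\<in>insert x A. \<Sum>i\<in>I. ?N i c * lookup (g i c) v)" for v
  proof -
    have "(\<Sum>c\<in>A. \<Sum>i\<in>I. ?N i c * lookup (g i c) v) = lookup t v"
      unfolding N(2) by (intro sum.cong refl) (use ne in auto)
    then show ?thesis using insert.hyps st(3) N1(2) by (simp add: lookup_add)
  qed
  ultimately show ?case by (intro exI[of _ ?N]) blast
qed

lemma enum_image_strict_mono:
  assumes "strict_mono_on {1..m} s" "i \<in> {1..m}"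
  shows "enum (s ` {1..m}) i = s i" "card (s ` {1..m}) = m"
proof -
  have inj: "inj_on s {1..m}" by (rule strict_mono_on_imp_inj_on[OF assms(1)])
  show "card (s ` {1..m}) = m" by (simp only: card_image[OF inj] card_atLeastAtMost)
  have lt: "s j < s i \<longleftrightarrow> j < i" if "j \<in> {1..m}" for j
    using assms that by (metis linorder_less_linear order_less_asym strict_mono_onD)
  have "{x \<in> s ` {1..m}. x < s i} = s ` {1..<i}"
    using lt assms(2) by force
  moreover have "inj_on s {1..<i}" using assms(2) by (intro inj_on_subset[OF inj]) auto
  ultimately show "enum (s ` {1..m}) i = s i"
    using assms(2) by (intro enum_eqI) (auto simp: card_image)
qed

lemma mon_dvdI:
  fixes s t :: mon
  assumes "\<And>v. lookup s v \<le> lookup t v" shows "\<exists>u. t = s + u"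
proof
  show "t = s + (t - s)" using assms by (intro poly_mapping_eqI) (simp add: lookup_add lookup_minus)
qed

text \<open>An occupied cell of row \<open>m\<close> beyond the greedy column of row
  \<open>m - 1\<close> completes the greedy columns to a chain. In a chain-free monomial the
  occupied columns of row \<open>m\<close> are therefore all covered by the greedy intervals of the
  earlier rows.\<close>

lemma greedy_chain:
  fixes b :: mon
  assumes A: "finite A" "\<And>c. c \<in> A \<Longrightarrow> 0 < c \<and> c < big"
    and m: "1 \<le> m" and c: "c \<in> A" "lookup b (m, c) > 0"
    and lt: "greedy A big (\<lambda>i c. lookup b (i, c)) (m - 1) < c"
  shows "\<exists>t\<in>chains m A. \<exists>u. b = t + u"
proof -
  let ?b = "\<lambda>i c. lookup b (i, c)"
  let ?g = "greedy A big ?b"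
  have bigA: "\<And>c. c \<in> A \<Longrightarrow> c < big" using A(2) by blast
  define s where "s i = (if i < m then ?g i else c)" for i
  have gb: "?g (m - 1) < big" using lt A(2)[OF c(1)] by simp
  have sA: "s i \<in> A \<and> lookup b (i, s i) > 0" if i: "i \<in> {1..m}" for i
  proof (cases "i < m")
    case True
    then obtain j where j: "i = Suc j" using i by (cases i) auto
    then have "?g (Suc j) < big" using greedy_less_big[OF bigA gb, of i] True by simp
    from greedy_mono(1,3)[OF bigA this] show ?thesis using True j by (simp add: s_def)
  next
    case False
    then have "i = m" using i by simp
    then show ?thesis using c by (simp add: s_def)
  qed
  have mono: "strict_mono_on {1..m} s"
  proof (rule strict_mono_onI)
    fix i j assume ij: "i \<in> {1..m}" "j \<in> {1..m}" "i < j"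
    show "s i < s j"
    proof (cases "j < m")
      case True
      then show ?thesis using ij greedy_strict_mono[OF bigA gb, of i j] by (simp add: s_def)
    next
      case False
      then have j: "j = m" using ij by simp
      have "i = m - 1 \<or> i < m - 1" using ij j by auto
      then have "?g i \<le> ?g (m - 1)" using greedy_strict_mono[OF bigA gb, of i "m - 1"] by auto
      then show ?thesis using lt ij j by (simp add: s_def)
    qed
  qed
  let ?F = "s ` {1..m}"
  have "cells {1..m} (enum ?F) = cells {1..m} s"
    by (rule cells_cong) (rule enum_image_strict_mono(1)[OF mono])
  moreover have "cells {1..m} (enum ?F) \<in> chains m A"
    unfolding chains_def using sA enum_image_strict_mono(2)[OF mono, of m] m
    by (intro CollectI exI[of _ ?F] conjI) auto
  moreover have "lookup (cells {1..m} s) v \<le> lookup b v" for v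
    using sA by (cases v) (force simp: lookup_cells)
  ultimately show ?thesis using mon_dvdI by metis
qed

lemma monev_sum_single:
  assumes "finite A"
  shows "monev f (\<Sum>c\<in>A. single (m, c) (k c)) = (\<Prod>c\<in>A. f (m, c) ^ k c)"
  using assms by (induction A) (auto simp: monev_add monev_single)

section \<open>Independence of chain-free monomials at the generic point\<close>

context
  fixes m :: nat and A :: "nat set"
begin

text \<open>The generic point of the locus where the columns in \<open>A\<close> lie on a common hyperplane:
  row \<open>m\<close> becomes a combination of the other rows, and the cells \<open>(0, i)\<close> of the otherwise
  unused row \<open>0\<close> serve as its coefficients.\<close>

definition generic_pt :: "nat \<times> nat \<Rightarrow> 'a::comm_ring_1 mpoly" where
  "generic_pt v = (if fst v = m \<and> snd v \<in> A
     then \<Sum>i\<in>{1..<m}. Xvar 0 i * Xvar i (snd v) else Xvar (fst v) (snd v))"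

definition off_row :: "mon \<Rightarrow> mon" where
  "off_row b = b - (\<Sum>c\<in>A. single (m, c) (lookup b (m, c)))"

text \<open>One summand of what \<open>generic_pt\<close> puts into cell \<open>(m, c)\<close>: the
  coefficient of row \<open>i\<close> times the entry of row \<open>i\<close>.\<close>

definition sub_cell :: "nat \<Rightarrow> nat \<Rightarrow> mon" where
  "sub_cell i c = single (0, i) 1 + single (i, c) 1"

lemma generic_pt_kills_minor:
  assumes F: "F \<subseteq> A" "finite F" "card F = m" and m: "1 \<le> m"
  shows "subst generic_pt (minor m F) = (0 :: 'a::comm_ring_1 mpoly)"
proof -
  have "gdet m (\<lambda>i j. generic_pt (i, j) :: 'a mpoly) (enum F) = 0"
  proof (rule gdet_row_combination[where r = m and w = "\<lambda>i. Xvar 0 i"])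
    show "m \<in> {1..m}" using m by simp
    fix j assume "j \<in> {1..m}"
    then have "enum F j \<in> A" using F enum_in[of F j] by auto
    moreover have "{1..m} - {m} = {1..<m}" by auto
    ultimately show "generic_pt (m, enum F j) = (\<Sum>i\<in>{1..m} - {m}. Xvar 0 i * (generic_pt (i, enum F j) :: 'a mpoly))"
      by (auto simp: generic_pt_def intro!: sum.cong)
  qed
  then show ?thesis by (simp add: minor_gdet subst_gdet)
qed

lemma lookup_row_sum:
  assumes "finite A"
  shows "lookup (\<Sum>c\<in>A. single (m, c) (lookup (b :: mon) (m, c))) v
    = (if fst v = m \<and> snd v \<in> A then lookup b v else 0)"
proof (cases v)
  case (Pair i j)
  have "lookup (\<Sum>c\<in>A. single (m, c) (lookup b (m, c))) v = (\<Sum>c\<in>A. if c = j then (if i = m then lookup b v else 0) else 0)"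
    unfolding lookup_sum lookup_single Pair by (intro sum.cong) (auto simp: when_def)
  then show ?thesis using assms Pair by simp
qed

lemma lookup_off_row:
  "finite A \<Longrightarrow> lookup (off_row b) v = (if fst v = m \<and> snd v \<in> A then 0 else lookup b v)"
  by (simp add: off_row_def lookup_minus lookup_row_sum)

lemma monev_generic_pt:
  assumes A: "finite A"
  shows "monev generic_pt b = single (off_row b) 1 *
    (\<Prod>c\<in>A. (\<Sum>i\<in>{1..<m}. single (sub_cell i c) (1 :: 'a::comm_ring_1)) ^ lookup b (m, c))"
proof -
  have b: "monev generic_pt b = (monev generic_pt (off_row b + (\<Sum>c\<in>A. single (m, c) (lookup b (m, c)))) :: 'a mpoly)"
  proof (rule arg_cong[where f = "monev generic_pt"])
    show "b = off_row b + (\<Sum>c\<in>A. single (m, c) (lookup b (m, c)))"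
      using A by (intro poly_mapping_eqI) (simp add: lookup_add lookup_off_row lookup_row_sum)
  qed
  have "monev generic_pt (off_row b) = monev (\<lambda>(i, j). Xvar i j :: 'a mpoly) (off_row b)"
    unfolding monev_def
    by (rule prod.cong) (use A in \<open>auto simp: generic_pt_def in_keys_iff lookup_off_row\<close>)
  moreover have "monev generic_pt (\<Sum>c\<in>A. single (m, c) (lookup b (m, c)))
      = (\<Prod>c\<in>A. generic_pt (m, c) ^ lookup b (m, c) :: 'a mpoly)"
    by (rule monev_sum_single[OF A])
  moreover have "generic_pt (m, c) = (\<Sum>i\<in>{1..<m}. single (sub_cell i c) 1 :: 'a mpoly)" if "c \<in> A" for c
    using that by (simp add: generic_pt_def Xvar_def mult_single sub_cell_def)
  ultimately show ?thesis
    unfolding b monev_add monev_Xvar by simp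
qed

lemma lookup_sub_cell:
  "lookup (sub_cell i c) v = (if v = (0, i) then 1 else 0) + (if v = (i, c) then 1 else 0)"
  by (auto simp: sub_cell_def lookup_add lookup_single when_def)

text \<open>The distribution can be read off in two ways: cell \<open>(i, x)\<close> shows the
  individual number \<open>N i x\<close>, and the auxiliary cell \<open>(0, i)\<close> shows the
  total moved into row \<open>i\<close>.\<close>

lemma lookup_sub_cell_sums:
  assumes A: "finite A" and i: "i \<in> {1..<m}"
  shows "(\<Sum>c\<in>A. \<Sum>j\<in>{1..<m}. N j c * lookup (sub_cell j c) (i, x)) = (if x \<in> A then N i x else 0)"
    "(\<Sum>c\<in>A. \<Sum>j\<in>{1..<m}. N j c * lookup (sub_cell j c) (0, i)) = (\<Sum>c\<in>A. N i c)"
proof -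
  have "(\<Sum>c\<in>A. \<Sum>j\<in>{1..<m}. N j c * lookup (sub_cell j c) (i, x))
      = (\<Sum>c\<in>A. \<Sum>j\<in>{1..<m}. if j = i then (if c = x then N i x else 0) else 0)"
    using i by (intro sum.cong refl) (auto simp: lookup_sub_cell)
  then show "(\<Sum>c\<in>A. \<Sum>j\<in>{1..<m}. N j c * lookup (sub_cell j c) (i, x)) = (if x \<in> A then N i x else 0)"
    using A i by simp
  have "(\<Sum>c\<in>A. \<Sum>j\<in>{1..<m}. N j c * lookup (sub_cell j c) (0, i))
      = (\<Sum>c\<in>A. \<Sum>j\<in>{1..<m}. if j = i then N i c else 0)"
    by (intro sum.cong refl) (auto simp: lookup_sub_cell)
  then show "(\<Sum>c\<in>A. \<Sum>j\<in>{1..<m}. N j c * lookup (sub_cell j c) (0, i)) = (\<Sum>c\<in>A. N i c)"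
    using A i by simp
qed

lemma lookup_sub_cell_other:
  assumes "0 < r" "c \<notin> A \<or> m \<le> r"
  shows "(\<Sum>x\<in>A. \<Sum>j\<in>{1..<m}. N j x * lookup (sub_cell j x) (r, c)) = 0"
  using assms by (intro sum.neutral ballI) (auto simp: lookup_sub_cell)

text \<open>The term \<open>l\<close> moves every exponent of row \<open>m\<close> into the row
  whose greedy interval contains its column. If the image of another \<open>b\<close> contains
  \<open>l\<close>, the rows before \<open>m\<close> of \<open>b\<close> and \<open>b'\<close> are
  two remainders of the same supply with the same totals removed from each row, and
  \<open>greedy_extremal\<close> makes \<open>b'\<close> the heavier one.\<close>

lemma chain_free_extremal:
  fixes b' :: mon
  assumes A: "finite A" "\<And>c. c \<in> A \<Longrightarrow> 0 < c \<and> c < big" and m: "2 \<le> m"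
    and b': "keys b' \<subseteq> {1..m} \<times> UNIV" and free: "\<nexists>t u. t \<in> chains m A \<and> b' = t + u"
  shows "\<exists>l. l \<in> keys (monev generic_pt b' :: 'a::field mpoly) \<and>
    (\<forall>b. keys b \<subseteq> {1..m} \<times> UNIV \<longrightarrow> l \<in> keys (monev generic_pt b :: 'a mpoly) \<longrightarrow> b \<noteq> b' \<longrightarrow>
      (\<exists>t\<in>{1..<m}. (\<forall>j\<in>{1..<t}. weight A big (\<lambda>i c. lookup b (i, c)) j = weight A big (\<lambda>i c. lookup b' (i, c)) j)
        \<and> weight A big (\<lambda>i c. lookup b (i, c)) t < weight A big (\<lambda>i c. lookup b' (i, c)) t))"
proof -
  let ?b' = "\<lambda>i c. lookup b' (i, c)"
  let ?g = "greedy A big ?b'"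
  \<comment> \<open>The row whose interval between consecutive greedy columns contains
    \<open>c\<close>. The value 1 is a dummy for columns not occupied in row
    \<open>m\<close>.\<close>
  define t where "t c = (if lookup b' (m, c) > 0 then LEAST i. 1 \<le> i \<and> c \<le> ?g i else 1)" for c
  have t: "t c \<in> {1..<m} \<and> (lookup b' (m, c) > 0 \<longrightarrow> ?g (t c - 1) < c \<and> c \<le> ?g (t c))" if c: "c \<in> A" for c
  proof (cases "lookup b' (m, c) > 0")
    case True
    have "c \<le> ?g (m - 1)"
      using greedy_chain[OF A _ c True] free m by (metis linorder_not_le one_le_numeral order_trans)
    then have ex: "1 \<le> m - 1 \<and> c \<le> ?g (m - 1)" using m by simp
    let ?Q = "\<lambda>i. 1 \<le> i \<and> c \<le> ?g i"
    have tc: "t c = (LEAST i. ?Q i)" using True by (simp add: t_def)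
    have 1: "?Q (t c)" unfolding tc by (rule LeastI[of ?Q, OF ex])
    have "t c \<le> m - 1" unfolding tc by (rule Least_le[of ?Q, OF ex])
    moreover have "?g (t c - 1) < c"
    proof (cases "t c - 1 = 0")
      case True
      then show ?thesis using A(2)[OF c] by simp
    next
      case False
      then have "\<not> ?Q (t c - 1)" unfolding tc by (intro not_less_Least) auto
      then show ?thesis using False by auto
    qed
    ultimately show ?thesis using 1 m by auto
  qed (use m in \<open>auto simp: t_def\<close>)
  \<comment> \<open>Counts the chosen cells \<open>(t c, c)\<close>. In the sum substituted for
    \<open>(m, c)\<close> exactly one summand has weight 1 and the others have weight 0, so
    \<open>l\<close> survives over every field.\<close>
  define w where "w k = (\<Sum>c\<in>A. lookup k (t c, c))" for k :: mon
  have w_add: "w (s + s') = w s + w s'" for s s' by (simp add: w_def lookup_add sum.distrib)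
  have w_cell: "w (sub_cell i c) = (if i = t c then 1 else 0)" if "i \<in> {1..<m}" "c \<in> A" for i c
  proof -
    have "w (sub_cell i c) = (\<Sum>x\<in>A. if x = c then (if i = t c then 1 else 0) else 0)"
      unfolding w_def using t that(1) by (intro sum.cong refl) (force simp: lookup_sub_cell)
    then show ?thesis using A(1) that(2) by simp
  qed
  define l where "l = off_row b' + (\<Sum>c\<in>A. \<Sum>j<lookup b' (m, c). sub_cell (t c) c)"
  have "top_at w (monev generic_pt b' :: 'a mpoly) l"
    unfolding monev_generic_pt[OF A(1)] l_def
  proof (intro top_at_mult top_at_prod top_at_power w_add)
    show "top_at w (single (off_row b') (1 :: 'a)) (off_row b')" by (rule top_at_single) simp
    fix c assume c: "c \<in> A"
    show "top_at w (\<Sum>i\<in>{1..<m}. single (sub_cell i c) (1 :: 'a)) (sub_cell (t c) c)"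
      by (rule top_at_sum[where x = "t c"]) (use t[OF c] c in \<open>auto simp: w_cell top_at_single\<close>)
  qed
  then have l: "l \<in> keys (monev generic_pt b' :: 'a mpoly)" by (simp add: top_at_def)
  define N' where "N' i c = (if i = t c then lookup b' (m, c) else 0)" for i c
  have lN': "lookup l v = lookup (off_row b') v + (\<Sum>c\<in>A. \<Sum>i\<in>{1..<m}. N' i c * lookup (sub_cell i c) v)" for v
  proof -
    have "(\<Sum>i\<in>{1..<m}. N' i c * lookup (sub_cell i c) v) = lookup b' (m, c) * lookup (sub_cell (t c) c) v"
      if "c \<in> A" for c
    proof -
      have "(\<Sum>i\<in>{1..<m}. N' i c * lookup (sub_cell i c) v)
          = (\<Sum>i\<in>{1..<m}. if i = t c then lookup b' (m, c) * lookup (sub_cell (t c) c) v else 0)"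
        by (intro sum.cong) (auto simp: N'_def)
      then show ?thesis using t[OF that] by simp
    qed
    then show ?thesis unfolding l_def by (simp add: lookup_add lookup_sum)
  qed
  have row0: "lookup b (0, i) = 0" if "keys b \<subseteq> {1..m} \<times> UNIV" for b :: mon and i
    using that by (auto simp: in_keys_iff subset_iff)
  have "\<exists>t\<in>{1..<m}. (\<forall>j\<in>{1..<t}. weight A big (\<lambda>i c. lookup b (i, c)) j = weight A big ?b' j)
        \<and> weight A big (\<lambda>i c. lookup b (i, c)) t < weight A big ?b' t"
    if b: "keys b \<subseteq> {1..m} \<times> UNIV" and lb: "l \<in> keys (monev generic_pt b :: 'a mpoly)" and ne: "b \<noteq> b'" for b
  proof -
    obtain k where k: "l = off_row b + k" "k \<in> keys (\<Prod>c\<in>A. (\<Sum>i\<in>{1..<m}. single (sub_cell i c) (1 :: 'a)) ^ lookup b (m, c))"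
      using lb unfolding monev_generic_pt[OF A(1)] by (auto elim!: keys_times_E)
    obtain N where N: "\<And>c. c \<in> A \<Longrightarrow> (\<Sum>i\<in>{1..<m}. N i c) = lookup b (m, c)"
      "\<And>v. lookup k v = (\<Sum>c\<in>A. \<Sum>i\<in>{1..<m}. N i c * lookup (sub_cell i c) v)"
      using keys_prod_power_sum_single[OF _ A(1) k(2)] by auto
    have E: "lookup (off_row b) v + (\<Sum>c\<in>A. \<Sum>i\<in>{1..<m}. N i c * lookup (sub_cell i c) v)
        = lookup (off_row b') v + (\<Sum>c\<in>A. \<Sum>i\<in>{1..<m}. N' i c * lookup (sub_cell i c) v)" for v
      using lN'[of v] N(2)[of v] unfolding k(1) by (simp add: lookup_add)
    have S: "(\<Sum>c\<in>A. \<Sum>j\<in>{1..<m}. M j c * lookup (sub_cell j c) (i, x)) = (if x \<in> A then M i x else 0)"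
      "(\<Sum>c\<in>A. \<Sum>j\<in>{1..<m}. M j c * lookup (sub_cell j c) (0, i)) = sum (M i) A"
      if "i \<in> {1..<m}" for M i x
      by (rule lookup_sub_cell_sums(1)[OF A(1) that]) (rule lookup_sub_cell_sums(2)[OF A(1) that])
    have eq: "lookup b (i, c) + N i c = lookup b' (i, c) + N' i c" if "i \<in> {1..<m}" "c \<in> A" for i c
      using E[of "(i, c)"] that(2) that(1) unfolding S(1)[OF that(1)] by (simp add: lookup_off_row A(1))
    have sum: "sum (N i) A = sum (N' i) A" if "i \<in> {1..<m}" for i
      using E[of "(0, i)"] row0[OF b] row0[OF b'] m
      unfolding S(2)[OF that] by (simp add: lookup_off_row A(1))
    have other: "lookup b (r, c) = lookup b' (r, c)" if "c \<notin> A \<or> m < r" for r c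
    proof (cases "r = 0")
      case True then show ?thesis using row0[OF b] row0[OF b'] by simp
    next
      case False
      then have z: "(\<Sum>x\<in>A. \<Sum>j\<in>{1..<m}. M j x * lookup (sub_cell j x) (r, c)) = 0" for M
        using that by (intro lookup_sub_cell_other) auto
      show ?thesis using E[of "(r, c)"] that unfolding z by (auto simp: lookup_off_row A(1) split: if_splits)
    qed
    \<comment> \<open>If rows \<open>1\<close> to \<open>m - 1\<close> agreed on \<open>A\<close>,
      the distributions \<open>N\<close> and \<open>N'\<close> would agree, and their column sums
      would force row \<open>m\<close> to agree as well.\<close>
    have "\<exists>i\<in>{1..<m}. \<exists>c\<in>A. lookup b (i, c) \<noteq> lookup b' (i, c)"
    proof (rule ccontr)
      assume "\<not> ?thesis"
      then have same: "lookup b (i, c) = lookup b' (i, c)" if "i \<in> {1..<m}" "c \<in> A" for i c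
        using that by blast
      then have "N i c = N' i c" if "i \<in> {1..<m}" "c \<in> A" for i c using eq[OF that] that by simp
      then have "lookup b (m, c) = lookup b' (m, c)" if "c \<in> A" for c
      proof -
        have "lookup b (m, c) = (\<Sum>i\<in>{1..<m}. N' i c)"
          unfolding N(1)[OF that, symmetric] using that \<open>\<And>i c. _ \<Longrightarrow> _ \<Longrightarrow> N i c = N' i c\<close> by (intro sum.cong) auto
        also have "\<dots> = lookup b' (m, c)" using t[OF that] by (simp add: N'_def)
        finally show ?thesis .
      qed
      then have "lookup b (r, c) = lookup b' (r, c)" for r c
        using same[of r c] other[of c r] row0[OF b] row0[OF b']
        by (cases "r = 0"; cases "c \<in> A"; cases r m rule: linorder_cases) auto
      then show False using ne by (auto intro: poly_mapping_eqI)
    qed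
    then obtain i c where ic: "i \<in> {1..<m}" "c \<in> A" "lookup b (i, c) \<noteq> lookup b' (i, c)" by blast
    show ?thesis
    proof (rule greedy_extremal[where b = "\<lambda>i c. lookup b (i, c)" and b' = ?b' and N = N and N' = N' and i = i and c = c])
      fix i c assume "i \<in> {1..<m}" "c \<in> A" "N' i c > 0"
      then show "?g (i - 1) < c \<and> c \<le> ?g i" using t[of c] by (auto simp: N'_def split: if_splits)
    qed (use A eq sum ic in auto)
  qed
  with l show ?thesis by blast
qed

lemma lookup_const_mult: "lookup (single 0 c * p) k = c * lookup (p :: 'a::idom mpoly) k"
proof (cases "c = 0")
  case False
  have ks: "keys (single (0 :: mon) c) = {0}" using False by simp
  have "lookup (single 0 c * p) k = (\<Sum>t\<in>keys p. if t = k then c * lookup p k else 0)"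
    unfolding lookup_times ks by (simp cong: if_cong)
  then show ?thesis by (auto simp: in_keys_iff)
qed simp

text \<open>Choose a monomial of \<open>f\<close> with lexicographically least weight vector. Its
  extremal term occurs in the image of no other monomial of \<open>f\<close>, so nothing can cancel
  it.\<close>

lemma chain_free_independent:
  fixes f :: "'a::field mpoly"
  assumes A: "finite A" "\<And>c. c \<in> A \<Longrightarrow> 0 < c" and m: "2 \<le> m"
    and f: "f \<in> polys_in ({1..m} \<times> C)" and free: "\<forall>s\<in>keys f. \<nexists>t u. t \<in> chains m A \<and> s = t + u"
    and zero: "subst generic_pt f = 0"
  shows "f = 0"
proof (rule ccontr)
  assume "f \<noteq> 0"
  then have ne: "keys f \<noteq> {}" by simp
  obtain big where big: "\<And>c. c \<in> A \<Longrightarrow> c < big"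
    using finite_nat_set_iff_bounded A(1) by auto
  then have A': "\<And>c. c \<in> A \<Longrightarrow> 0 < c \<and> c < big" using A(2) by blast
  let ?w = "\<lambda>b :: mon. weight A big (\<lambda>i c. lookup b (i, c))"
  let ?L = "\<lambda>b :: mon. map (?w b) [1..<m]"
  have wf: "wf (inv_image (lex less_than) ?L)" by (intro wf_inv_image wf_lex wf_less_than)
  obtain x where "x \<in> keys f" using ne by blast
  from wfE_min[OF wf this] obtain b' where b': "b' \<in> keys f"
    "\<And>b. (?L b, ?L b') \<in> lex less_than \<Longrightarrow> b \<notin> keys f"
    by (auto simp: in_inv_image)
  have box: "keys b \<subseteq> {1..m} \<times> UNIV" if "b \<in> keys f" for b
    using f that by (auto simp: polys_in_def)
  obtain l where l: "l \<in> keys (monev generic_pt b' :: 'a mpoly)"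
    "\<And>b. keys b \<subseteq> {1..m} \<times> UNIV \<Longrightarrow> l \<in> keys (monev generic_pt b :: 'a mpoly) \<Longrightarrow> b \<noteq> b' \<Longrightarrow>
      \<exists>t\<in>{1..<m}. (\<forall>j\<in>{1..<t}. ?w b j = ?w b' j) \<and> ?w b t < ?w b' t"
    using chain_free_extremal[OF A(1) A' m box[OF b'(1)], where 'a = 'a] free b'(1) by auto
  have only: "lookup (monev generic_pt b :: 'a mpoly) l = 0" if "b \<in> keys f" "b \<noteq> b'" for b
  proof (rule ccontr)
    assume "lookup (monev generic_pt b :: 'a mpoly) l \<noteq> 0"
    then have "l \<in> keys (monev generic_pt b :: 'a mpoly)" by (simp add: in_keys_iff)
    from l(2)[OF box[OF that(1)] this that(2)]
    obtain t where t: "t \<in> {1..<m}" "\<And>j. j \<in> {1..<t} \<Longrightarrow> ?w b j = ?w b' j" "?w b t < ?w b' t" by blast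
    have sp: "[1..<m] = [1..<t] @ t # [Suc t..<m]"
      using t(1) upt_add_eq_append[of 1 t "m - t"] upt_conv_Cons[of t m] by simp
    have eq: "map (?w b) [1..<t] = map (?w b') [1..<t]" using t(2) by simp
    have "(?L b, ?L b') \<in> lex less_than"
      unfolding sp lex_conv using t(3) eq by (simp, intro exI[of _ "map (?w b') [1..<t]"], simp)
    with b'(2) that(1) show False by blast
  qed
  have "lookup (subst generic_pt f) l = (\<Sum>b\<in>keys f. lookup f b * lookup (monev generic_pt b) l)"
    by (simp add: subst_def lookup_sum lookup_const_mult)
  also have "\<dots> = (\<Sum>b\<in>keys f. if b = b' then lookup f b' * lookup (monev generic_pt b') l else 0)"
    using only by (intro sum.cong) auto
  also have "\<dots> = lookup f b' * lookup (monev generic_pt b') l" using b'(1) by simp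
  finally show False using zero b'(1) l(1) by (simp add: in_keys_iff)
qed

end

text \<open>The generators vanish at the generic point, hence so does the ideal, and a chain-free
  member must be 0 by independence.\<close>

lemma groebner_maximal_minors:
  assumes A: "A \<subseteq> {1..n}" and m: "2 \<le> m"
  defines "B \<equiv> {1..m} \<times> {1..n}"
  shows "groebner B (ideal_gen (polys_in B) (minor m ` {F. F \<subseteq> A \<and> card F = m}) :: 'a::field mpoly set)
    (chains m A)"
proof -
  define G :: "'a mpoly set" where "G = minor m ` {F. F \<subseteq> A \<and> card F = m}"
  define I where "I = ideal_gen (polys_in B) G"
  have fin: "finite A" using A by (rule finite_subset) simp
  have finF: "finite F" if "F \<subseteq> A" for F using that fin by (rule finite_subset)
  have GB: "G \<subseteq> polys_in B"
  proof
    fix g assume "g \<in> G"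
    then obtain F where F: "g = minor m F" "F \<subseteq> A" "card F = m" unfolding G_def by blast
    show "g \<in> polys_in B" unfolding F(1) B_def
      by (rule minor_polys_in[OF finF[OF F(2)] F(3)]) (use F(2) A in blast)
  qed
  have finB: "finite B" by (simp add: B_def)
  have idI: "ideal_in (polys_in B) I" unfolding I_def by (rule ideal_in_gen[OF GB])
  have chain: "\<exists>g\<in>I. g \<noteq> 0 \<and> LM g = t" if t: "t \<in> chains m A" for t
  proof -
    obtain F where F: "F \<subseteq> A" "card F = m" "t = cells {1..m} (enum F)"
      using t unfolding chains_def by blast
    have "minor m F \<in> G" unfolding G_def using F(1,2) by blast
    then have gI: "minor m F \<in> I" unfolding I_def by (rule subsetD[OF ideal_gen_superset])
    show ?thesis
      by (rule bexI[OF _ gI]) (use LM_minor[OF finF[OF F(1)] F(2), where 'a = 'a] F(3) in simp)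
  qed
  have kill: "subst (generic_pt m A) g = 0" if "g \<in> G" for g
  proof -
    obtain F where F: "g = minor m F" "F \<subseteq> A" "card F = m" using \<open>g \<in> G\<close> unfolding G_def by blast
    show ?thesis unfolding F(1)
      by (rule generic_pt_kills_minor[OF F(2) finF[OF F(2)] F(3)]) (use m in simp)
  qed
  have indep: "f = 0" if f: "f \<in> I" and free: "\<forall>s\<in>keys f. \<nexists>t u. t \<in> chains m A \<and> s = t + u" for f
  proof -
    obtain T c where T: "f = (\<Sum>g\<in>T. c g * g)" "T \<subseteq> G" using f unfolding I_def ideal_gen_def by blast
    have "subst (generic_pt m A) (c g * g) = 0" if "g \<in> T" for g
      using kill[of g] that T(2) by (simp add: subst_mult subset_iff)
    then have zero: "subst (generic_pt m A) f = 0"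
      unfolding T(1) subst_sum by (intro sum.neutral ballI)
    have fB: "f \<in> polys_in ({1..m} \<times> {1..n})" using ideal_inD(1)[OF idI f] by (simp add: B_def)
    have A0: "0 < c" if "c \<in> A" for c using that A by auto
    show ?thesis by (rule chain_free_independent[OF fin A0 m fB free zero])
  qed
  have "groebner B I (chains m A)"
    by (rule groebner_if_independent[OF finB idI chain indep])
  then show ?thesis unfolding I_def G_def .
qed

section \<open>Primality when a clique is attached\<close>

definition facets :: "nat \<Rightarrow> nat set set \<Rightarrow> nat set set" where
  "facets m \<C> = {F. card F = m \<and> (\<exists>A\<in>\<C>. F \<subseteq> A)}"

definition minors_ideal :: "nat \<Rightarrow> nat \<Rightarrow> nat set set \<Rightarrow> 'a::comm_ring_1 mpoly set" where
  "minors_ideal n m \<C> = ideal_gen (polys_in ({1..m} \<times> {1..n})) (minor m ` facets m \<C>)"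

lemma minor_facets_polys_in:
  assumes "\<And>A. A \<in> \<C> \<Longrightarrow> A \<subseteq> {1..n}"
  shows "minor m ` facets m \<C> \<subseteq> polys_in ({1..m} \<times> {1..n})"
proof
  fix g assume "g \<in> minor m ` facets m \<C>"
  then obtain F A where F: "g = minor m F" "card F = m" "A \<in> \<C>" "F \<subseteq> A" by (auto simp: facets_def)
  then have "F \<subseteq> {1..n}" using assms by blast
  moreover from this have "finite F" by (rule finite_subset) simp
  ultimately show "g \<in> polys_in ({1..m} \<times> {1..n})" unfolding F(1) using F(2) by (intro minor_polys_in)
qed

lemma ideal_in_minors_ideal:
  assumes "\<And>A. A \<in> \<C> \<Longrightarrow> A \<subseteq> {1..n}"
  shows "ideal_in (polys_in ({1..m} \<times> {1..n})) (minors_ideal n m \<C>)"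
  unfolding minors_ideal_def using minor_facets_polys_in[OF assms] by (rule ideal_in_gen)

lemma minor_in_minors_ideal:
  assumes "F \<subseteq> A" "A \<in> \<C>" "card F = m" shows "minor m F \<in> minors_ideal n m \<C>"
  unfolding minors_ideal_def using assms
  by (intro subsetD[OF ideal_gen_superset] imageI) (auto simp: facets_def)

lemma groebner_family:
  assumes "finite \<C>" "\<And>A. A \<in> \<C> \<Longrightarrow> A \<subseteq> {1..n}" and m: "2 \<le> m"
    and "\<And>A A' s t. A \<in> \<C> \<Longrightarrow> A' \<in> \<C> \<Longrightarrow> A \<noteq> A' \<Longrightarrow> s \<in> chains m A \<Longrightarrow> t \<in> chains m A'
      \<Longrightarrow> keys s \<inter> keys t = {}"
  shows "groebner ({1..m} \<times> {1..n}) (minors_ideal n m \<C> :: 'a::field mpoly set) (\<Union>A\<in>\<C>. chains m A)"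
  using assms(1,2,4)
proof (induction \<C>)
  case empty
  have "(minors_ideal n m {} :: 'a mpoly set) = {0}"
    by (auto simp: minors_ideal_def facets_def ideal_gen_def)
  then show ?case by (simp add: groebner_def ideal_in_def)
next
  case (insert A \<C>)
  let ?B = "{1..m} \<times> {1..n}"
  have fin: "finite ?B" by simp
  have A: "groebner ?B (ideal_gen (polys_in ?B) (minor m ` {F. F \<subseteq> A \<and> card F = m}) :: 'a mpoly set) (chains m A)"
    by (rule groebner_maximal_minors[OF _ m]) (use insert.prems in blast)
  have IH: "groebner ?B (minors_ideal n m \<C> :: 'a mpoly set) (\<Union>A\<in>\<C>. chains m A)"
  proof (rule insert.IH)
    show "A \<subseteq> {1..n}" if "A \<in> \<C>" for A using insert.prems(1) that by blast
    show "keys s \<inter> keys t = {}" if "A \<in> \<C>" "A' \<in> \<C>" "A \<noteq> A'" "s \<in> chains m A" "t \<in> chains m A'"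
      for A A' s t
      by (rule insert.prems(2)[OF _ _ that(3-5)]) (use that in simp_all)
  qed
  have co: "keys s \<inter> keys t = {}" if s: "s \<in> chains m A" and t: "t \<in> (\<Union>A\<in>\<C>. chains m A)" for s t
  proof -
    obtain A' where A': "A' \<in> \<C>" "t \<in> chains m A'" using t by blast
    then have "A \<noteq> A'" using insert.hyps(2) by blast
    then show ?thesis using insert.prems(2)[OF _ _ _ s A'(2)] A'(1) by blast
  qed
  have G: "(minor m ` {F. F \<subseteq> A \<and> card F = m} :: 'a mpoly set) \<subseteq> polys_in ?B"
    using minor_facets_polys_in[of "{A}" n m] insert.prems(1) by (auto simp: facets_def)
  have H: "(minor m ` facets m \<C> :: 'a mpoly set) \<subseteq> polys_in ?B"
    by (rule minor_facets_polys_in) (use insert.prems(1) in blast)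
  have "(minor m ` {F. F \<subseteq> A \<and> card F = m} \<union> minor m ` facets m \<C> :: 'a mpoly set)
      = minor m ` facets m (insert A \<C>)"
    by (auto simp: facets_def)
  then have "(minors_ideal n m (insert A \<C>) :: 'a mpoly set)
      = {a + b |a b. a \<in> ideal_gen (polys_in ?B) (minor m ` {F. F \<subseteq> A \<and> card F = m}) \<and> b \<in> minors_ideal n m \<C>}"
    using ideal_gen_Un[OF G H] by (simp add: minors_ideal_def)
  then show ?case unfolding UN_insert by (simp only:) (rule groebner_plus[OF fin A IH co])
qed

section \<open>The grading by degree in row 1\<close>

definition row1_deg :: "mon \<Rightarrow> nat" where
  "row1_deg t = (\<Sum>v\<in>keys t. if fst v = 1 then lookup t v else 0)"

lemma row1_deg_superset:
  assumes "finite V" "keys t \<subseteq> V"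
  shows "row1_deg t = (\<Sum>v\<in>V. if fst v = 1 then lookup t v else 0)"
  unfolding row1_deg_def by (rule sum.mono_neutral_left) (use assms in \<open>auto simp: in_keys_iff\<close>)

lemma row1_deg_add: "row1_deg (s + t) = row1_deg s + row1_deg t"
proof -
  let ?V = "keys s \<union> keys t"
  have "row1_deg (s + t) = (\<Sum>v\<in>?V. if fst v = 1 then lookup (s + t) v else 0)"
    by (rule row1_deg_superset) (auto simp: keys_add_mon)
  also have "\<dots> = (\<Sum>v\<in>?V. if fst v = 1 then lookup s v else 0) + (\<Sum>v\<in>?V. if fst v = 1 then lookup t v else 0)"
    unfolding sum.distrib[symmetric] by (intro sum.cong) (auto simp: lookup_add)
  also have "\<dots> = row1_deg s + row1_deg t"
    using row1_deg_superset[of ?V s] row1_deg_superset[of ?V t] by simp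
  finally show ?thesis .
qed

definition row1_part :: "nat \<Rightarrow> 'a::comm_ring_1 mpoly \<Rightarrow> 'a mpoly" where
  "row1_part k p = (\<Sum>t\<in>{t \<in> keys p. row1_deg t = k}. single t (lookup p t))"

lemma lookup_row1_part: "lookup (row1_part k p) t = (if row1_deg t = k then lookup p t else 0)"
  unfolding row1_part_def by (subst lookup_sum_when) (auto simp: when_def in_keys_iff)

lemma row1_part_add: "row1_part k (p + q) = row1_part k p + row1_part k q"
  by (rule poly_mapping_eqI) (simp add: lookup_row1_part lookup_add)

lemma row1_part_0: "row1_part k 0 = 0"
  by (rule poly_mapping_eqI) (simp add: lookup_row1_part)

lemma row1_part_sum: "row1_part k (sum f A) = (\<Sum>a\<in>A. row1_part k (f a))"
  by (induction A rule: infinite_finite_induct) (auto simp: row1_part_add row1_part_0)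

lemma sum_row1_part: "\<exists>K. p = (\<Sum>k\<le>K. row1_part k p)"
proof
  let ?K = "Max (row1_deg ` keys p)"
  show "p = (\<Sum>k\<le>?K. row1_part k p)"
  proof (rule poly_mapping_eqI)
    fix t
    have "row1_deg t \<le> ?K" if "t \<in> keys p" using that by simp
    then show "lookup p t = lookup (\<Sum>k\<le>?K. row1_part k p) t"
      by (cases "t \<in> keys p") (auto simp: lookup_sum lookup_row1_part in_keys_iff)
  qed
qed

lemma row1_part_homogeneous:
  assumes "\<And>t. t \<in> keys p \<Longrightarrow> row1_deg t = d"
  shows "row1_part k p = (if k = d then p else 0)"
  using assms by (intro poly_mapping_eqI) (auto simp: lookup_row1_part in_keys_iff)

lemma row1_part_times_homogeneous:
  assumes "\<And>t. t \<in> keys g \<Longrightarrow> row1_deg t = d"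
  shows "row1_part k (c * g) = (if d \<le> k then row1_part (k - d) c * g else 0)"
proof (induction c rule: poly_single_induct)
  case (single t a)
  have "row1_deg u = row1_deg t + d" if u: "u \<in> keys (single t a * g)" for u
  proof -
    obtain s v where "s \<in> keys (single t a)" "v \<in> keys g" "u = s + v" using u by (rule keys_times_E)
    then show ?thesis using assms by (simp add: row1_deg_add split: if_splits)
  qed
  then have "row1_part k (single t a * g) = (if k = row1_deg t + d then single t a * g else 0)"
    by (rule row1_part_homogeneous)
  moreover have "row1_part (k - d) (single t a) = (if k - d = row1_deg t then single t a else 0)"
    by (rule row1_part_homogeneous) (simp split: if_splits)
  ultimately show ?case by (cases "d \<le> k") auto
qed (simp add: algebra_simps row1_part_add)

lemma row1_part_polys_in: "p \<in> polys_in B \<Longrightarrow> row1_part k p \<in> polys_in B"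
  unfolding polys_in_def by (auto simp: in_keys_iff lookup_row1_part split: if_splits)

lemma row1_deg_cells: "finite I \<Longrightarrow> row1_deg (cells I g) = (if 1 \<in> I then 1 else 0)"
proof -
  assume fin: "finite I"
  have "row1_deg (cells I g) = (\<Sum>v\<in>(\<lambda>i. (i, g i)) ` I. if fst v = 1 then lookup (cells I g) v else 0)"
    using fin by (intro row1_deg_superset) (auto simp: keys_cells)
  also have "\<dots> = (\<Sum>i\<in>I. if i = 1 then 1 else 0)"
    using fin by (subst sum.reindex) (auto simp: inj_on_def lookup_cells intro!: sum.cong)
  finally show ?thesis using fin by simp
qed

lemma row1_deg_minor:
  assumes "t \<in> keys (minor m F :: 'a::comm_ring_1 mpoly)" "1 \<le> m"
  shows "row1_deg t = 1"
proof -
  have "t \<in> (\<Union>\<pi>\<in>{\<pi>. \<pi> permutes {1..m}}. keys (single (cells {1..m} (\<lambda>i. enum F (\<pi> i))) (of_int (sign \<pi>)) :: 'a mpoly))"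
  proof (rule ccontr)
    assume "\<not> ?thesis"
    then have "lookup (minor m F :: 'a mpoly) t = 0"
      unfolding minor_gdet gdet_def of_int_prod_Xvar lookup_sum
      by (intro sum.neutral) (auto simp: lookup_single when_def split: if_splits)
    with assms(1) show False by (simp add: in_keys_iff)
  qed
  then show ?thesis using assms(2) by (auto simp: row1_deg_cells split: if_splits)
qed

text \<open>Every minor is homogeneous of degree 1 in row 1, so the ideal contains the homogeneous
  parts of its members. This will separate the different powers of \<open>h\<close>.\<close>

lemma row1_part_minors_ideal:
  assumes \<C>: "\<And>A. A \<in> \<C> \<Longrightarrow> A \<subseteq> {1..n}" and m: "1 \<le> m" and f: "(f :: 'a::comm_ring_1 mpoly) \<in> minors_ideal n m \<C>"
  shows "row1_part k f \<in> minors_ideal n m \<C>"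
proof -
  let ?B = "{1..m} \<times> {1..n}"
  have I: "ideal_in (polys_in ?B) (minors_ideal n m \<C> :: 'a mpoly set)"
    by (rule ideal_in_minors_ideal[OF \<C>])
  obtain T c where T: "f = (\<Sum>g\<in>T. c g * g)" "T \<subseteq> minor m ` facets m \<C>" "\<And>g. g \<in> T \<Longrightarrow> c g \<in> polys_in ?B"
    using f unfolding minors_ideal_def ideal_gen_def by blast
  show ?thesis unfolding T(1) row1_part_sum
  proof (rule ideal_in_sum[OF I])
    fix g assume g: "g \<in> T"
    then have gJ: "g \<in> minors_ideal n m \<C>"
      unfolding minors_ideal_def using T(2) ideal_gen_superset by blast
    have "row1_deg t = 1" if "t \<in> keys g" for t using row1_deg_minor m that g T(2) by blast
    then have "row1_part k (c g * g) = (if 1 \<le> k then row1_part (k - 1) (c g) * g else 0)"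
      by (rule row1_part_times_homogeneous)
    then show "row1_part k (c g * g) \<in> minors_ideal n m \<C>"
      using ideal_inD(2)[OF I] ideal_inD(4)[OF I row1_part_polys_in[OF T(3)[OF g]] gJ] by simp
  qed
qed

text \<open>Since \<open>h\<close> does not involve row 1, its powers leave the grading alone, and
  the part of degree \<open>k\<close> acquires exactly the factor \<open>h ^ k\<close>.\<close>

lemma subst_scale_row1:
  assumes h: "\<And>t. t \<in> keys h \<Longrightarrow> row1_deg t = 0"
  shows "row1_part k (subst (\<lambda>(i, j). if i = 1 then h * Xvar i j else Xvar i j) p) = h ^ k * row1_part k p"
proof (induction p rule: poly_single_induct)
  case (single t c)
  have pw: "(\<Prod>v\<in>V. h ^ (if fst v = 1 then e v else 0)) = h ^ (\<Sum>v\<in>V. if fst v = 1 then e v else 0)"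
    for V :: "(nat \<times> nat) set" and e by (simp add: power_sum)
  have "monev (\<lambda>(i, j). if i = 1 then h * Xvar i j else Xvar i j) t
      = (\<Prod>v\<in>keys t. h ^ (if fst v = 1 then lookup t v else 0) * (case v of (i, j) \<Rightarrow> Xvar i j) ^ lookup t v)"
    unfolding monev_def by (intro prod.cong) (auto simp: power_mult_distrib)
  also have "\<dots> = h ^ row1_deg t * single t 1"
    unfolding prod.distrib pw monev_Xvar[symmetric] monev_def row1_deg_def ..
  finally have s: "subst (\<lambda>(i, j). if i = 1 then h * Xvar i j else Xvar i j) (single t c) = h ^ row1_deg t * single t c"
    unfolding subst_single by (simp add: mult_single mult.left_commute[of "single 0 c"])
  have hk: "row1_deg u = 0" if "u \<in> keys (h ^ j)" for u j
    using that
  proof (induction j arbitrary: u)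
    case 0
    then show ?case by (simp add: row1_deg_def split: if_splits)
  next
    case (Suc j)
    then show ?case using h by (auto elim!: keys_times_E simp: row1_deg_add)
  qed
  have "row1_deg u = row1_deg t" if "u \<in> keys (h ^ row1_deg t * single t c)" for u
    using that hk by (auto elim!: keys_times_E simp: row1_deg_add split: if_splits)
  then have "row1_part k (h ^ row1_deg t * single t c) = (if k = row1_deg t then h ^ row1_deg t * single t c else 0)"
    by (rule row1_part_homogeneous)
  moreover have "row1_part k (single t c) = (if k = row1_deg t then single t c else 0)"
    by (rule row1_part_homogeneous) (simp split: if_splits)
  ultimately show ?case unfolding s by simp
qed (simp add: subst_add row1_part_add algebra_simps)

lemma subst_congruent:
  fixes p :: "'a::comm_ring_1 mpoly"
  assumes J: "ideal_in (polys_in B) J" and p: "p \<in> polys_in B"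
    and f: "\<And>v. v \<in> B \<Longrightarrow> f v \<in> polys_in B" and g: "\<And>v. v \<in> B \<Longrightarrow> g v \<in> polys_in B"
    and fg: "\<And>v. v \<in> B \<Longrightarrow> f v - g v \<in> J"
  shows "subst f p - subst g p \<in> J"
proof -
  have mult: "a * b - a' * b' \<in> J" if "a - a' \<in> J" "b - b' \<in> J" "a \<in> polys_in B" "b' \<in> polys_in B" for a a' b b'
  proof -
    have "a * (b - b') + b' * (a - a') \<in> J"
      using that by (intro ideal_inD(3)[OF J] ideal_inD(4)[OF J])
    then show ?thesis by (simp add: algebra_simps)
  qed
  have pow: "f v ^ k - g v ^ k \<in> J" if "v \<in> B" for v k
  proof (induction k)
    case (Suc k)
    have "f v * f v ^ k - g v * g v ^ k \<in> J"
      by (rule mult[OF fg[OF that] Suc f[OF that] polys_in_power[OF g[OF that]]])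
    then show ?case by simp
  qed (simp add: ideal_inD(2)[OF J])
  have "(\<Prod>v\<in>V. f v ^ e v) - (\<Prod>v\<in>V. g v ^ e v) \<in> J" if "finite V" "V \<subseteq> B" for V e
    using that
  proof (induction V)
    case (insert x V)
    have "f x ^ e x * (\<Prod>v\<in>V. f v ^ e v) - g x ^ e x * (\<Prod>v\<in>V. g v ^ e v) \<in> J"
    proof (rule mult)
      show "f x ^ e x - g x ^ e x \<in> J" using pow insert.prems by blast
      show "(\<Prod>v\<in>V. f v ^ e v) - (\<Prod>v\<in>V. g v ^ e v) \<in> J" using insert by blast
      show "f x ^ e x \<in> polys_in B" using f insert.prems by (intro polys_in_power) auto
      show "(\<Prod>v\<in>V. g v ^ e v) \<in> polys_in B" using g insert.prems by (intro polys_in_prod polys_in_power) auto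
    qed
    then show ?case using insert.hyps by simp
  qed (simp add: ideal_inD(2)[OF J])
  then have mon: "monev f t - monev g t \<in> J" if "t \<in> keys p" for t
    unfolding monev_def using p that by (auto simp: polys_in_def)
  have "subst f p - subst g p = (\<Sum>t\<in>keys p. single 0 (lookup p t) * (monev f t - monev g t))"
    by (simp add: subst_def sum_subtractf algebra_simps)
  also have "\<dots> \<in> J"
    by (rule ideal_in_sum[OF J]) (intro ideal_inD(4)[OF J] mon polys_in_single, auto)
  finally show ?thesis .
qed

text \<open>The quotient by \<open>J\<close> embeds into the quotient by the prime
  \<open>J'\<close>.\<close>

lemma prime_preimage:
  assumes P: "prime_ideal_in (polys_in B) J'" and J: "ideal_in (polys_in B) J"
    and f: "\<And>v. v \<in> B \<Longrightarrow> f v \<in> polys_in B"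
    and iff: "\<And>g. g \<in> polys_in B \<Longrightarrow> g \<in> J \<longleftrightarrow> subst f g \<in> J'"
  shows "prime_ideal_in (polys_in B) J"
proof -
  have J': "ideal_in (polys_in B) J'" "J' \<noteq> polys_in B"
    and pr: "\<And>a b. a \<in> polys_in B \<Longrightarrow> b \<in> polys_in B \<Longrightarrow> a * b \<in> J' \<Longrightarrow> a \<in> J' \<or> b \<in> J'"
    using P unfolding prime_ideal_in_iff by auto
  have fB: "subst f g \<in> polys_in B" if "g \<in> polys_in B" for g
    using that f by (rule subst_polys_in)
  have "1 \<notin> J"
  proof
    assume "1 \<in> J"
    then have "1 \<in> J'" using iff[of 1] by simp
    then have "r \<in> J'" if "r \<in> polys_in B" for r
      using ideal_inD(4)[OF J'(1) that, of 1] by simp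
    then show False using J'(2) ideal_inD(1)[OF J'(1)] by blast
  qed
  then have "J \<noteq> polys_in B" by auto
  moreover have "a \<in> J \<or> b \<in> J" if a: "a \<in> polys_in B" and b: "b \<in> polys_in B" and ab: "a * b \<in> J" for a b
  proof -
    have "subst f a * subst f b \<in> J'" using ab iff[OF polys_in_mult[OF a b]] by (simp add: subst_mult)
    then show ?thesis using pr[OF fB[OF a] fB[OF b]] iff[OF a] iff[OF b] by blast
  qed
  ultimately show ?thesis using J unfolding prime_ideal_in_iff by blast
qed

lemma prime_zero_ideal: "prime_ideal_in (polys_in B) {0 :: 'a::field mpoly}"
proof -
  have "polys_in B \<noteq> {0 :: 'a mpoly}"
  proof
    assume eq: "polys_in B = {0 :: 'a mpoly}"
    have "(1 :: 'a mpoly) \<in> polys_in B" by simp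
    then show False unfolding eq by simp
  qed
  then show ?thesis unfolding prime_ideal_in_def by auto
qed

lemma gdet_scale_row1:
  assumes "1 \<le> m" "\<And>j. j \<in> {1..m} \<Longrightarrow> Y 1 (c j) = h * X 1 (c j)"
    and "\<And>i j. i \<in> {2..m} \<Longrightarrow> j \<in> {1..m} \<Longrightarrow> Y i (c j) = X i (c j)"
  shows "gdet m Y c = h * gdet m X c"
  unfolding gdet_def sum_distrib_left
proof (intro sum.cong refl)
  fix \<pi> assume "\<pi> \<in> {\<pi>. \<pi> permutes {1..m}}"
  then have \<pi>: "\<pi> i \<in> {1..m}" if "i \<in> {1..m}" for i using that permutes_in_image[of \<pi> "{1..m}" i] by simp
  have s: "{1..m} = insert 1 {2..m}" using assms(1) by auto
  have "(\<Prod>i\<in>{2..m}. Y i (c (\<pi> i))) = (\<Prod>i\<in>{2..m}. X i (c (\<pi> i)))"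
    by (intro prod.cong refl assms(3) \<pi>) auto
  moreover have "Y 1 (c (\<pi> 1)) = h * X 1 (c (\<pi> 1))" using assms(1) by (intro assms(2) \<pi>) auto
  ultimately show "of_int (sign \<pi>) * (\<Prod>i\<in>{1..m}. Y i (c (\<pi> i)))
      = h * (of_int (sign \<pi>) * (\<Prod>i\<in>{1..m}. X i (c (\<pi> i))))"
    unfolding s by (simp add: mult_ac)
qed

text \<open>Let \<open>h\<close> be the minor on rows \<open>2, \<dots>, m\<close> and the first \<open>m - 1\<close> columns of the new clique \<open>C\<close>.
  It is a nonzerodivisor modulo \<open>J\<close> because its leading monomial avoids all chains. After inverting
  \<open>h\<close> the relations coming from \<open>C\<close> just express the entries of row 1 in the remaining columns of \<open>C\<close>
  through the other variables. Scaling row 1 by \<open>h\<close> turns this elimination into a polynomial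
  substitution, under which \<open>J\<close> is the preimage of \<open>J'\<close>.\<close>

lemma prime_attach_clique:
  fixes n m :: nat and \<C> :: "nat set set" and C :: "nat set"
  defines "B \<equiv> {1..m} \<times> {1..n}"
    and "J \<equiv> minors_ideal n m (insert C \<C>) :: 'a::field mpoly set"
    and "J' \<equiv> minors_ideal n m \<C> :: 'a mpoly set"
  assumes \<C>: "\<And>A. A \<in> insert C \<C> \<Longrightarrow> A \<subseteq> {1..n}" and m: "2 \<le> m" and C: "m \<le> card C"
    and gb: "groebner B J (\<Union>A\<in>insert C \<C>. chains m A)"
    and new: "\<And>A x. A \<in> \<C> \<Longrightarrow> x \<in> A \<Longrightarrow> x \<in> C \<Longrightarrow> x = enum C 1"
    and free: "\<And>A t. A \<in> \<C> \<Longrightarrow> t \<in> chains m A \<Longrightarrow> (2, enum C 1) \<notin> keys t"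
    and prime: "prime_ideal_in (polys_in B) J'"
  shows "prime_ideal_in (polys_in B) J"
proof -
  let ?X = "Xvar :: nat \<Rightarrow> nat \<Rightarrow> 'a mpoly"
  let ?a = "enum C" and ?W = "last_cofactor m ?X (enum C)"
  define h where "h = ?W 1"
  define L where "L = ?a ` {1..<m}"
  have fB: "finite B" by (simp add: B_def)
  have Cn: "C \<subseteq> {1..n}" using \<C> by blast
  then have fC: "finite C" by (rule finite_subset) simp
  have finA: "finite A" if "A \<in> insert C \<C>" for A using \<C>[OF that] by (rule finite_subset) simp
  have J: "ideal_in (polys_in B) J" unfolding J_def B_def by (rule ideal_in_minors_ideal[OF \<C>])
  have J': "ideal_in (polys_in B) J'" using prime by (simp add: prime_ideal_in_iff)
  have aC: "?a j \<in> C" if "j \<in> {1..m}" for j using that fC C by (intro enum_in) auto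
  have mono: "strict_mono_on {1..<m} ?a"
    using fC C by (intro strict_mono_onI enum_mono) auto
  have WB: "?W i \<in> polys_in B" if "i \<in> {1..m}" for i
  proof (rule polys_in_mono)
    show "?W i \<in> polys_in (({1..m} - {i}) \<times> C)"
      by (rule last_cofactor_polys_in) (use aC that in auto)
    show "({1..m} - {i}) \<times> C \<subseteq> B" using Cn by (auto simp: B_def)
  qed
  have hB: "h \<in> polys_in B" unfolding h_def using m by (intro WB) auto
  have h0: "h \<noteq> 0" and hLM: "LM h = cells {2..m} (\<lambda>i. ?a (i - 1))"
    unfolding h_def using LM_last_cofactor[OF mono, where 'a = 'a] m by auto
  have h_row: "row1_deg t = 0" if t: "t \<in> keys h" for t
  proof -
    have "h \<in> polys_in (({1..m} - {1}) \<times> C)"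
      unfolding h_def by (rule last_cofactor_polys_in) (use aC m in auto)
    then have "keys t \<subseteq> ({1..m} - {1}) \<times> C" using t by (auto simp: polys_in_def)
    then show ?thesis unfolding row1_deg_def by (intro sum.neutral) auto
  qed
  \<comment> \<open>For a facet inside \<open>C\<close>, its vertex in row \<open>i\<close> is at
    least the \<open>i\<close>-th vertex of \<open>C\<close>, whereas \<open>h\<close> uses the one
    before. A different clique can only share \<open>enum C 1\<close>, which \<open>h\<close> meets
    in row 2.\<close>
  have co: "keys t \<inter> keys (LM h) = {}" if t: "t \<in> (\<Union>A\<in>insert C \<C>. chains m A)" for t
  proof (rule ccontr)
    assume ne: "keys t \<inter> keys (LM h) \<noteq> {}"
    obtain A F where A: "A \<in> insert C \<C>" "t \<in> chains m A" "F \<subseteq> A" "card F = m" "t = cells {1..m} (enum F)"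
      using t by (auto simp: chains_def)
    have fF: "finite F" using A(1,3) finA finite_subset by blast
    obtain i where i: "i \<in> {2..m}" "enum F i = ?a (i - 1)" "(i, ?a (i - 1)) \<in> keys t"
      using ne unfolding A(5) hLM by (auto simp: keys_cells)
    show False
    proof (cases "A = C")
      case True
      have "i - 1 = card {x \<in> F. x < enum F i}" using card_less_enum(1)[OF fF, of i] i(1) A(4) by simp
      also have "\<dots> \<le> card {x \<in> C. x < ?a (i - 1)}"
        unfolding i(2) using A(3) True fC by (intro card_mono) auto
      also have "\<dots> = i - 1 - 1" using i(1) C by (intro card_less_enum(1)[OF fC]) auto
      finally have "i - 1 \<le> i - 1 - 1" .
      moreover have "2 \<le> i" using i(1) by simp
      ultimately show False by linarith
    next
      case False
      then have AC: "A \<in> \<C>" using A(1) by blast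
      have "enum F i \<in> A" using enum_in[OF fF, of i] i(1) A(3,4) by auto
      moreover have "i - 1 \<in> {1..m}" using i(1) by auto
      then have "?a (i - 1) \<in> C" by (rule aC)
      ultimately have "enum F i = ?a 1" unfolding i(2)[symmetric] by (intro new[OF AC])
      then have "?a (i - 1) = ?a 1" using i(2) by (simp only:)
      moreover have "i - 1 \<in> {1..<m}" "1 \<in> {1..<m}" using i(1) m by auto
      ultimately have "i - 1 = 1" by (rule inj_onD[OF strict_mono_on_imp_inj_on[OF mono]])
      then have "i = 2" using i(1) by simp
      then have "(2, ?a 1) \<in> keys t" using i(3) by simp
      then show False using free[OF AC A(2)] by blast
    qed
  qed
  have nzd: "g \<in> J" if "h * g \<in> J" "g \<in> polys_in B" for g
    by (rule groebner_nonzero_divisor[OF fB gb h0 co that(2,1) hB])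
  have nzd_power: "g \<in> J" if "h ^ k * g \<in> J" "g \<in> polys_in B" for g k
    using that(1)
  proof (induction k)
    case (Suc k)
    have "h * (h ^ k * g) \<in> J" using Suc.prems by (simp add: mult.assoc)
    moreover have "h ^ k * g \<in> polys_in B" using hB that(2) by auto
    ultimately have "h ^ k * g \<in> J" by (rule nzd)
    then show ?case by (rule Suc.IH)
  qed simp
  \<comment> \<open>Laplace expansion with an arbitrary column \<open>d\<close> in the last
    position, which the cofactors do not see.\<close>
  have Bexpand: "(\<Sum>i\<in>{1..m}. ?W i * ?X i d) = gdet m ?X (?a(m := d))" for d
  proof -
    have "last_cofactor m ?X (?a(m := d)) i = ?W i" if "i \<in> {1..m}" for i
      by (rule last_cofactor_cong) (use that in auto)
    then show ?thesis using gdet_expand_last_column[of m ?X "?a(m := d)"] m by simp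
  qed
  have split1: "(\<Sum>i\<in>{1..m}. f i) = f 1 + (\<Sum>i\<in>{2..m}. f i)" for f :: "nat \<Rightarrow> 'a mpoly"
  proof -
    have "{1..m} = insert 1 {2..m}" using m by auto
    then show ?thesis by simp
  qed
  \<comment> \<open>In the columns of \<open>C\<close> outside \<open>L\<close> the relation
    \<open>Bexpand\<close> is solved for \<open>h * X 1 j\<close>; in all other columns row 1 is
    merely scaled by \<open>h\<close>, as in \<sigma>.\<close>
  define \<psi> where "\<psi> = (\<lambda>(i, j). if i = 1 then
      (if j \<in> C - L then - (\<Sum>i\<in>{2..m}. ?W i * ?X i j) else h * ?X 1 j) else ?X i j)"
  define \<sigma> where "\<sigma> = (\<lambda>(i, j). if i = 1 then h * ?X i j else ?X i j)"
  have \<psi>B: "\<psi> v \<in> polys_in B" if "v \<in> B" for v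
    using that hB WB Cn unfolding \<psi>_def B_def
    by (auto intro!: polys_in_uminus polys_in_sum polys_in_mult polys_in_Xvar)
  have \<sigma>B: "\<sigma> v \<in> polys_in B" if "v \<in> B" for v
    using that hB unfolding \<sigma>_def B_def by (auto intro!: polys_in_mult polys_in_Xvar)
  \<comment> \<open>Row 1 becomes a combination of the other rows on all of \<open>C\<close>.
    Outside \<open>L\<close> this is the definition; on \<open>L\<close> it expands a determinant
    with a repeated column.\<close>
  have \<psi>_row: "\<psi> (1, d) = (\<Sum>i\<in>{1..m} - {1}. - ?W i * \<psi> (i, d))" if d: "d \<in> C" for d
  proof -
    have "(\<Sum>i\<in>{1..m} - {1}. - ?W i * \<psi> (i, d)) = - (\<Sum>i\<in>{2..m}. ?W i * ?X i d)"
      unfolding sum_negf[symmetric] by (rule sum.cong) (auto simp: \<psi>_def)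
    moreover have "h * ?X 1 d = - (\<Sum>i\<in>{2..m}. ?W i * ?X i d)" if "d \<in> L"
    proof -
      obtain j where j: "j \<in> {1..<m}" "d = ?a j" using \<open>d \<in> L\<close> unfolding L_def by blast
      have "gdet m ?X (?a(m := d)) = 0"
        by (rule gdet_eq_cols[of j _ m]) (use j in auto)
      then show ?thesis using Bexpand[of d] split1[of "\<lambda>i. ?W i * ?X i d"]
        by (simp add: h_def eq_neg_iff_add_eq_0)
    qed
    ultimately show ?thesis using d by (auto simp: \<psi>_def)
  qed
  have \<psi>_minor: "subst \<psi> (minor m F) \<in> J'" if F: "F \<in> facets m (insert C \<C>)" for F
  proof -
    obtain A where A: "A \<in> insert C \<C>" "F \<subseteq> A" "card F = m" using F by (auto simp: facets_def)
    have fF: "finite F" using A finA finite_subset by blast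
    have eF: "enum F j \<in> F" if "j \<in> {1..m}" for j using that fF A(3) by (intro enum_in) auto
    have s: "subst \<psi> (minor m F) = gdet m (\<lambda>i j. \<psi> (i, j)) (enum F)"
      by (simp add: minor_gdet subst_gdet)
    show ?thesis
    proof (cases "A = C")
      case True
      have "gdet m (\<lambda>i j. \<psi> (i, j)) (enum F) = 0"
      proof (rule gdet_row_combination[where r = 1 and w = "\<lambda>i. - ?W i"])
        show "1 \<in> {1..m}" using m by simp
        fix j assume "j \<in> {1..m}"
        then show "\<psi> (1, enum F j) = (\<Sum>i\<in>{1..m} - {1}. - ?W i * \<psi> (i, enum F j))"
          using eF A(2) True by (intro \<psi>_row) auto
      qed
      then show ?thesis using s ideal_inD(2)[OF J'] by simp
    next
      case False
      then have AC: "A \<in> \<C>" using A(1) by blast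
      \<comment> \<open>The only vertex shared with \<open>C\<close> is \<open>enum C 1\<close>,
        which lies in \<open>L\<close>; on an old facet the substitution therefore only scales row
        1.\<close>
      have nE: "enum F j \<notin> C - L" if "j \<in> {1..m}" for j
      proof
        assume E: "enum F j \<in> C - L"
        have "enum F j = ?a 1" by (rule new[OF AC]) (use E eF[OF that] A(2) in blast)+
        moreover have "?a 1 \<in> L" unfolding L_def using m by (intro imageI) auto
        ultimately show False using E by simp
      qed
      have "gdet m (\<lambda>i j. \<psi> (i, j)) (enum F) = h * gdet m ?X (enum F)"
        by (rule gdet_scale_row1) (use m nE in \<open>auto simp: \<psi>_def\<close>)
      moreover have "minor m F \<in> J'" unfolding J'_def by (rule minor_in_minors_ideal[OF A(2) AC A(3)])
      ultimately show ?thesis using ideal_inD(4)[OF J' hB] s by (simp add: minor_gdet)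
    qed
  qed
  have sub: "J' \<subseteq> J"
    unfolding J'_def
  proof (subst minors_ideal_def, rule ideal_gen_least)
    show "ideal_in (polys_in ({1..m} \<times> {1..n})) J" using J by (simp add: B_def)
    show "minor m ` facets m \<C> \<subseteq> J"
    proof
      fix g :: "'a mpoly" assume "g \<in> minor m ` facets m \<C>"
      then obtain F A where F: "g = minor m F" "card F = m" "A \<in> \<C>" "F \<subseteq> A" by (auto simp: facets_def)
      show "g \<in> J" unfolding F(1) J_def by (rule minor_in_minors_ideal[OF F(4) _ F(2)]) (use F(3) in blast)
    qed
  qed
  have \<sigma>\<psi>: "\<sigma> v - \<psi> v \<in> J" if v: "v \<in> B" for v
  proof -
    obtain i d where id: "v = (i, d)" by fastforce
    show ?thesis
    proof (cases "i = 1 \<and> d \<in> C - L")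
      case True
      have "\<sigma> v - \<psi> v = (\<Sum>i\<in>{1..m}. ?W i * ?X i d)"
        unfolding split1 using True by (simp add: id \<sigma>_def \<psi>_def h_def)
      also have "\<dots> = gdet m ?X (?a(m := d))" by (rule Bexpand)
      also have "\<dots> \<in> J"
      proof -
        have lt: "?a j < d" if j: "j \<in> {1..<m}" for j
        proof -
          obtain k where k: "k \<in> {1..card C}" "d = ?a k" using enum_inverse[OF fC] True by blast
          have "k \<notin> {1..<m}" using True k(2) by (auto simp: L_def)
          then have "j < k" using k(1) j by auto
          then show ?thesis using k enum_mono[OF fC, of j k] j by auto
        qed
        let ?s = "?a(m := d)"
        have sm: "strict_mono_on {1..m} ?s"
        proof (rule strict_mono_onI)
          fix i j assume "i \<in> {1..m}" "j \<in> {1..m}" "i < j"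
          then show "?s i < ?s j" using lt strict_mono_onD[OF mono, of i j] by auto
        qed
        have "gdet m ?X ?s = minor m (?s ` {1..m})"
          unfolding minor_gdet by (rule gdet_cong) (simp only: enum_image_strict_mono(1)[OF sm])
        moreover have "?s ` {1..m} \<subseteq> C" using aC True by auto
        moreover have "card (?s ` {1..m}) = m" using enum_image_strict_mono(2)[OF sm, of m] m by simp
        ultimately show ?thesis unfolding J_def using minor_in_minors_ideal[of "?s ` {1..m}" C "insert C \<C>" m n] by auto
      qed
      finally show ?thesis .
    next
      case False
      then have "\<sigma> v = \<psi> v" by (auto simp: id \<sigma>_def \<psi>_def)
      then show ?thesis using ideal_inD(2)[OF J] by simp
    qed
  qed
  have iff: "g \<in> J \<longleftrightarrow> subst \<psi> g \<in> J'" if g: "g \<in> polys_in B" for g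
  proof
    assume "g \<in> J"
    then obtain T c where T: "g = (\<Sum>f\<in>T. c f * f)" "T \<subseteq> minor m ` facets m (insert C \<C>)"
      "\<And>f. f \<in> T \<Longrightarrow> c f \<in> polys_in B"
      unfolding J_def minors_ideal_def ideal_gen_def B_def by blast
    show "subst \<psi> g \<in> J'" unfolding T(1) subst_sum subst_mult
    proof (rule ideal_in_sum[OF J'])
      fix f assume f: "f \<in> T"
      then have "subst \<psi> f \<in> J'" using T(2) \<psi>_minor by auto
      then show "subst \<psi> (c f) * subst \<psi> f \<in> J'"
        by (intro ideal_inD(4)[OF J'] subst_polys_in[OF T(3)[OF f] \<psi>B])
    qed
  next
    assume "subst \<psi> g \<in> J'"
    then have "subst \<psi> g \<in> J" using sub by blast
    moreover have "subst \<sigma> g - subst \<psi> g \<in> J" by (rule subst_congruent[OF J g \<sigma>B \<psi>B \<sigma>\<psi>])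
    ultimately have "subst \<sigma> g - subst \<psi> g + subst \<psi> g \<in> J" by (intro ideal_inD(3)[OF J])
    then have \<sigma>J: "subst \<sigma> g \<in> J" by simp
    \<comment> \<open>Passing to homogeneous parts isolates a single power of \<open>h\<close>,
      which can then be cancelled modulo \<open>J\<close>.\<close>
    have part: "row1_part k g \<in> J" for k
    proof (rule nzd_power)
      have m1: "1 \<le> m" using m by simp
      have "row1_part k (subst \<sigma> g) \<in> J"
        unfolding J_def by (rule row1_part_minors_ideal[OF \<C> m1 \<sigma>J[unfolded J_def]])
      moreover have "row1_part k (subst \<sigma> g) = h ^ k * row1_part k g"
        unfolding \<sigma>_def by (rule subst_scale_row1[OF h_row])
      ultimately show "h ^ k * row1_part k g \<in> J" by simp
      show "row1_part k g \<in> polys_in B" by (rule row1_part_polys_in[OF g])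
    qed
    obtain K where "g = (\<Sum>k\<le>K. row1_part k g)" using sum_row1_part by blast
    moreover have "(\<Sum>k\<le>K. row1_part k g) \<in> J" by (rule ideal_in_sum[OF J]) (rule part)
    ultimately show "g \<in> J" by simp
  qed
  show ?thesis by (rule prime_preimage[OF prime J \<psi>B iff])
qed

section \<open>Independence of primality from the labelling\<close>

lemma gdet_enumeration:
  assumes F: "finite F" "card F = m" and c: "bij_betw c {1..m} F"
  shows "gdet m Xvar c = (minor m F :: 'a::comm_ring_1 mpoly) \<or> gdet m Xvar c = - (minor m F :: 'a mpoly)"
proof -
  let ?e = "enum F"
  have e: "bij_betw ?e {1..m} F" using enum_bij[OF F(1)] F(2) by simp
  define \<tau> where "\<tau> i = (if i \<in> {1..m} then inv_into {1..m} ?e (c i) else i)" for i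
  have \<tau>: "\<tau> permutes {1..m}"
  proof (rule bij_imp_permutes)
    have "bij_betw (inv_into {1..m} ?e \<circ> c) {1..m} {1..m}"
      using bij_betw_trans[OF c bij_betw_inv_into[OF e]] .
    then show "bij_betw \<tau> {1..m} {1..m}"
      by (rule bij_betw_cong[THEN iffD1, rotated]) (simp add: \<tau>_def)
  qed (auto simp: \<tau>_def)
  have "?e (\<tau> i) = c i" if i: "i \<in> {1..m}" for i
  proof -
    have "c i \<in> ?e ` {1..m}" using e c i by (auto simp: bij_betw_def)
    then show ?thesis using i by (simp add: \<tau>_def f_inv_into_f)
  qed
  then have "gdet m Xvar (?e \<circ> \<tau>) = (gdet m Xvar c :: 'a mpoly)"
    by (intro gdet_cong) simp
  then have "minor m F = of_int (sign \<tau>) * (gdet m Xvar c :: 'a mpoly)"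
    using gdet_permute_cols[OF \<tau>, where X = "Xvar :: nat \<Rightarrow> nat \<Rightarrow> 'a mpoly" and c = ?e] by (simp add: minor_gdet)
  then show ?thesis by (cases "sign \<tau> = 1") (auto simp: sign_def split: if_splits)
qed

lemma subst_relabel_minors_ideal:
  assumes \<C>: "\<And>A. A \<in> \<C> \<Longrightarrow> A \<subseteq> {1..n}" and \<sigma>: "\<sigma> permutes {1..n}"
    and g: "(g :: 'a::comm_ring_1 mpoly) \<in> minors_ideal n m \<C>"
  shows "subst (\<lambda>(i, j). Xvar i (\<sigma> j)) g \<in> minors_ideal n m ((`) \<sigma> ` \<C>)"
proof -
  let ?B = "{1..m} \<times> {1..n}" and ?s = "\<lambda>(i, j). Xvar i (\<sigma> j) :: 'a mpoly"
  have \<sigma>\<C>: "A \<subseteq> {1..n}" if "A \<in> (`) \<sigma> ` \<C>" for A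
    using that \<C> permutes_in_image[OF \<sigma>] by blast
  have J: "ideal_in (polys_in ?B) (minors_ideal n m ((`) \<sigma> ` \<C>) :: 'a mpoly set)"
    by (rule ideal_in_minors_ideal[OF \<sigma>\<C>])
  obtain T c where T: "g = (\<Sum>f\<in>T. c f * f)" "T \<subseteq> minor m ` facets m \<C>" "\<And>f. f \<in> T \<Longrightarrow> c f \<in> polys_in ?B"
    using g unfolding minors_ideal_def ideal_gen_def by blast
  have sB: "?s v \<in> polys_in ?B" if "v \<in> ?B" for v
  proof -
    obtain i j where v: "v = (i, j)" by fastforce
    then have "(i, \<sigma> j) \<in> ?B" using that permutes_in_image[OF \<sigma>, of j] by simp
    then show ?thesis unfolding v by (simp add: polys_in_Xvar)
  qed
  show ?thesis unfolding T(1) subst_sum subst_mult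
  proof (rule ideal_in_sum[OF J])
    fix f assume f: "f \<in> T"
    have "f \<in> minor m ` facets m \<C>" using f T(2) by blast
    then obtain F A where F: "f = minor m F" "card F = m" "A \<in> \<C>" "F \<subseteq> A"
      by (auto simp: facets_def)
    have "F \<subseteq> {1..n}" using F(4) \<C>[OF F(3)] by blast
    then have fF: "finite F" by (rule finite_subset) simp
    have inj: "inj_on \<sigma> F" using permutes_inj[OF \<sigma>] by (rule inj_on_subset) simp
    have "bij_betw (\<sigma> \<circ> enum F) {1..m} (\<sigma> ` F)"
      using bij_betw_trans[OF enum_bij[OF fF] inj_on_imp_bij_betw[OF inj]] F(2) by simp
    moreover have card: "card (\<sigma> ` F) = m" using card_image[OF inj] F(2) by simp
    ultimately have "gdet m Xvar (\<sigma> \<circ> enum F) = (minor m (\<sigma> ` F) :: 'a mpoly)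
        \<or> gdet m Xvar (\<sigma> \<circ> enum F) = - (minor m (\<sigma> ` F) :: 'a mpoly)"
      using fF by (intro gdet_enumeration) auto
    moreover have "subst ?s f = gdet m Xvar (\<sigma> \<circ> enum F)"
      unfolding F(1) minor_gdet subst_gdet by (rule gdet_cong) simp
    moreover have "minor m (\<sigma> ` F) \<in> (minors_ideal n m ((`) \<sigma> ` \<C>) :: 'a mpoly set)"
      by (rule minor_in_minors_ideal[OF _ _ card, where A = "\<sigma> ` A"]) (use F in auto)
    ultimately have "subst ?s f \<in> minors_ideal n m ((`) \<sigma> ` \<C>)"
      using ideal_in_uminus[OF J] by auto
    then show "subst ?s (c f) * subst ?s f \<in> minors_ideal n m ((`) \<sigma> ` \<C>)"
      by (intro ideal_inD(4)[OF J] subst_polys_in[OF T(3)[OF f] sB])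
  qed
qed

text \<open>Sorting renamed columns changes a minor by a sign only, so renaming maps one ideal into
  the other; the inverse renaming gives the converse.\<close>

lemma prime_relabel:
  assumes \<C>: "\<And>A. A \<in> \<C> \<Longrightarrow> A \<subseteq> {1..n}" and \<sigma>: "\<sigma> permutes {1..n}"
    and P: "prime_ideal_in (polys_in ({1..m} \<times> {1..n})) (minors_ideal n m ((`) \<sigma> ` \<C>) :: 'a::field mpoly set)"
  shows "prime_ideal_in (polys_in ({1..m} \<times> {1..n})) (minors_ideal n m \<C> :: 'a mpoly set)"
proof (rule prime_preimage[OF P])
  let ?B = "{1..m} \<times> {1..n}"
  let ?s = "\<lambda>\<sigma> (i, j). Xvar i (\<sigma> j) :: 'a mpoly"
  show "ideal_in (polys_in ?B) (minors_ideal n m \<C> :: 'a mpoly set)"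
    by (rule ideal_in_minors_ideal[OF \<C>])
  show "?s \<sigma> v \<in> polys_in ?B" if "v \<in> ?B" for v
  proof -
    obtain i j where v: "v = (i, j)" by fastforce
    then have "(i, \<sigma> j) \<in> ?B" using that permutes_in_image[OF \<sigma>, of j] by simp
    then show ?thesis unfolding v by (simp add: polys_in_Xvar)
  qed
  fix g :: "'a mpoly"
  show "g \<in> minors_ideal n m \<C> \<longleftrightarrow> subst (?s \<sigma>) g \<in> minors_ideal n m ((`) \<sigma> ` \<C>)"
  proof
    assume "g \<in> minors_ideal n m \<C>"
    then show "subst (?s \<sigma>) g \<in> minors_ideal n m ((`) \<sigma> ` \<C>)"
      by (intro subst_relabel_minors_ideal \<C> \<sigma>)
  next
    assume g: "subst (?s \<sigma>) g \<in> minors_ideal n m ((`) \<sigma> ` \<C>)"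
    have "A \<subseteq> {1..n}" if "A \<in> (`) \<sigma> ` \<C>" for A
      using that \<C> permutes_in_image[OF \<sigma>] by blast
    then have "subst (?s (inv \<sigma>)) (subst (?s \<sigma>) g) \<in> minors_ideal n m ((`) (inv \<sigma>) ` (`) \<sigma> ` \<C>)"
      by (intro subst_relabel_minors_ideal permutes_inv[OF \<sigma>] g)
    moreover have "(`) (inv \<sigma>) ` (`) \<sigma> ` \<C> = \<C>"
      using permutes_inj[OF \<sigma>] by (simp add: image_image image_inv_f_f)
    moreover have "subst (?s (inv \<sigma>)) (subst (?s \<sigma>) g) = g"
    proof -
      have "(\<lambda>v. subst (?s (inv \<sigma>)) (?s \<sigma> v)) = (\<lambda>(i, j). Xvar i j)"
        using permutes_inverses(2)[OF \<sigma>] by (auto simp: fun_eq_iff)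
      then show ?thesis by (simp add: subst_subst subst_Xvar_id)
    qed
    ultimately show "g \<in> minors_ideal n m \<C>" by simp
  qed
qed

section \<open>Trees of cliques and their labellings\<close>

text \<open>A recursive form of a tree that exposes a last clique for inductions. The first clique
  \<open>R\<close> is kept as a parameter because it is the one whose top vertex
  \<open>tree_labelling\<close> can prescribe.\<close>

inductive tree_family :: "'v set \<Rightarrow> 'v set set \<Rightarrow> bool" where
  root: "tree_family R {R}"
| attach: "tree_family R \<C> \<Longrightarrow> A \<in> \<C> \<Longrightarrow> C \<notin> \<C> \<Longrightarrow> C \<inter> A = {v} \<Longrightarrow>
    (\<And>B. B \<in> \<C> \<Longrightarrow> B \<noteq> A \<Longrightarrow> C \<inter> B = {}) \<Longrightarrow> tree_family R (insert C \<C>)"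

lemma tree_family_root: "tree_family R \<C> \<Longrightarrow> R \<in> \<C>"
  by (induction rule: tree_family.induct) auto

text \<open>Put \<open>C\<close> at the beginning of the construction instead of the end:
  \<open>A\<close> is then attached to \<open>C\<close>, and all later steps carry over because they
  do not meet \<open>C\<close>.\<close>

lemma tree_family_attach_root:
  assumes "tree_family A \<C>" "C \<notin> \<C>" "C \<inter> A = {v}" "\<And>B. B \<in> \<C> \<Longrightarrow> B \<noteq> A \<Longrightarrow> C \<inter> B = {}"
  shows "tree_family C (insert C \<C>)"
  using assms
proof (induction rule: tree_family.induct)
  case (root R)
  have "tree_family C (insert R {C})"
    by (rule tree_family.attach[OF tree_family.root, where A = C and v = v]) (use root in auto)
  then show ?case by (simp add: insert_commute)
next
  case (attach R \<C> A D u)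
  have IH: "tree_family C (insert C \<C>)"
    by (rule attach.IH) (use attach.prems in auto)
  have "D \<noteq> R" using tree_family_root[OF attach.hyps(1)] attach.hyps(3) by blast
  then have CD: "C \<inter> D = {}" using attach.prems(3)[of D] by blast
  have "tree_family C (insert D (insert C \<C>))"
  proof (rule tree_family.attach[OF IH])
    show "A \<in> insert C \<C>" using attach.hyps(2) by blast
    show "D \<notin> insert C \<C>" using attach.hyps(3) attach.prems(1) by blast
    show "D \<inter> A = {u}" by (rule attach.hyps(4))
    show "D \<inter> B = {}" if "B \<in> insert C \<C>" "B \<noteq> A" for B
      using that CD attach.hyps(5)[of B] by blast
  qed
  then show ?case by (simp add: insert_commute)
qed

text \<open>A new clique may attach to any \<open>A\<close> of the old tree, while primality needs a
  labelling with a prescribed top vertex of that \<open>A\<close>.\<close>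

lemma tree_family_reroot:
  assumes "tree_family R \<C>" "A \<in> \<C>"
  shows "tree_family A \<C>"
  using assms
proof (induction arbitrary: A rule: tree_family.induct)
  case (root R)
  then show ?case by (simp add: tree_family.root)
next
  case (attach R \<C> B C v)
  show ?case
  proof (cases "A = C")
    case True
    show ?thesis unfolding True
      by (rule tree_family_attach_root[OF attach.IH[OF attach.hyps(2)] attach.hyps(3,4)]) (rule attach.hyps(5))
  next
    case False
    then have "tree_family A \<C>" using attach.IH attach.prems by blast
    then show ?thesis
      by (rule tree_family.attach[OF _ attach.hyps(2-4)]) (rule attach.hyps(5))
  qed
qed

section \<open>Positions of shared vertices and the construction of labellings\<close>

definition lows :: "(nat \<Rightarrow> int) \<Rightarrow> nat set \<Rightarrow> nat \<Rightarrow> nat" where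
  "lows f A w = card {x \<in> A. f x < f w}"

definition highs :: "(nat \<Rightarrow> int) \<Rightarrow> nat set \<Rightarrow> nat \<Rightarrow> nat" where
  "highs f A w = card {x \<in> A. f w < f x}"

text \<open>The rows a vertex \<open>w\<close> can occupy in the diagonals of facets inside \<open>A\<close> form an interval;
  \<open>apart\<close> says that the intervals belonging to \<open>A\<close> and \<open>B\<close> are disjoint.\<close>

definition apart :: "nat \<Rightarrow> (nat \<Rightarrow> int) \<Rightarrow> nat set \<Rightarrow> nat set \<Rightarrow> nat \<Rightarrow> bool" where
  "apart m f A B w \<longleftrightarrow> lows f A w + highs f B w + 2 \<le> m \<or> lows f B w + highs f A w + 2 \<le> m"

text \<open>What is left of \<open>apart\<close> when the other clique has \<open>w\<close> at the
  suitable end: \<open>w\<close> is among the first or the last \<open>m - 1\<close> vertices of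
  \<open>A\<close>.\<close>

definition peripheral :: "nat \<Rightarrow> (nat \<Rightarrow> int) \<Rightarrow> nat set \<Rightarrow> nat \<Rightarrow> bool" where
  "peripheral m f A w \<longleftrightarrow> lows f A w + 2 \<le> m \<or> highs f A w + 2 \<le> m"

text \<open>Labellings have integer values so that reversing the order is negation, which exchanges
  the two ends.\<close>

lemma lows_uminus: "lows (\<lambda>x. - f x) A w = highs f A w"
  and highs_uminus: "highs (\<lambda>x. - f x) A w = lows f A w"
  by (simp_all add: lows_def highs_def)

lemma apart_uminus: "apart m (\<lambda>x. - f x) A B w \<longleftrightarrow> apart m f A B w"
  unfolding apart_def lows_uminus highs_uminus by (auto simp: add.commute)

lemma peripheral_uminus: "peripheral m (\<lambda>x. - f x) A w \<longleftrightarrow> peripheral m f A w"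
  unfolding peripheral_def lows_uminus highs_uminus by auto

lemma apart_commute: "apart m f A B w \<longleftrightarrow> apart m f B A w"
  by (auto simp: apart_def)

lemma lows_highs_cong:
  assumes "\<And>x. x \<in> A \<Longrightarrow> f x = g x" "w \<in> A"
  shows "lows f A w = lows g A w" "highs f A w = highs g A w"
proof -
  have "{x \<in> A. f x < f w} = {x \<in> A. g x < g w}" "{x \<in> A. f w < f x} = {x \<in> A. g w < g x}"
    using assms by auto
  then show "lows f A w = lows g A w" "highs f A w = highs g A w"
    unfolding lows_def highs_def by simp_all
qed

text \<open>List \<open>D\<close> with at most \<open>a\<close> elements of \<open>P\<close> in
  front and the remaining ones, at most \<open>b\<close>, at the back; \<open>g\<close> is the
  position in this list.\<close>

lemma arrange:
  fixes D :: "nat set"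
  assumes D: "finite D" "P \<subseteq> D" and P: "card P \<le> a + b"
  shows "\<exists>g. inj_on g D \<and> (\<forall>x\<in>P. card {y \<in> D. g y < (g x :: nat)} < a \<or> card {y \<in> D. g x < g y} < b)"
proof -
  have fP: "finite P" using D by (rule finite_subset[rotated])
  obtain P1 where P1: "P1 \<subseteq> P" "card P1 = min a (card P)"
    using obtain_subset_with_card_n[of "min a (card P)" P] by auto
  define P2 where "P2 = P - P1"
  define Q where "Q = D - P"
  have fin: "finite P1" "finite P2" "finite Q"
    using fP P1(1) D(1) by (auto simp: P2_def Q_def intro: finite_subset)
  have c2: "card P2 \<le> b"
    using P P1 fin(1) by (simp add: P2_def card_Diff_subset)
  obtain xs1 xs2 ys where l: "set xs1 = P1" "distinct xs1" "set xs2 = P2" "distinct xs2" "set ys = Q" "distinct ys"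
    using fin finite_distinct_list by metis
  let ?zs = "xs1 @ ys @ xs2"
  have zs: "distinct ?zs" "set ?zs = D"
    using l P1(1) D(2) by (auto simp: P2_def Q_def)
  have bij: "bij_betw ((!) ?zs) {..<length ?zs} D" using zs by (intro bij_betw_nth) auto
  define g where "g = inv_into {..<length ?zs} ((!) ?zs)"
  have bg: "bij_betw g D {..<length ?zs}" unfolding g_def by (rule bij_betw_inv_into[OF bij])
  then have inj: "inj_on g D" and im: "g ` D = {..<length ?zs}" by (auto simp: bij_betw_def)
  have gn: "g (?zs ! i) = i" if "i < length ?zs" for i
    unfolding g_def using bij that by (intro inv_into_f_f) (auto simp: bij_betw_def)
  have lowcard: "card {y \<in> D. g y < g x} = g x" if x: "x \<in> D" for x
  proof -
    have "g x < length ?zs" using im x by auto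
    then have "{k \<in> g ` D. k < g x} = {..<g x}" unfolding im by auto
    moreover have "{k \<in> g ` D. k < g x} = g ` {y \<in> D. g y < g x}" by blast
    ultimately have "g ` {y \<in> D. g y < g x} = {..<g x}" by (simp only:)
    moreover have "inj_on g {y \<in> D. g y < g x}" using inj by (rule inj_on_subset) auto
    ultimately show ?thesis by (metis card_image card_lessThan)
  qed
  have highcard: "card {y \<in> D. g x < g y} = length ?zs - Suc (g x)" if x: "x \<in> D" for x
  proof -
    have "g x < length ?zs" using im x by auto
    then have "{k \<in> g ` D. g x < k} = {g x<..<length ?zs}" unfolding im by auto
    moreover have "{k \<in> g ` D. g x < k} = g ` {y \<in> D. g x < g y}" by blast
    ultimately have "g ` {y \<in> D. g x < g y} = {g x<..<length ?zs}" by (simp only:)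
    moreover have "inj_on g {y \<in> D. g x < g y}" using inj by (rule inj_on_subset) auto
    ultimately show ?thesis by (metis card_image card_greaterThanLessThan)
  qed
  have "card {y \<in> D. g y < g x} < a \<or> card {y \<in> D. g x < g y} < b" if x: "x \<in> P" for x
  proof (cases "x \<in> P1")
    case True
    then obtain i where i: "i < length xs1" "x = xs1 ! i" using l(1) by (metis in_set_conv_nth)
    then have "x = ?zs ! i" by (simp add: nth_append)
    then have "g x = i" using gn[of i] i(1) by simp
    moreover have "length xs1 \<le> a" using l(1,2) P1(2) distinct_card[of xs1] by simp
    ultimately show ?thesis using lowcard[of x] x D(2) i(1) by auto
  next
    case False
    then have "x \<in> set xs2" using x l(3) by (simp add: P2_def)
    then obtain i where i: "i < length xs2" "x = xs2 ! i" by (metis in_set_conv_nth)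
    let ?j = "length xs1 + length ys + i"
    have "x = ?zs ! ?j" using i by (simp add: nth_append)
    then have "g x = ?j" using gn[of ?j] i(1) by simp
    moreover have "length xs2 \<le> b" using l(3,4) c2 distinct_card[of xs2] by simp
    ultimately show ?thesis using highcard[of x] x D(2) i(1) by auto
  qed
  with inj show ?thesis by blast
qed

text \<open>With the new vertices above all of \<open>U\<close>, the attaching vertex
  \<open>w\<close> is lowest in \<open>C\<close> and occupies one of the \<open>m - 1\<close> low
  places. This leaves \<open>m - 2\<close> low and \<open>m - 1\<close> high places for
  \<open>P\<close>.\<close>

lemma extend_upwards:
  fixes f :: "nat \<Rightarrow> int"
  assumes U: "finite U" "inj_on f U" and C: "finite C" "C \<inter> U = {w}"
    and P: "P \<subseteq> C - {w}" "card P \<le> 2 * (m - 1) - 1" and m: "2 \<le> m"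
  shows "\<exists>f'. (\<forall>x\<in>U. f' x = f x) \<and> inj_on f' (U \<union> C) \<and> (\<forall>x\<in>U. \<forall>c\<in>C - {w}. f' x < f' c)
    \<and> (\<forall>x\<in>P. peripheral m f' C x)"
proof -
  have "2 * (m - 1) - 1 = (m - 2) + (m - 1)" using m by simp
  then obtain g where g: "inj_on g (C - {w})"
    "\<And>x. x \<in> P \<Longrightarrow> card {y \<in> C - {w}. g y < (g x :: nat)} < m - 2 \<or> card {y \<in> C - {w}. g x < g y} < m - 1"
    using arrange[of "C - {w}" P "m - 2" "m - 1"] C(1) P by auto
  define M where "M = Max (f ` U)"
  have M: "f x \<le> M" if "x \<in> U" for x unfolding M_def using U(1) that by simp
  define f' where "f' x = (if x \<in> C - {w} then M + 1 + int (g x) else f x)" for x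
  have CU: "x \<notin> U" if "x \<in> C - {w}" for x using C(2) that by blast
  have w: "w \<in> U" "w \<in> C" using C(2) by auto
  have fU: "f' x = f x" if "x \<in> U" for x using that CU by (auto simp: f'_def)
  have fC: "f' x = M + 1 + int (g x)" if "x \<in> C - {w}" for x using that by (simp add: f'_def)
  have less: "f' x < f' c" if "x \<in> U" "c \<in> C - {w}" for x c
    using fU[OF that(1)] fC[OF that(2)] M[OF that(1)] by linarith
  have "inj_on f' (U \<union> C)"
  proof (rule inj_onI)
    fix x y assume xy: "x \<in> U \<union> C" "y \<in> U \<union> C" "f' x = f' y"
    consider "x \<in> U" "y \<in> U" | "x \<in> U" "y \<in> C - {w}" | "x \<in> C - {w}" "y \<in> U" | "x \<in> C - {w}" "y \<in> C - {w}"
      using xy(1,2) w by blast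
    then show "x = y"
    proof cases
      case 1
      then show ?thesis using xy(3) inj_onD[OF U(2)] by (simp add: fU)
    next
      case 2
      then show ?thesis using less[OF 2] xy(3) by simp
    next
      case 3
      then show ?thesis using less[OF 3(2,1)] xy(3) by simp
    next
      case 4
      then have "g x = g y" using xy(3) fC[OF 4(1)] fC[OF 4(2)] by simp
      then show ?thesis using inj_onD[OF g(1)] 4 by blast
    qed
  qed
  moreover have "peripheral m f' C x" if x: "x \<in> P" for x
  proof -
    have xC: "x \<in> C - {w}" using x P(1) by blast
    have cmp: "(f' y < f' x \<longleftrightarrow> y = w \<or> g y < g x) \<and> (f' x < f' y \<longleftrightarrow> y \<noteq> w \<and> g x < g y)" if "y \<in> C" for y
    proof (cases "y = w")
      case True
      then show ?thesis using less[OF w(1) xC] by simp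
    next
      case False
      then show ?thesis using fC[of y] fC[OF xC] that by simp
    qed
    have "{y \<in> C. f' y < f' x} = insert w {y \<in> C - {w}. g y < g x}"
      using cmp w(2) by blast
    then have "lows f' C x = Suc (card {y \<in> C - {w}. g y < g x})"
      unfolding lows_def using C(1) by simp
    moreover have "{y \<in> C. f' x < f' y} = {y \<in> C - {w}. g x < g y}"
      using cmp by blast
    then have "highs f' C x = card {y \<in> C - {w}. g x < g y}" unfolding highs_def by simp
    ultimately show ?thesis using g(2)[OF x] m unfolding peripheral_def by auto
  qed
  ultimately show ?thesis using fU less by blast
qed

lemma lows_lowest:
  assumes "w \<in> C" "\<And>c. c \<in> C - {w} \<Longrightarrow> f w < f c" shows "lows f C w = 0"
proof -
  have "\<not> f x < f w" if "x \<in> C" for x using assms(2)[of x] that by (cases "x = w") auto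
  then have "{x \<in> C. f x < f w} = {}" by blast
  then show ?thesis by (simp only: lows_def card.empty)
qed

text \<open>If few vertices of \<open>A\<close> lie above \<open>w\<close>, then \<open>C\<close>
  goes on top, which makes \<open>lows f' C w = 0\<close> and yields \<open>apart\<close>. Otherwise
  few vertices lie below \<open>w\<close>, and the same construction is applied to the negated
  labelling.\<close>

lemma extend_apart:
  fixes f :: "nat \<Rightarrow> int"
  assumes U: "finite U" "inj_on f U" and C: "finite C" "C \<inter> U = {w}"
    and P: "P \<subseteq> C" "card P \<le> 2 * (m - 1)" "w \<in> P" and m: "2 \<le> m"
    and A: "A \<subseteq> U" "w \<in> A" "peripheral m f A w"
  shows "\<exists>f'. (\<forall>x\<in>U. f' x = f x) \<and> inj_on f' (U \<union> C)
    \<and> (\<forall>x\<in>P. peripheral m f' C x) \<and> apart m f' A C w"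
proof -
  have fP: "finite P" using P(1) C(1) by (rule finite_subset)
  have P': "P - {w} \<subseteq> C - {w}" "card (P - {w}) \<le> 2 * (m - 1) - 1"
    using P fP by (auto simp: card_Diff_singleton)
  have main: "\<exists>f'. (\<forall>x\<in>U. f' x = f x) \<and> inj_on f' (U \<union> C)
      \<and> (\<forall>x\<in>P. peripheral m f' C x) \<and> apart m f' A C w"
    if f: "inj_on f U" and high: "highs f A w + 2 \<le> m" for f :: "nat \<Rightarrow> int"
  proof -
    obtain f' where f': "\<And>x. x \<in> U \<Longrightarrow> f' x = f x" "inj_on f' (U \<union> C)"
      "\<And>x c. x \<in> U \<Longrightarrow> c \<in> C - {w} \<Longrightarrow> f' x < f' c" "\<And>x. x \<in> P - {w} \<Longrightarrow> peripheral m f' C x"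
      using extend_upwards[OF U(1) f C P' m] by blast
    have w: "w \<in> U" "w \<in> C" using C(2) by auto
    have low: "lows f' C w = 0" by (rule lows_lowest[OF w(2)]) (rule f'(3)[OF w(1)])
    have "highs f' A w = highs f A w" using A(1,2) f'(1) by (intro lows_highs_cong) auto
    then have "apart m f' A C w" using low high by (simp add: apart_def)
    moreover have "peripheral m f' C w" using low m by (simp add: peripheral_def)
    then have "\<forall>x\<in>P. peripheral m f' C x" using f'(4) by (metis DiffI singletonD)
    ultimately show ?thesis using f'(1,2) by blast
  qed
  show ?thesis
  proof (cases "highs f A w + 2 \<le> m")
    case True
    then show ?thesis by (rule main[OF U(2)])
  next
    case False
    then have "highs (\<lambda>x. - f x) A w + 2 \<le> m" using A(3) by (simp add: peripheral_def highs_uminus)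
    moreover have "inj_on (\<lambda>x. - f x) U" using U(2) by (auto simp: inj_on_def)
    ultimately obtain f' where f': "\<And>x. x \<in> U \<Longrightarrow> f' x = - f x" "inj_on f' (U \<union> C)"
      "\<And>x. x \<in> P \<Longrightarrow> peripheral m f' C x" "apart m f' A C w"
      using main[of "\<lambda>x. - f x"] by blast
    then show ?thesis
      by (intro exI[of _ "\<lambda>x. - f' x"]) (auto simp: peripheral_uminus apart_uminus inj_on_def)
  qed
qed

text \<open>The set \<open>S\<close> stays fixed during the induction and so includes vertices
  shared with cliques attached later: every clique reserves its ends for them from the beginning. In
  the root, \<open>v\<close> occupies one of the \<open>2 * (m - 1)\<close> end places.\<close>

lemma tree_labelling:
  assumes "tree_family R \<C>" and fin: "\<And>A. A \<in> \<C> \<Longrightarrow> finite A"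
    and card: "\<And>A. A \<in> \<C> \<Longrightarrow> card (S \<inter> A) \<le> 2 * (m - 1)"
    and S: "\<And>A B. A \<in> \<C> \<Longrightarrow> B \<in> \<C> \<Longrightarrow> A \<noteq> B \<Longrightarrow> A \<inter> B \<subseteq> S"
    and v: "v \<in> R" "card (insert v (S \<inter> R)) \<le> 2 * (m - 1)" and m: "2 \<le> m"
  shows "\<exists>f :: nat \<Rightarrow> int. inj_on f (\<Union>\<C>) \<and> (\<forall>x\<in>R - {v}. f x < f v)
    \<and> (\<forall>A\<in>\<C>. \<forall>w\<in>S \<inter> A. peripheral m f A w)
    \<and> (\<forall>A\<in>\<C>. \<forall>B\<in>\<C>. \<forall>w\<in>A \<inter> B. A \<noteq> B \<longrightarrow> apart m f A B w)"
  using assms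
proof (induction rule: tree_family.induct)
  case (root R)
  have fR: "finite R" using root by simp
  have "card (S \<inter> R - {v}) \<le> 2 * (m - 1) - 1"
  proof -
    have "card (insert v (S \<inter> R)) = card (insert v (S \<inter> R - {v}))" by simp
    also have "\<dots> = Suc (card (S \<inter> R - {v}))" by (rule card_insert_disjoint) (use fR in auto)
    finally show ?thesis using root.prems(5) by linarith
  qed
  \<comment> \<open>The root is built upwards from \<open>v\<close> alone and negated at the end,
    which turns the lowest vertex \<open>v\<close> into the highest one.\<close>
  then have "\<exists>f'. (\<forall>x\<in>{v}. f' x = 0) \<and> inj_on f' ({v} \<union> R) \<and> (\<forall>x\<in>{v}. \<forall>c\<in>R - {v}. f' x < f' c)
      \<and> (\<forall>x\<in>S \<inter> R - {v}. peripheral m f' R x)"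
    by (intro extend_upwards m) (use fR root.prems(4) in auto)
  then obtain f where f: "inj_on f ({v} \<union> R)" "\<And>c. c \<in> R - {v} \<Longrightarrow> f v < f c"
    "\<And>x. x \<in> S \<inter> R - {v} \<Longrightarrow> peripheral m f R x"
    by blast
  have "peripheral m f R v"
  proof -
    have "lows f R v = 0" by (rule lows_lowest[OF root.prems(4)]) (rule f(2))
    then show ?thesis using m by (simp add: peripheral_def)
  qed
  then have "\<forall>w\<in>S \<inter> R. peripheral m f R w" using f(3) by (metis DiffI singletonD)
  moreover have "inj_on f R" using f(1) by (rule inj_on_subset) auto
  ultimately show ?case using f(2)
    by (intro exI[of _ "\<lambda>x. - f x"]) (auto simp: peripheral_uminus inj_on_def)
next
  case (attach R \<C> A C w)
  have "\<exists>f :: nat \<Rightarrow> int. inj_on f (\<Union>\<C>) \<and> (\<forall>x\<in>R - {v}. f x < f v)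
      \<and> (\<forall>A\<in>\<C>. \<forall>w\<in>S \<inter> A. peripheral m f A w)
      \<and> (\<forall>A\<in>\<C>. \<forall>B\<in>\<C>. \<forall>w\<in>A \<inter> B. A \<noteq> B \<longrightarrow> apart m f A B w)"
    by (rule attach.IH) (use attach.prems in auto)
  then obtain f :: "nat \<Rightarrow> int" where F: "inj_on f (\<Union>\<C>)" "\<forall>x\<in>R - {v}. f x < f v"
    "\<forall>A\<in>\<C>. \<forall>w\<in>S \<inter> A. peripheral m f A w"
    "\<forall>A\<in>\<C>. \<forall>B\<in>\<C>. \<forall>w\<in>A \<inter> B. A \<noteq> B \<longrightarrow> apart m f A B w"
    by (elim exE conjE)
  note f = F(1) F(2-4)[rule_format]
  have "finite \<C>" using attach.hyps(1) by (induction rule: tree_family.induct) auto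
  then have fU: "finite (\<Union>\<C>)" using attach.prems(1) by auto
  have CU: "C \<inter> \<Union>\<C> = {w}" using attach.hyps(2,4,5) by blast
  have AC: "A \<noteq> C" using attach.hyps(2,3) by blast
  have wA: "w \<in> A" "w \<in> C" using attach.hyps(4) by auto
  then have wS: "w \<in> S" using attach.prems(3)[of A C] AC attach.hyps(2) by blast
  have "\<exists>f'. (\<forall>x\<in>\<Union>\<C>. f' x = f x) \<and> inj_on f' (\<Union>\<C> \<union> C)
      \<and> (\<forall>x\<in>S \<inter> C. peripheral m f' C x) \<and> apart m f' A C w"
  proof (rule extend_apart[OF fU f(1) _ CU _ _ _ m])
    show "finite C" "card (S \<inter> C) \<le> 2 * (m - 1)" using attach.prems by auto
    show "S \<inter> C \<subseteq> C" "w \<in> S \<inter> C" "A \<subseteq> \<Union>\<C>" "w \<in> A" using wA wS attach.hyps(2) by auto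
    show "peripheral m f A w" using f(3)[OF attach.hyps(2)] wA wS by blast
  qed
  then obtain f' where f': "\<And>x. x \<in> \<Union>\<C> \<Longrightarrow> f' x = f x" "inj_on f' (\<Union>\<C> \<union> C)"
    "\<And>x. x \<in> S \<inter> C \<Longrightarrow> peripheral m f' C x" "apart m f' A C w" by blast
  have same: "lows f' B x = lows f B x" "highs f' B x = highs f B x" if "B \<in> \<C>" "x \<in> B" for B x
  proof -
    have "f' y = f y" if "y \<in> B" for y using that \<open>B \<in> \<C>\<close> by (intro f'(1)) blast
    then show "lows f' B x = lows f B x" "highs f' B x = highs f B x"
      using lows_highs_cong[of B f' f x] \<open>x \<in> B\<close> by blast+
  qed
  have RC: "R \<in> \<C>" by (rule tree_family_root[OF attach.hyps(1)])
  have "f' x < f' v" if "x \<in> R - {v}" for x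
  proof -
    have "f' x = f x" "f' v = f v" by (rule f'(1), use that RC attach.prems(4) in blast)+
    then show ?thesis using f(2)[OF that] by simp
  qed
  moreover have "peripheral m f' B x" if B: "B \<in> insert C \<C>" "x \<in> S \<inter> B" for B x
  proof (cases "B = C")
    case True
    then show ?thesis using f'(3) B(2) by blast
  next
    case False
    then have "B \<in> \<C>" using B(1) by blast
    then show ?thesis using f(3)[of B x] same[of B x] B(2) by (simp add: peripheral_def)
  qed
  moreover have "apart m f' B D x" if BD: "B \<in> insert C \<C>" "D \<in> insert C \<C>" "x \<in> B \<inter> D" "B \<noteq> D" for B D x
  proof -
    have only: "E = A \<and> y = w" if "E \<in> \<C>" "y \<in> C \<inter> E" for E y
      using that attach.hyps(4) attach.hyps(5)[of E] by blast
    consider "B \<in> \<C>" "D \<in> \<C>" | "B = C" "D \<in> \<C>" | "B \<in> \<C>" "D = C" using BD(1,2,4) by blast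
    then show ?thesis
    proof cases
      case 1
      have "x \<in> B" "x \<in> D" using BD(3) by auto
      then show ?thesis using f(4)[OF 1 BD(3,4)] same[OF 1(1)] same[OF 1(2)] by (simp add: apart_def)
    next
      case 2
      then have "D = A \<and> x = w" using only[of D x] BD(3) by blast
      then show ?thesis using f'(4) 2(1) apart_commute[of m f' A C w] by simp
    next
      case 3
      then have "B = A \<and> x = w" using only[of B x] BD(3) by blast
      then show ?thesis using f'(4) 3(2) by simp
    qed
  qed
  moreover have "inj_on f' (\<Union>(insert C \<C>))" using f'(2) by (simp add: Un_commute)
  ultimately show ?case by (intro exI[of _ f'] conjI ballI impI) blast+
qed

text \<open>Vertices outside \<open>U\<close> are placed above all labels used on \<open>U\<close>,
  in their natural order, and \<sigma> is the rank in the resulting injective labelling of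
  \<open>{1..n}\<close>.\<close>

lemma relabelling:
  fixes f :: "nat \<Rightarrow> int"
  assumes "inj_on f U" "U \<subseteq> {1..n}"
  shows "\<exists>\<sigma>. \<sigma> permutes {1..n} \<and> (\<forall>x\<in>U. \<forall>y\<in>U. \<sigma> x < \<sigma> y \<longleftrightarrow> f x < f y)"
proof -
  have fU: "finite U" using assms(2) by (rule finite_subset) simp
  \<comment> \<open>The inserted 0 keeps the maximum meaningful for empty \<open>U\<close>.\<close>
  define M where "M = Max (insert 0 (f ` U))"
  have M: "f x \<le> M" if "x \<in> U" for x unfolding M_def using fU that by simp
  define g where "g x = (if x \<in> U then f x else M + int x)" for x
  have inj: "x = y" if "x \<in> {1..n}" "y \<in> {1..n}" "g x = g y" for x y
    using that M[of x] M[of y] inj_onD[OF assms(1), of x y] by (auto simp: g_def split: if_splits)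
  define \<sigma> where "\<sigma> x = (if x \<in> {1..n} then card {y \<in> {1..n}. g y \<le> g x} else x)" for x
  have mono: "\<sigma> x < \<sigma> y" if "x \<in> {1..n}" "y \<in> {1..n}" "g x < g y" for x y
  proof -
    have "y \<in> {z \<in> {1..n}. g z \<le> g y}" "y \<notin> {z \<in> {1..n}. g z \<le> g x}"
      "{z \<in> {1..n}. g z \<le> g x} \<subseteq> {z \<in> {1..n}. g z \<le> g y}" using that by auto
    then have "{z \<in> {1..n}. g z \<le> g x} \<subset> {z \<in> {1..n}. g z \<le> g y}" by blast
    then show ?thesis unfolding \<sigma>_def using that by (simp add: psubset_card_mono)
  qed
  have iff: "\<sigma> x < \<sigma> y \<longleftrightarrow> g x < g y" if "x \<in> {1..n}" "y \<in> {1..n}" for x y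
    using mono[OF that] mono[OF that(2,1)] inj[OF that]
    by (cases "g x" "g y" rule: linorder_cases) auto
  have "\<sigma> x \<in> {1..n}" if "x \<in> {1..n}" for x
  proof -
    have "card {y \<in> {1..n}. g y \<le> g x} \<le> card {1..n}" by (rule card_mono) auto
    moreover have "0 < card {y \<in> {1..n}. g y \<le> g x}" using that by (subst card_gt_0_iff) auto
    ultimately show ?thesis using that by (simp add: \<sigma>_def)
  qed
  then have im: "\<sigma> ` {1..n} \<subseteq> {1..n}" by blast
  have inj\<sigma>: "inj_on \<sigma> {1..n}"
  proof (rule inj_onI)
    fix x y assume xy: "x \<in> {1..n}" "y \<in> {1..n}" "\<sigma> x = \<sigma> y"
    have "\<not> g x < g y" "\<not> g y < g x" using iff[OF xy(1,2)] iff[OF xy(2,1)] xy(3) by simp_all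
    then show "x = y" using inj[OF xy(1,2)] by simp
  qed
  have "bij_betw \<sigma> {1..n} {1..n}"
    unfolding bij_betw_def using inj\<sigma> endo_inj_surj[OF _ im inj\<sigma>] by blast
  then have "\<sigma> permutes {1..n}" by (rule bij_imp_permutes) (simp only: \<sigma>_def if_False)
  moreover have "\<sigma> x < \<sigma> y \<longleftrightarrow> f x < f y" if "x \<in> U" "y \<in> U" for x y
  proof -
    have "x \<in> {1..n}" "y \<in> {1..n}" using that assms(2) by auto
    from iff[OF this] show ?thesis using that by (simp add: g_def)
  qed
  ultimately show ?thesis by blast
qed

lemma lows_highs_relabel:
  assumes "\<And>x y. x \<in> U \<Longrightarrow> y \<in> U \<Longrightarrow> \<sigma> x < \<sigma> y \<longleftrightarrow> f x < f y"
    and "inj \<sigma>" "A \<subseteq> U" "w \<in> U"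
  shows "card {x \<in> \<sigma> ` A. x < \<sigma> w} = lows f A w" "card {x \<in> \<sigma> ` A. \<sigma> w < x} = highs f A w"
proof -
  have "{x \<in> \<sigma> ` A. x < \<sigma> w} = \<sigma> ` {x \<in> A. f x < f w}" "{x \<in> \<sigma> ` A. \<sigma> w < x} = \<sigma> ` {x \<in> A. f w < f x}"
    using assms by (auto simp: subset_iff)
  moreover have "inj_on \<sigma> S" for S using assms(2) by (rule inj_on_subset) simp
  ultimately show "card {x \<in> \<sigma> ` A. x < \<sigma> w} = lows f A w" "card {x \<in> \<sigma> ` A. \<sigma> w < x} = highs f A w"
    unfolding lows_def highs_def by (simp_all add: card_image)
qed

text \<open>A vertex in position \<open>i\<close> of a facet has \<open>i - 1\<close> facet vertices
  below and \<open>m - i\<close> above it. A coincidence would make \<open>lows\<close> in one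
  clique plus \<open>highs\<close> in the other at least \<open>m - 1\<close>, both ways
  round.\<close>

lemma enum_neq_if_apart:
  assumes \<sigma>: "\<And>x y. x \<in> U \<Longrightarrow> y \<in> U \<Longrightarrow> \<sigma> x < \<sigma> y \<longleftrightarrow> f x < f y" "inj \<sigma>"
    and AB: "A \<subseteq> U" "B \<subseteq> U" "finite A" "finite B" "\<And>w. w \<in> A \<inter> B \<Longrightarrow> apart m f A B w"
    and F: "F \<subseteq> \<sigma> ` A" "card F = m" and G: "G \<subseteq> \<sigma> ` B" "card G = m" and i: "i \<in> {1..m}"
  shows "enum F i \<noteq> enum G i"
proof
  assume eq: "enum F i = enum G i"
  have fin: "finite F" "finite G" using F(1) G(1) AB(3,4) by (auto intro: finite_subset)
  have "enum F i \<in> \<sigma> ` A" using enum_in[OF fin(1), of i] F i by auto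
  moreover have "enum F i \<in> \<sigma> ` B" using enum_in[OF fin(2), of i] G i eq by auto
  ultimately obtain w w' where ww: "enum F i = \<sigma> w" "w \<in> A" "enum F i = \<sigma> w'" "w' \<in> B" by blast
  then have "w = w'" using injD[OF \<sigma>(2), of w w'] by simp
  then have w: "enum F i = \<sigma> w" "w \<in> A" "w \<in> B" using ww by auto
  have low: "i - 1 \<le> lows f D w" and high: "m - i \<le> highs f D w"
    if D: "D \<subseteq> U" "finite D" "w \<in> D" and H: "H \<subseteq> \<sigma> ` D" "card H = m" "enum H i = \<sigma> w" for D H
  proof -
    have wU: "w \<in> U" using D by blast
    have fH: "finite H" using H(1) D(2) by (auto intro: finite_subset)
    have "i - 1 = card {x \<in> H. x < \<sigma> w}" "m - i = card {x \<in> H. \<sigma> w < x}"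
      using card_less_enum[OF fH, of i] H(2,3) i by auto
    moreover have "card {x \<in> H. x < \<sigma> w} \<le> card {x \<in> \<sigma> ` D. x < \<sigma> w}"
      "card {x \<in> H. \<sigma> w < x} \<le> card {x \<in> \<sigma> ` D. \<sigma> w < x}"
      using H(1) D(2) by (auto intro!: card_mono)
    ultimately show "i - 1 \<le> lows f D w" "m - i \<le> highs f D w"
      using lows_highs_relabel[of U \<sigma> f D w, OF \<sigma> D(1) wU] by auto
  qed
  have "apart m f A B w" using AB(5) w by blast
  moreover have "i - 1 \<le> lows f A w" "m - i \<le> highs f A w" "i - 1 \<le> lows f B w" "m - i \<le> highs f B w"
    using low[of A F] high[of A F] low[of B G] high[of B G] AB F G w eq by auto
  ultimately show False using i unfolding apart_def by auto
qed

section \<open>From the graph of cliques to successive attachments\<close>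

lemma simple_path_exists:
  assumes "(\<lambda>x y. x \<in> V \<and> y \<in> V \<and> E x y)\<^sup>*\<^sup>* a b" "a \<in> V"
  shows "\<exists>vs. vs \<noteq> [] \<and> hd vs = a \<and> last vs = b \<and> distinct vs \<and> set vs \<subseteq> V \<and> successively E vs"
  using assms
proof (induction rule: converse_rtranclp_induct)
  case base
  then show ?case by (intro exI[of _ "[b]"]) simp
next
  case (step a c)
  then obtain vs where vs: "vs \<noteq> []" "hd vs = c" "last vs = b" "distinct vs" "set vs \<subseteq> V" "successively E vs"
    by blast
  show ?case
  proof (cases "a \<in> set vs")
    case True
    then obtain ys zs where yz: "vs = ys @ a # zs" by (meson split_list)
    show ?thesis
      by (intro exI[of _ "a # zs"]) (use vs in \<open>auto simp: yz successively_append_iff\<close>)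
  next
    case False
    then show ?thesis
      by (intro exI[of _ "a # vs"]) (use vs step in \<open>auto simp: successively_Cons\<close>)
  qed
qed

lemma path_leaves_set:
  assumes "(\<lambda>x y. x \<in> V \<and> y \<in> V \<and> E x y)\<^sup>*\<^sup>* a b" "a \<in> S" "b \<notin> S"
  shows "\<exists>x y. x \<in> S \<and> y \<in> V \<and> y \<notin> S \<and> E x y"
  using assms by (induction rule: converse_rtranclp_induct) blast+

text \<open>Grow a set of cliques along edges. If a new clique met two members, a simple path
  joining them inside the set would close up to a cycle through the new clique; hence connectivity
  within the set is part of the invariant.\<close>

lemma tree_family_of_tree:
  fixes V :: "'v set set"
  defines "E \<equiv> \<lambda>A B. A \<in> V \<and> B \<in> V \<and> A \<noteq> B \<and> A \<inter> B \<noteq> {}"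
  assumes tree: "is_tree V E" and R: "R \<in> V"
    and meet: "\<And>A B. A \<in> V \<Longrightarrow> B \<in> V \<Longrightarrow> A \<noteq> B \<Longrightarrow> finite A \<and> card (A \<inter> B) \<le> 1"
  shows "tree_family R V"
proof -
  have fV: "finite V" and conn: "\<And>A B. A \<in> V \<Longrightarrow> B \<in> V \<Longrightarrow> (\<lambda>x y. x \<in> V \<and> y \<in> V \<and> E x y)\<^sup>*\<^sup>* A B"
    and acyc: "\<not> has_cycle V E"
    using tree by (auto simp: is_tree_def)
  have symE: "E A B \<longleftrightarrow> E B A" for A B by (auto simp: E_def)
  let ?P = "\<lambda>S x y. x \<in> S \<and> y \<in> S \<and> E x y"
  have symP: "(?P S)\<^sup>*\<^sup>* x y" if "(?P S)\<^sup>*\<^sup>* y x" for S x y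
    using that
  proof (induction rule: rtranclp_induct)
    case (step u w)
    then have "?P S w u" using symE by blast
    then show ?case using step.IH by (rule converse_rtranclp_into_rtranclp)
  qed simp
  have "\<exists>S\<subseteq>V. card S = Suc k \<and> tree_family R S \<and> (\<forall>A\<in>S. (?P S)\<^sup>*\<^sup>* R A)" if "Suc k \<le> card V" for k
    using that
  proof (induction k)
    case 0
    show ?case by (intro exI[of _ "{R}"]) (use R tree_family.root in auto)
  next
    case (Suc k)
    then obtain S where S: "S \<subseteq> V" "card S = Suc k" "tree_family R S" "\<And>A. A \<in> S \<Longrightarrow> (?P S)\<^sup>*\<^sup>* R A"
      by auto
    have fS: "finite S" using S(1) fV by (rule finite_subset)
    have RS: "R \<in> S" by (rule tree_family_root[OF S(3)])
    have "S \<noteq> V" using S(2) Suc.prems by auto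
    then obtain B where B: "B \<in> V" "B \<notin> S" using S(1) by blast
    obtain A C where AC: "A \<in> S" "C \<in> V" "C \<notin> S" "E A C"
      using path_leaves_set[OF conn[OF R B(1)] RS B(2)] by blast
    have AV: "A \<in> V" "A \<noteq> C" "A \<inter> C \<noteq> {}" using AC(4) by (auto simp: E_def)
    have "card (C \<inter> A) \<le> 1" "finite (C \<inter> A)" using meet[OF AC(2) AV(1)] AV(2) by auto
    then have "card (C \<inter> A) = 1" using AV(3) by (metis Int_commute card_0_eq le_antisym less_one not_le)
    then obtain v where v: "C \<inter> A = {v}" by (auto simp: card_1_singleton_iff)
    have other: "C \<inter> D = {}" if D: "D \<in> S" "D \<noteq> A" for D
    proof (rule ccontr)
      assume ne: "C \<inter> D \<noteq> {}"
      have ECD: "E D C" using ne D(1) S(1) AC(2,3) by (auto simp: E_def)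
      have "(?P S)\<^sup>*\<^sup>* A D" using symP[OF S(4)[OF AC(1)]] S(4)[OF D(1)] by (rule rtranclp_trans)
      from simple_path_exists[OF this AC(1)]
      obtain vs where vs: "vs \<noteq> []" "hd vs = A" "last vs = D" "distinct vs" "set vs \<subseteq> S" "successively E vs"
        by blast
      \<comment> \<open>The ends \<open>A\<close> and \<open>D\<close> differ, so together with
        \<open>C\<close> the path has the three vertices that a cycle requires.\<close>
      have "2 \<le> length vs" using vs(1-3) D(2) by (cases vs; cases "tl vs") auto
      then have "3 \<le> length (C # vs)" by simp
      moreover have "distinct (C # vs)" "set (C # vs) \<subseteq> V" using vs(4,5) AC(2,3) S(1) by auto
      moreover have "successively E (C # vs)" using vs(1,2,6) AC(4) symE by (auto simp: successively_Cons)
      then have "\<forall>i. Suc i < length (C # vs) \<longrightarrow> E ((C # vs) ! i) ((C # vs) ! Suc i)"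
        by (simp only: successively_conv_nth)
      moreover have "E (last (C # vs)) (hd (C # vs))" using ECD vs(1,3) by simp
      ultimately have "has_cycle V E" unfolding has_cycle_def by blast
      then show False using acyc by blast
    qed
    have tf: "tree_family R (insert C S)"
      by (rule tree_family.attach[OF S(3) AC(1,3) v other])
    have mono: "(?P (insert C S))\<^sup>*\<^sup>* x y" if "(?P S)\<^sup>*\<^sup>* x y" for x y
      using that by (rule rtranclp_mono[THEN predicate2D, rotated]) blast
    have "(?P (insert C S))\<^sup>*\<^sup>* R D" if "D \<in> insert C S" for D
    proof (cases "D = C")
      case True
      have "(?P (insert C S))\<^sup>*\<^sup>* R A" by (rule mono[OF S(4)[OF AC(1)]])
      moreover have "?P (insert C S) A C" using AC(1,4) by blast
      ultimately show ?thesis unfolding True by (rule rtranclp.rtrancl_into_rtrancl)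
    next
      case False
      then show ?thesis using mono[OF S(4)] that by blast
    qed
    moreover have "card (insert C S) = Suc (Suc k)" using fS AC(3) S(2) by simp
    ultimately show ?case using tf S(1) AC(2) by (intro exI[of _ "insert C S"]) auto
  qed
  moreover have "0 < card V" using fV R by (auto simp: card_gt_0_iff)
  ultimately obtain S where "S \<subseteq> V" "card S = card V" "tree_family R S"
    by (metis Suc_pred order_refl)
  then show ?thesis using card_subset_eq[OF fV] by blast
qed

lemma chains_disjoint_if_apart:
  assumes \<sigma>: "\<And>x y. x \<in> U \<Longrightarrow> y \<in> U \<Longrightarrow> \<sigma> x < \<sigma> y \<longleftrightarrow> f x < f y" "inj \<sigma>"
    and AB: "A \<subseteq> U" "B \<subseteq> U" "finite A" "finite B" "\<And>w. w \<in> A \<inter> B \<Longrightarrow> apart m f A B w"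
    and s: "s \<in> chains m (\<sigma> ` A)" and t: "t \<in> chains m (\<sigma> ` B)"
  shows "keys s \<inter> keys t = {}"
proof -
  obtain F G where F: "s = cells {1..m} (enum F)" "F \<subseteq> \<sigma> ` A" "card F = m"
    and G: "t = cells {1..m} (enum G)" "G \<subseteq> \<sigma> ` B" "card G = m"
    using s t unfolding chains_def by blast
  have "enum F i \<noteq> enum G i" if "i \<in> {1..m}" for i
    by (rule enum_neq_if_apart[where U = U and f = f and \<sigma> = \<sigma> and A = A and B = B and m = m])
      (use \<sigma> AB F(2,3) G(2,3) that in blast)+
  then show ?thesis unfolding F(1) G(1) by (auto simp: keys_cells)
qed

lemma minors_ideal_empty: "minors_ideal n m {} = {0}"
  by (auto simp: minors_ideal_def facets_def ideal_gen_def)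

text \<open>Re-rooting the old tree at \<open>A\<close> allows \<open>v\<close> to be the top of
  \<open>A\<close>; extending upwards makes \<open>v\<close> the bottom of \<open>C\<close>.
  Primality is carried to these labels for the old cliques and carried back for the enlarged
  family.\<close>

lemma prime_tree_family:
  assumes "tree_family R \<C>" and \<C>: "\<And>A. A \<in> \<C> \<Longrightarrow> A \<subseteq> {1..n} \<and> m \<le> card A" and m: "3 \<le> m"
    and card: "\<And>A. A \<in> \<C> \<Longrightarrow> card (S \<inter> A) \<le> 2 * (m - 1)"
    and S: "\<And>A B. A \<in> \<C> \<Longrightarrow> B \<in> \<C> \<Longrightarrow> A \<noteq> B \<Longrightarrow> A \<inter> B \<subseteq> S"
  shows "prime_ideal_in (polys_in ({1..m} \<times> {1..n})) (minors_ideal n m \<C> :: 'a::field mpoly set)"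
  using assms(1,2,4,5)
proof (induction rule: tree_family.induct)
  case (root R)
  have m2: "2 \<le> m" using m by simp
  \<comment> \<open>A single clique is attached to the empty family, whose ideal is 0.\<close>
  show ?case
  proof (rule prime_attach_clique[OF _ m2])
    show "groebner ({1..m} \<times> {1..n}) (minors_ideal n m {R} :: 'a mpoly set) (\<Union>A\<in>{R}. chains m A)"
      by (rule groebner_family[OF _ _ m2]) (use root in auto)
    show "prime_ideal_in (polys_in ({1..m} \<times> {1..n})) (minors_ideal n m {} :: 'a mpoly set)"
      unfolding minors_ideal_empty by (rule prime_zero_ideal)
  qed (use root in auto)
next
  case (attach R \<C> A C v)
  let ?B = "{1..m} \<times> {1..n}"
  have m2: "2 \<le> m" using m by simp
  have sub: "D \<subseteq> {1..n}" if "D \<in> insert C \<C>" for D using attach.prems(1)[OF that] by blast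
  have finD: "finite D" if "D \<in> insert C \<C>" for D using sub[OF that] by (rule finite_subset) simp
  have IH: "prime_ideal_in (polys_in ?B) (minors_ideal n m \<C> :: 'a mpoly set)"
    by (rule attach.IH) (use attach.prems in auto)
  have tfA: "tree_family A \<C>" by (rule tree_family_reroot[OF attach.hyps(1,2)])
  have fin\<C>: "finite \<C>" using attach.hyps(1) by (induction rule: tree_family.induct) auto
  have vA: "v \<in> A" "v \<in> C" using attach.hyps(4) by auto
  have AC: "A \<noteq> C" using attach.hyps(2,3) by blast
  have vS: "v \<in> S" using attach.prems(3)[of A C] attach.hyps(2) AC vA by blast
  have "insert v (S \<inter> A) = S \<inter> A" using vS vA by blast
  then have cv: "card (insert v (S \<inter> A)) \<le> 2 * (m - 1)" using attach.prems(2)[of A] attach.hyps(2) by simp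
  have "\<exists>f :: nat \<Rightarrow> int. inj_on f (\<Union>\<C>) \<and> (\<forall>x\<in>A - {v}. f x < f v)
    \<and> (\<forall>A\<in>\<C>. \<forall>w\<in>S \<inter> A. peripheral m f A w)
    \<and> (\<forall>A\<in>\<C>. \<forall>B\<in>\<C>. \<forall>w\<in>A \<inter> B. A \<noteq> B \<longrightarrow> apart m f A B w)"
    by (rule tree_labelling[OF tfA _ _ _ vA(1) cv m2]) (use finD attach.prems in auto)
  then obtain f0 :: "nat \<Rightarrow> int" where f0: "inj_on f0 (\<Union>\<C>)" "\<forall>x\<in>A - {v}. f0 x < f0 v"
    "\<forall>A\<in>\<C>. \<forall>B\<in>\<C>. \<forall>w\<in>A \<inter> B. A \<noteq> B \<longrightarrow> apart m f0 A B w"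
    by (elim exE conjE)
  have fU: "finite (\<Union>\<C>)" using fin\<C> finD by auto
  have CU: "C \<inter> \<Union>\<C> = {v}" using attach.hyps(2,4,5) by blast
  \<comment> \<open>The set \<open>P\<close> is empty here: no further clique is attached to
    \<open>C\<close> under this labelling, so no end places have to be reserved in it.\<close>
  have "\<exists>f'. (\<forall>x\<in>\<Union>\<C>. f' x = f0 x) \<and> inj_on f' (\<Union>\<C> \<union> C) \<and> (\<forall>x\<in>\<Union>\<C>. \<forall>c\<in>C - {v}. f' x < f' c)
    \<and> (\<forall>x\<in>{}. peripheral m f' C x)"
    by (rule extend_upwards[OF fU f0(1) _ CU _ _ m2]) (use finD in auto)
  then obtain f where f: "\<forall>x\<in>\<Union>\<C>. f x = f0 x" "inj_on f (\<Union>\<C> \<union> C)" "\<forall>x\<in>\<Union>\<C>. \<forall>c\<in>C - {v}. f x < f c"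
    by (elim exE conjE)
  have vU: "v \<in> \<Union>\<C>" using vA(1) attach.hyps(2) by blast
  have Aful: "A \<subseteq> \<Union>\<C>" using attach.hyps(2) by blast
  let ?U = "\<Union>\<C> \<union> C"
  have Un: "?U \<subseteq> {1..n}" using sub by blast
  obtain \<sigma> where \<sigma>: "\<sigma> permutes {1..n}" "\<forall>x\<in>?U. \<forall>y\<in>?U. \<sigma> x < \<sigma> y \<longleftrightarrow> f x < f y"
    using relabelling[OF f(2) Un] by blast
  have inj: "inj \<sigma>" by (rule permutes_inj[OF \<sigma>(1)])
  have ord: "\<sigma> x < \<sigma> y \<longleftrightarrow> f x < f y" if "x \<in> ?U" "y \<in> ?U" for x y using \<sigma>(2) that by blast
  have topv: "f x < f v" if "x \<in> A - {v}" for x using f0(2) f(1) that vU Aful by auto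
  have highA: "highs f A v = 0"
  proof -
    have "\<not> f v < f x" if "x \<in> A" for x using topv[of x] that by (cases "x = v") auto
    then have "{x \<in> A. f v < f x} = {}" by blast
    then show ?thesis by (simp only: highs_def card.empty)
  qed
  have lowC: "lows f C v = 0"
    by (rule lows_lowest[OF vA(2)]) (use f(3) vU in blast)
  have only: "D = A \<and> x = v" if "D \<in> \<C>" "x \<in> C" "x \<in> D" for D x
    using that attach.hyps(4) attach.hyps(5)[of D] by blast
  have apart: "apart m f D D' w"
    if D: "D \<in> insert C \<C>" "D' \<in> insert C \<C>" "D \<noteq> D'" "w \<in> D \<inter> D'" for D D' w
  proof -
    have CA: "apart m f A C v" using highA lowC m2 by (simp add: apart_def)
    consider "D \<in> \<C>" "D' \<in> \<C>" | "D = C" "D' \<in> \<C>" | "D \<in> \<C>" "D' = C" using D(1-3) by blast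
    then show ?thesis
    proof cases
      case 1
      have "apart m f0 D D' w" using f0(3) 1 D(3,4) by blast
      moreover have "lows f E w = lows f0 E w \<and> highs f E w = highs f0 E w" if "E \<in> \<C>" "w \<in> E" for E
      proof -
        have "f x = f0 x" if "x \<in> E" for x using f(1) that \<open>E \<in> \<C>\<close> by blast
        then show ?thesis using lows_highs_cong[of E f f0 w] \<open>w \<in> E\<close> by blast
      qed
      ultimately show ?thesis using 1 D(4) by (simp add: apart_def)
    next
      case 2
      then have "D' = A \<and> w = v" using only[of D' w] D(4) by blast
      then show ?thesis using CA 2(1) apart_commute[of m f A C v] by simp
    next
      case 3
      then have "D = A \<and> w = v" using only[of D w] D(4) by blast
      then show ?thesis using CA 3(2) by simp
    qed
  qed
  have DU: "D \<subseteq> ?U" if "D \<in> insert C \<C>" for D using that by blast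
  let ?\<D> = "(`) \<sigma> ` \<C>"
  have img: "(`) \<sigma> ` insert C \<C> = insert (\<sigma> ` C) ?\<D>" by simp
  have subD: "D \<subseteq> {1..n}" if D: "D \<in> insert (\<sigma> ` C) ?\<D>" for D
  proof -
    obtain D0 where "D = \<sigma> ` D0" "D0 \<in> insert C \<C>" using D by blast
    then show ?thesis using image_mono[OF sub[of D0], of \<sigma>] permutes_image[OF \<sigma>(1)] by simp
  qed
  have gb: "groebner ?B (minors_ideal n m (insert (\<sigma> ` C) ?\<D>) :: 'a mpoly set) (\<Union>A\<in>insert (\<sigma> ` C) ?\<D>. chains m A)"
  proof (rule groebner_family[OF _ subD m2])
    show "finite (insert (\<sigma> ` C) ?\<D>)" using fin\<C> by simp
    fix D D' s t assume D: "D \<in> insert (\<sigma> ` C) ?\<D>" "D' \<in> insert (\<sigma> ` C) ?\<D>" "D \<noteq> D'"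
      "s \<in> chains m D" "t \<in> chains m D'"
    obtain D0 D1 where D0: "D = \<sigma> ` D0" "D0 \<in> insert C \<C>" and D1: "D' = \<sigma> ` D1" "D1 \<in> insert C \<C>"
      using D(1,2) by blast
    have ne: "D0 \<noteq> D1" using D(3) D0(1) D1(1) by blast
    show "keys s \<inter> keys t = {}"
      by (rule chains_disjoint_if_apart[OF ord inj DU[OF D0(2)] DU[OF D1(2)] finD[OF D0(2)] finD[OF D1(2)]
            apart[OF D0(2) D1(2) ne] D(4)[unfolded D0(1)] D(5)[unfolded D1(1)]])
  qed
  have fC: "finite C" using finD by blast
  have e1: "enum (\<sigma> ` C) 1 = \<sigma> v"
  proof (rule enum_eqI)
    have "card {x \<in> \<sigma> ` C. x < \<sigma> v} = lows f C v"
      by (rule lows_highs_relabel(1)[where U = ?U, OF ord inj]) (use vA in auto)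
    then show "card {x \<in> \<sigma> ` C. x < \<sigma> v} = 1 - 1" using lowC by simp
  qed (use fC vA in auto)
  have prime\<D>: "prime_ideal_in (polys_in ?B) (minors_ideal n m ?\<D> :: 'a mpoly set)"
  proof (rule prime_relabel[OF _ permutes_inv[OF \<sigma>(1)]])
    show "D \<subseteq> {1..n}" if "D \<in> ?\<D>" for D using subD that by blast
    have "(`) (inv \<sigma>) ` ?\<D> = \<C>" using inj by (simp add: image_image image_inv_f_f)
    then show "prime_ideal_in (polys_in ?B) (minors_ideal n m ((`) (inv \<sigma>) ` ?\<D>) :: 'a mpoly set)"
      using IH by simp
  qed
  have P: "prime_ideal_in (polys_in ?B) (minors_ideal n m (insert (\<sigma> ` C) ?\<D>) :: 'a mpoly set)"
  proof (rule prime_attach_clique[OF subD m2 _ gb _ _ prime\<D>])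
    show "m \<le> card (\<sigma> ` C)"
      using attach.prems(1)[of C] card_image[of \<sigma> C] inj_on_subset[OF inj] by simp
    show "x = enum (\<sigma> ` C) 1" if x: "D \<in> ?\<D>" "x \<in> D" "x \<in> \<sigma> ` C" for D x
    proof -
      obtain D0 y z where y: "D0 \<in> \<C>" "x = \<sigma> y" "y \<in> D0" "x = \<sigma> z" "z \<in> C" using x by blast
      then have "y = z" using injD[OF inj, of y z] by simp
      then show ?thesis using only[of D0 y] y e1 by simp
    qed
    show "(2, enum (\<sigma> ` C) 1) \<notin> keys t" if t: "D \<in> ?\<D>" "t \<in> chains m D" for D t
    proof
      assume "(2, enum (\<sigma> ` C) 1) \<in> keys t"
      moreover obtain F where F: "t = cells {1..m} (enum F)" "F \<subseteq> D" "card F = m"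
        using t(2) unfolding chains_def by blast
      ultimately have e2: "enum F 2 = \<sigma> v" unfolding e1 by (simp add: keys_cells)
      obtain D0 where D0: "D0 \<in> \<C>" "D = \<sigma> ` D0" using t(1) by blast
      have fF: "finite F" using F(2) D0 finD[of D0] by (auto intro: finite_subset)
      have "\<sigma> v \<in> \<sigma> ` D0" using enum_in[OF fF, of 2] e2 F(2,3) D0(2) m by auto
      then have "v \<in> D0" using inj by (auto dest: injD)
      then have DA: "D0 = A" using only[OF D0(1) vA(2)] by blast
      \<comment> \<open>Here \<open>m \<ge> 3\<close> is essential: a facet with \<open>v\<close> in
        position 2 would have a third vertex, lying in \<open>A\<close> above its top vertex
        \<open>v\<close>.\<close>
      have "enum F 3 \<in> \<sigma> ` A" using enum_in[OF fF, of 3] F(2,3) D0(2) DA m by auto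
      then obtain y where y: "y \<in> A" "enum F 3 = \<sigma> y" by blast
      have "\<sigma> v < \<sigma> y" using enum_mono[OF fF, of 2 3] e2 y(2) F(3) m by simp
      then have "f v < f y" using ord[of v y] vU y(1) Aful by blast
      then show False using topv[of y] y(1) by (cases "y = v") auto
    qed
  qed
  show ?case by (rule prime_relabel[OF _ \<sigma>(1) P[folded img]]) (rule sub)
qed

section \<open>Closed determinantal facet ideals\<close>

locale clique_tree =
  fixes n m :: nat and Fs :: "nat set set"
  assumes pure: "pure_complex n m Fs" and m: "m - 1 \<ge> 2"
    and cond1: "cond_i n m Fs" and cond2: "cond_ii n m Fs"
    and tree: "is_tree (cliques n m Fs) (G_adj n m Fs)"
begin

abbreviation "\<K> \<equiv> cliques n m Fs"

definition shared :: "nat set" where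
  "shared = {x. \<exists>A\<in>\<K>. \<exists>B\<in>\<K>. A \<noteq> B \<and> x \<in> A \<inter> B}"

lemma clique_simplexD:
  assumes "A \<in> \<K>"
  shows "A \<subseteq> {1..n}" "finite A" "m \<le> card A" "\<And>F. F \<subseteq> A \<Longrightarrow> card F = m \<Longrightarrow> F \<in> Fs"
  using assms unfolding cliques_def clique_simplex_def by (auto intro: finite_subset)

lemma clique_simplex_in_clique:
  assumes "clique_simplex n m Fs W" shows "\<exists>A\<in>\<K>. W \<subseteq> A"
proof -
  have "finite {W. clique_simplex n m Fs W}"
    by (rule finite_subset[of _ "Pow {1..n}"]) (auto simp: clique_simplex_def)
  from finite_has_maximal2[OF this, of W] assms
  obtain A where "clique_simplex n m Fs A" "W \<subseteq> A" "\<And>W'. clique_simplex n m Fs W' \<Longrightarrow> A \<subseteq> W' \<Longrightarrow> A = W'"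
    by auto
  then show ?thesis unfolding cliques_def by blast
qed

text \<open>Every facet is a clique simplex and so lies in a maximal one. This identifies
  \<open>J_Delta\<close> with the ideal of the family of cliques.\<close>

lemma facets_cliques: "facets m \<K> = Fs"
proof (intro set_eqI iffI)
  fix F assume "F \<in> facets m \<K>"
  then show "F \<in> Fs" using clique_simplexD(4) by (auto simp: facets_def)
next
  fix F assume F: "F \<in> Fs"
  then have c: "F \<subseteq> {1..n}" "card F = m" using pure by (auto simp: pure_complex_def)
  have fF: "finite F" using c(1) by (rule finite_subset) simp
  have "clique_simplex n m Fs F"
    unfolding clique_simplex_def using c F card_subset_eq[OF fF] by auto
  then show "F \<in> facets m \<K>" using clique_simplex_in_clique c(2) by (auto simp: facets_def)
qed

lemma same_clique:
  assumes "A \<in> \<K>" "B \<in> \<K>" "F \<subseteq> A" "F \<subseteq> B" "card F = m" shows "A = B"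
proof (rule ccontr)
  assume "A \<noteq> B"
  then have "card (A \<inter> B) \<le> 1" using cond1 assms(1,2) unfolding cond_i_def by blast
  moreover have "card F \<le> card (A \<inter> B)"
    using assms clique_simplexD(2)[OF assms(1)] by (intro card_mono) auto
  ultimately show False using assms(5) m by linarith
qed

lemma adjacent_unique:
  assumes "A \<in> \<K>" "B \<in> \<K>" "A \<noteq> B" "x \<in> A" "x \<in> B" "y \<in> A" "y \<in> B" shows "x = y"
proof (rule ccontr)
  assume "x \<noteq> y"
  then have "card {x, y} = 2" by simp
  moreover have "card {x, y} \<le> card (A \<inter> B)"
    using assms clique_simplexD(2)[OF assms(1)] by (intro card_mono) auto
  moreover have "card (A \<inter> B) \<le> 1" using cond1 assms(1-3) unfolding cond_i_def by blast
  ultimately show False by linarith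
qed

text \<open>By (i) a neighbour meets \<open>A\<close> in a single vertex, and by (ii) different
  neighbours meet \<open>A\<close> in different vertices.\<close>

lemma degree_eq_card_shared:
  assumes A: "A \<in> \<K>" shows "G_degree n m Fs A = card (shared \<inter> A)"
proof -
  define N where "N = {B. G_adj n m Fs A B}"
  have mem: "B \<in> N \<longleftrightarrow> B \<in> \<K> \<and> A \<noteq> B \<and> A \<inter> B \<noteq> {}" for B
    using A by (auto simp: N_def G_adj_def)
  define g where "g B = (THE x. x \<in> A \<inter> B)" for B
  have g: "g B = x" if "B \<in> N" "x \<in> A" "x \<in> B" for B x
    unfolding g_def using that mem[of B] adjacent_unique[OF A, of B] by (intro the_equality) auto
  have "bij_betw g N (shared \<inter> A)"
    unfolding bij_betw_def
  proof
    show "inj_on g N"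
    proof (rule inj_onI)
      fix B C assume BC: "B \<in> N" "C \<in> N" "g B = g C"
      have nb: "B \<in> \<K>" "A \<noteq> B" "A \<inter> B \<noteq> {}" "C \<in> \<K>" "A \<noteq> C" "A \<inter> C \<noteq> {}"
        using BC(1,2) mem[of B] mem[of C] by blast+
      then obtain x y where x: "x \<in> A" "x \<in> B" and y: "y \<in> A" "y \<in> C" by blast
      have "x = y" using g[OF BC(1) x] g[OF BC(2) y] BC(3) by simp
      show "B = C"
      proof (rule ccontr)
        assume "B \<noteq> C"
        then have "A \<inter> B \<inter> C = {}"
          using cond2 A nb(1,2,4,5) unfolding cond_ii_def by blast
        then show False using x y \<open>x = y\<close> by blast
      qed
    qed
    show "g ` N = shared \<inter> A"
    proof (intro equalityI subsetI)
      fix y assume "y \<in> g ` N"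
      then obtain B where B: "B \<in> N" "y = g B" by blast
      obtain x where x: "x \<in> A" "x \<in> B" using B(1) mem[of B] by blast
      have "y = x" using g[OF B(1) x] B(2) by simp
      then show "y \<in> shared \<inter> A" using x A B(1) mem[of B] by (auto simp: shared_def)
    next
      fix x assume x: "x \<in> shared \<inter> A"
      then obtain C D where CD: "C \<in> \<K>" "D \<in> \<K>" "C \<noteq> D" "x \<in> C" "x \<in> D" by (auto simp: shared_def)
      obtain B where B: "B \<in> \<K>" "A \<noteq> B" "x \<in> B" using CD by metis
      then have "B \<in> N" using mem[of B] x by blast
      then show "x \<in> g ` N" using g[of B x] x B(3) by (intro image_eqI[of _ _ B]) auto
    qed
  qed
  then show ?thesis unfolding G_degree_def N_def by (rule bij_betw_same_card)
qed

lemma tree_family_cliques: "R \<in> \<K> \<Longrightarrow> tree_family R \<K>"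
proof (rule tree_family_of_tree)
  have "G_adj n m Fs = (\<lambda>A B. A \<in> \<K> \<and> B \<in> \<K> \<and> A \<noteq> B \<and> A \<inter> B \<noteq> {})"
    by (simp add: fun_eq_iff G_adj_def)
  then show "is_tree \<K> (\<lambda>A B. A \<in> \<K> \<and> B \<in> \<K> \<and> A \<noteq> B \<and> A \<inter> B \<noteq> {})" using tree by simp
  show "finite A \<and> card (A \<inter> B) \<le> 1" if "A \<in> \<K>" "B \<in> \<K>" "A \<noteq> B" for A B
    using that cond1 clique_simplexD(2) unfolding cond_i_def by blast
qed

lemma shared_supset: "A \<in> \<K> \<Longrightarrow> B \<in> \<K> \<Longrightarrow> A \<noteq> B \<Longrightarrow> A \<inter> B \<subseteq> shared"
  by (auto simp: shared_def)

text \<open>The origin of the bound \<open>2 * (m - 1)\<close>: there are \<open>m - 1\<close>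
  places at either end of a clique.\<close>

lemma card_extremal:
  fixes A :: "nat set"
  assumes "finite A"
  shows "card {w \<in> A. card {x \<in> A. x < w} + 2 \<le> m} \<le> m - 1"
    "card {w \<in> A. card {x \<in> A. w < x} + 2 \<le> m} \<le> m - 1"
proof -
  have "{w \<in> A. card {x \<in> A. x < w} + 2 \<le> m} \<subseteq> enum A ` {1..m - 1}"
  proof
    fix w assume w: "w \<in> {w \<in> A. card {x \<in> A. x < w} + 2 \<le> m}"
    then obtain i where i: "i \<in> {1..card A}" "w = enum A i" using enum_inverse[OF assms] by blast
    then have "i \<in> {1..m - 1}" using w card_less_enum(1)[OF assms i(1)] by auto
    then show "w \<in> enum A ` {1..m - 1}" using i(2) by blast
  qed
  then have "card {w \<in> A. card {x \<in> A. x < w} + 2 \<le> m} \<le> card {1..m - 1}"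
    by (rule surj_card_le[rotated]) simp
  then show "card {w \<in> A. card {x \<in> A. x < w} + 2 \<le> m} \<le> m - 1" by simp
  have "{w \<in> A. card {x \<in> A. w < x} + 2 \<le> m} \<subseteq> (\<lambda>k. enum A (card A - k)) ` {..<m - 1}"
  proof
    fix w assume w: "w \<in> {w \<in> A. card {x \<in> A. w < x} + 2 \<le> m}"
    then obtain i where i: "i \<in> {1..card A}" "w = enum A i" using enum_inverse[OF assms] by blast
    then have "card A - i \<in> {..<m - 1}" using w card_less_enum(2)[OF assms i(1)] by auto
    moreover have "w = enum A (card A - (card A - i))" using i by simp
    ultimately show "w \<in> (\<lambda>k. enum A (card A - k)) ` {..<m - 1}" by blast
  qed
  then have "card {w \<in> A. card {x \<in> A. w < x} + 2 \<le> m} \<le> card {..<m - 1}"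
    by (rule surj_card_le[rotated]) simp
  then show "card {w \<in> A. card {x \<in> A. w < x} + 2 \<le> m} \<le> m - 1" by simp
qed

text \<open>A shared vertex with \<open>m - 1\<close> vertices of \<open>A\<close> on either side
  can stand in any row of a facet of \<open>A\<close>, in particular in the row it occupies in some
  facet of a second clique \<open>B\<close>. Closedness would make the union of the two facets a
  clique simplex, and (i) would force \<open>A = B\<close>.\<close>

lemma closed_degree:
  assumes closed: "is_closed n m Fs" and A: "A \<in> \<K>"
  shows "card (shared \<inter> A) \<le> 2 * (m - 1)"
proof -
  obtain \<sigma> where \<sigma>: "bij_betw \<sigma> {1..n} {1..n}" and cl: "closed_wrt m ((`) \<sigma> ` Fs)"
    using closed unfolding is_closed_def by blast
  have inj: "inj_on \<sigma> {1..n}" using \<sigma> by (simp add: bij_betw_def)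
  have An: "A \<subseteq> {1..n}" and fA: "finite A" using clique_simplexD[OF A] by auto
  have pull: "H \<in> Fs" if H: "\<sigma> ` H \<in> (`) \<sigma> ` Fs" "H \<subseteq> {1..n}" for H
  proof -
    obtain H' where H': "H' \<in> Fs" "\<sigma> ` H = \<sigma> ` H'" using H(1) by blast
    then have "H' \<subseteq> {1..n}" using pure by (auto simp: pure_complex_def)
    then have "H = H'" using inj_on_image_eq_iff[OF inj H(2)] H'(2) by blast
    then show ?thesis using H'(1) by simp
  qed
  have ext: "card {x \<in> \<sigma> ` A. x < \<sigma> w} + 2 \<le> m \<or> card {x \<in> \<sigma> ` A. \<sigma> w < x} + 2 \<le> m"
    if w: "w \<in> shared \<inter> A" for w
  proof (rule ccontr)
    assume neg: "\<not> ?thesis"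
    obtain C D where CD: "C \<in> \<K>" "D \<in> \<K>" "C \<noteq> D" "w \<in> C" "w \<in> D" using w by (auto simp: shared_def)
    obtain B where B: "B \<in> \<K>" "A \<noteq> B" "w \<in> B" using CD by metis
    note Bc = clique_simplexD[OF B(1)]
    obtain G0 where G0: "G0 \<subseteq> B - {w}" "card G0 = m - 1"
      using obtain_subset_with_card_n[of "m - 1" "B - {w}"] Bc(2) B(3) diff_le_mono[OF Bc(3), of 1]
      by (auto simp: card_Diff_singleton)
    define G where "G = insert w G0"
    have "finite G0" using G0(1) Bc(2) by (auto intro: finite_subset)
    then have G: "G \<subseteq> B" "card G = m" "w \<in> G" "finite G"
      using G0 B(3) m by (auto simp: G_def card_insert_if)
    have "inj_on \<sigma> G" using inj by (rule inj_on_subset) (use G(1) Bc(1) in blast)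
    then have cG: "card (\<sigma> ` G) = m" using G(2) by (simp add: card_image)
    obtain i where i: "i \<in> {1..m}" "\<sigma> w = enum (\<sigma> ` G) i"
      using enum_inverse[of "\<sigma> ` G" "\<sigma> w"] G(3,4) cG by auto
    have "\<exists>F'\<subseteq>\<sigma> ` A. card F' = m \<and> enum F' i = \<sigma> w"
      by (rule exists_subset_with_enum) (use fA w neg i(1) in auto)
    then obtain F' where F': "F' \<subseteq> \<sigma> ` A" "card F' = m" "enum F' i = \<sigma> w" by blast
    obtain F where F: "F \<subseteq> A" "F' = \<sigma> ` F" using F'(1) by (auto simp: subset_image_iff)
    have "inj_on \<sigma> F" using inj by (rule inj_on_subset) (use F(1) An in blast)
    then have cF: "card F = m" using F'(2) F(2) by (simp add: card_image)
    have FFs: "F \<in> Fs" "G \<in> Fs" using clique_simplexD(4)[OF A F(1) cF] Bc(4)[OF G(1,2)] by auto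
    have "sorted_list_of_set (\<sigma> ` F) ! (i - 1) = sorted_list_of_set (\<sigma> ` G) ! (i - 1)"
      using F'(3) F(2) i(2) by (simp add: enum_def)
    moreover have "i - 1 < m" using i(1) by auto
    ultimately have all: "H \<in> (`) \<sigma> ` Fs" if "H \<subseteq> \<sigma> ` F \<union> \<sigma> ` G" "card H = m" for H
      using cl FFs that unfolding closed_wrt_def by blast
    have FGn: "F \<union> G \<subseteq> {1..n}" using F(1) An G(1) Bc(1) by blast
    have "clique_simplex n m Fs (F \<union> G)"
      unfolding clique_simplex_def
    proof (intro conjI allI impI)
      show "F \<union> G \<subseteq> {1..n}" by (rule FGn)
      have "finite (F \<union> G)" using FGn by (rule finite_subset) simp
      then show "m \<le> card (F \<union> G)" using card_mono[of "F \<union> G" F] cF by simp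
      fix H assume H: "H \<subseteq> F \<union> G \<and> card H = m"
      have "inj_on \<sigma> H" using inj by (rule inj_on_subset) (use H FGn in blast)
      then have "card (\<sigma> ` H) = m" using H by (simp add: card_image)
      then have "\<sigma> ` H \<in> (`) \<sigma> ` Fs" using H by (intro all) blast
      then show "H \<in> Fs" using H FGn by (intro pull) auto
    qed
    then obtain E where E: "E \<in> \<K>" "F \<union> G \<subseteq> E" using clique_simplex_in_clique by blast
    have "A = E" by (rule same_clique[OF A E(1) F(1) _ cF]) (use E(2) in blast)
    moreover have "B = E" by (rule same_clique[OF B(1) E(1) G(1) _ G(2)]) (use E(2) in blast)
    ultimately show False using B(2) by simp
  qed
  have injA: "inj_on \<sigma> (shared \<inter> A)" using inj by (rule inj_on_subset) (use An in blast)
  let ?L = "{w \<in> \<sigma> ` A. card {x \<in> \<sigma> ` A. x < w} + 2 \<le> m}"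
  let ?H = "{w \<in> \<sigma> ` A. card {x \<in> \<sigma> ` A. w < x} + 2 \<le> m}"
  have "\<sigma> ` (shared \<inter> A) \<subseteq> ?L \<union> ?H" using ext by blast
  then have "card (\<sigma> ` (shared \<inter> A)) \<le> card (?L \<union> ?H)" using fA by (intro card_mono) auto
  also have "\<dots> \<le> card ?L + card ?H" by (rule card_Un_le)
  also have "\<dots> \<le> 2 * (m - 1)" using card_extremal[of "\<sigma> ` A"] fA by simp
  finally show ?thesis using card_image[OF injA] by simp
qed

lemma cliques_nonempty: "\<K> \<noteq> {}"
  using tree by (auto simp: is_tree_def)

text \<open>When all cliques are \<open>apart\<close> at their shared vertices, facets that agree in
  a position lie in one clique, and all \<open>m\<close>-subsets of a clique are facets.\<close>

lemma closed_if_degree: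
  assumes deg: "\<And>A. A \<in> \<K> \<Longrightarrow> card (shared \<inter> A) \<le> 2 * (m - 1)"
  shows "is_closed n m Fs"
proof -
  obtain R where R: "R \<in> \<K>" using cliques_nonempty by blast
  have "R \<noteq> {}" using clique_simplexD(3)[OF R] m by auto
  \<comment> \<open>The top vertex of the root is taken among the shared vertices if there are any,
    so that it uses no additional end place.\<close>
  then have "\<exists>v\<in>R. shared \<inter> R \<noteq> {} \<longrightarrow> v \<in> shared" by blast
  then obtain v where v: "v \<in> R" "shared \<inter> R \<noteq> {} \<longrightarrow> v \<in> shared" by blast
  have "card (insert v (shared \<inter> R)) \<le> 2 * (m - 1)"
  proof (cases "shared \<inter> R = {}")
    case True
    then show ?thesis using m by simp
  next
    case False
    then have "insert v (shared \<inter> R) = shared \<inter> R" using v by blast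
    then show ?thesis using deg[OF R] by simp
  qed
  have m2: "2 \<le> m" using m by simp
  have "\<exists>f :: nat \<Rightarrow> int. inj_on f (\<Union>\<K>) \<and> (\<forall>x\<in>R - {v}. f x < f v)
    \<and> (\<forall>A\<in>\<K>. \<forall>w\<in>shared \<inter> A. peripheral m f A w)
    \<and> (\<forall>A\<in>\<K>. \<forall>B\<in>\<K>. \<forall>w\<in>A \<inter> B. A \<noteq> B \<longrightarrow> apart m f A B w)"
    by (rule tree_labelling[OF tree_family_cliques[OF R] clique_simplexD(2) deg shared_supset v(1)
          \<open>card (insert v (shared \<inter> R)) \<le> 2 * (m - 1)\<close> m2])
  then obtain f :: "nat \<Rightarrow> int" where f: "inj_on f (\<Union>\<K>)"
    "\<forall>A\<in>\<K>. \<forall>B\<in>\<K>. \<forall>w\<in>A \<inter> B. A \<noteq> B \<longrightarrow> apart m f A B w"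
    by (elim exE conjE)
  have Un: "\<Union>\<K> \<subseteq> {1..n}" using clique_simplexD(1) by blast
  obtain \<sigma> where \<sigma>: "\<sigma> permutes {1..n}" "\<forall>x\<in>\<Union>\<K>. \<forall>y\<in>\<Union>\<K>. \<sigma> x < \<sigma> y \<longleftrightarrow> f x < f y"
    using relabelling[OF f(1) Un] by blast
  have inj: "inj \<sigma>" by (rule permutes_inj[OF \<sigma>(1)])
  have ord: "\<sigma> x < \<sigma> y \<longleftrightarrow> f x < f y" if "x \<in> \<Union>\<K>" "y \<in> \<Union>\<K>" for x y using \<sigma>(2) that by blast
  have "closed_wrt m ((`) \<sigma> ` Fs)"
    unfolding closed_wrt_def
  proof (intro ballI impI allI)
    fix F' G' H assume FG: "F' \<in> (`) \<sigma> ` Fs" "G' \<in> (`) \<sigma> ` Fs"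
      and ex: "\<exists>i<m. sorted_list_of_set F' ! i = sorted_list_of_set G' ! i" and H: "H \<subseteq> F' \<union> G' \<and> card H = m"
    obtain F G where F: "F \<in> Fs" "F' = \<sigma> ` F" and G: "G \<in> Fs" "G' = \<sigma> ` G" using FG by blast
    obtain A where A: "A \<in> \<K>" "F \<subseteq> A" "card F = m" using F(1) facets_cliques by (auto simp: facets_def)
    obtain B where B: "B \<in> \<K>" "G \<subseteq> B" "card G = m" using G(1) facets_cliques by (auto simp: facets_def)
    have card: "card (\<sigma> ` X) = card X" for X using inj by (intro card_image inj_on_subset[OF inj]) simp
    have "A = B"
    proof (rule ccontr)
      assume ne: "A \<noteq> B"
      obtain i where i: "i < m" "sorted_list_of_set F' ! i = sorted_list_of_set G' ! i" using ex by blast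
      have AU: "A \<subseteq> \<Union>\<K>" "B \<subseteq> \<Union>\<K>" using A(1) B(1) by auto
      have ap: "apart m f A B w" if "w \<in> A \<inter> B" for w using f(2) A(1) B(1) ne that by blast
      have F'A: "F' \<subseteq> \<sigma> ` A" "card F' = m" and G'B: "G' \<subseteq> \<sigma> ` B" "card G' = m"
        using F(2) G(2) A(2,3) B(2,3) card by auto
      have "Suc i \<in> {1..m}" using i(1) by simp
      from enum_neq_if_apart[OF ord inj AU clique_simplexD(2)[OF A(1)] clique_simplexD(2)[OF B(1)] ap F'A G'B this]
      show False using i(2) by (simp add: enum_def)
    qed
    then have "H \<subseteq> \<sigma> ` A" using H F(2) G(2) A(2) B(2) by blast
    then obtain H0 where H0: "H0 \<subseteq> A" "H = \<sigma> ` H0" by (auto simp: subset_image_iff)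
    have "H0 \<in> Fs" using clique_simplexD(4)[OF A(1) H0(1)] H H0(2) card by simp
    then show "H \<in> (`) \<sigma> ` Fs" using H0(2) by blast
  qed
  then show ?thesis unfolding is_closed_def using permutes_imp_bij[OF \<sigma>(1)] by blast
qed

text \<open>Closedness acts through the degree bound of \<open>closed_degree\<close>, from which the
  labellings of the individual attachment steps are built.\<close>

lemma prime_if_closed:
  assumes "is_closed n m Fs"
  shows "prime_ideal_in (polyring m n :: 'a::field mpoly set) (J_Delta n m Fs)"
proof -
  obtain R where R: "R \<in> \<K>" using cliques_nonempty by blast
  have "prime_ideal_in (polys_in ({1..m} \<times> {1..n})) (minors_ideal n m \<K> :: 'a mpoly set)"
  proof (rule prime_tree_family[OF tree_family_cliques[OF R] _ _ closed_degree[OF assms] shared_supset])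
    show "A \<subseteq> {1..n} \<and> m \<le> card A" if "A \<in> \<K>" for A using clique_simplexD[OF that] by blast
    show "3 \<le> m" using m by simp
  qed
  then show ?thesis
    unfolding J_Delta_def minors_ideal_def facets_cliques polyring_eq .
qed

lemma closed_iff_degree:
  "is_closed n m Fs \<longleftrightarrow> (\<forall>A\<in>\<K>. G_degree n m Fs A \<le> min (card A) (2 * (m - 1)))"
proof
  assume closed: "is_closed n m Fs"
  show "\<forall>A\<in>\<K>. G_degree n m Fs A \<le> min (card A) (2 * (m - 1))"
  proof
    fix A assume A: "A \<in> \<K>"
    have "card (shared \<inter> A) \<le> card A" using clique_simplexD(2)[OF A] by (intro card_mono) auto
    then show "G_degree n m Fs A \<le> min (card A) (2 * (m - 1))"
      using closed_degree[OF closed A] degree_eq_card_shared[OF A] by simp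
  qed
next
  assume "\<forall>A\<in>\<K>. G_degree n m Fs A \<le> min (card A) (2 * (m - 1))"
  then show "is_closed n m Fs" using degree_eq_card_shared by (intro closed_if_degree) auto
qed

end

theorem theorem3p2:
  fixes n m :: nat and Fs :: "nat set set"
  assumes "pure_complex n m Fs"
    and "m - 1 \<ge> 2"
    and "cond_i n m Fs" and "cond_ii n m Fs"
    and "is_tree (cliques n m Fs) (G_adj n m Fs)"
  shows "(is_closed n m Fs \<longrightarrow>
            prime_ideal_in (polyring m n :: 'a::field mpoly set) (J_Delta n m Fs))
       \<and> (is_closed n m Fs \<longleftrightarrow>
            (\<forall>A\<in>cliques n m Fs. G_degree n m Fs A \<le> min (card A) (2 * (m - 1))))"
proof -
  interpret clique_tree n m Fs using assms by unfold_locales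
  show ?thesis using prime_if_closed closed_iff_degree by blast
qed

end
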